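(* Let $\{(x_k,y_k)\}$ be generated by the basic SCGD algorithm (defined in the context) under Assumption 1 (stated in the context), starting from an arbitrary initial point $(x_0,y_0)\in\mathcal X\times\mathbb R^m$, with stepsizes $\{\alpha_k\},\{\beta_k\}\subset(0,1]$ satisfying $$\sum_{k=0}^\infty \alpha_k=\infty,\qquad \sum_{k=0}^\infty\beta_k=\infty,\qquad \sum_{k=0}^\infty\Big(\alpha_k^2+\beta_k^2+\frac{\alpha_k^2}{\beta_k}\Big)<\infty .$$ Then: (a) If $F$ is convex and the problem $\min_{x\in\mathcal X}F(x)$ has at least one optimal solution, then $x_k$ converges almost surely to a (random) optimal solution of $\min_{x\in\mathcal X}F(x)$. (b) If $F$ is differentiable with Lipschitz continuous gradient and $\mathcal X=\mathbb R^n$, then with probability 1 every limit point of the sequence $\{x_k\}$ is a stationary point of $F$, i.e. a point $\bar x$ with $\nabla F(\bar x)=0$.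
   Context: Problem. Minimize $F(x)=f(g(x))$ over $x\in\mathcal X\subset\mathbb R^n$, where $f:\mathbb R^m\to\mathbb R$, $g:\mathbb R^n\to\mathbb R^m$, $f(y)=\mathbf E[f_v(y)]$, $g(x)=\mathbf E[g_w(x)]$ and $(w,v)$ is a pair of (possibly dependent) random variables. Standing assumption: the problem has at least one optimal solution $x^*\in\mathcal X$; $F^*=F(x^* )$. $\|\cdot\|$ is the Euclidean norm (operator norm for matrices) and $\Pi_{\mathcal X}$ is Euclidean projection onto $\mathcal X$. $\partial F(x)$ is the subdifferential of $F$ at $x$, equal to $\{\nabla F(x)\}$ when $F$ is differentiable. For each realization $w$ and each $x\in\mathcal X$, $\widetilde\nabla g_w(x)\in\mathbb R^{n\times m}$ is a given random matrix (a noisy generalized gradient of $g$, whose $j$-th column corresponds to the $j$-th component of $g$). Assumption 1. There are positive scalars $C_g,C_f,V_g,L_f$ such that: (i) $f$ is continuously differentiable, $g$ is continuous, $\mathcal X$ is nonempty, closed and convex. (ii) $(w_0,v_0),(w_1,v_1),\dots$ are i.i.d. (copies of $(w,v)$), and with probability 1, for all $x\in\mathcal X$, $\mathbf E[g_{w_0}(x)\mid v_0]=g(x)$ and $\mathbf E[\widetilde\nabla g_{w_0}(x)\nabla f_{v_0}(g(x))\mid v_0]\in\partial F(x)$. (iii) $g$ is Lipschitz continuous with parameter $C_g$, and with probability 1, for all $x\in\mathcal X$, $\mathbf E[\|\widetilde\nabla g_{w_0}(x)\|^2\mid v_0]\le C_g$ and $\mathbf E[\|g_{w_0}(x)-g(x)\|^2\mid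 v_0]\le V_g$. (iv) With probability 1, for all $y,\bar y\in\mathbb R^m$, $\mathbf E[\|\nabla f_{v_0}(y)\|^2\mid w_0]\le C_f$ and $\|\nabla f_{v_0}(y)-\nabla f_{v_0}(\bar y)\|\le L_f\|y-\bar y\|$; $f$ likewise has Lipschitz continuous gradient. Basic SCGD algorithm. Given deterministic $x_0\in\mathcal X$, $y_0\in\mathbb R^m$ and stepsizes $\alpha_k,\beta_k$, for $k=0,1,2,\dots$: $$y_{k+1}=(1-\beta_k)y_k+\beta_k g_{w_k}(x_k),\qquad x_{k+1}=\Pi_{\mathcal X}\big\{x_k-\alpha_k\widetilde\nabla g_{w_k}(x_k)\nabla f_{v_k}(y_{k+1})\big\}.$$ *)

theory Defs
  imports "HOL-Probability.Probability"
begin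

definition grad :: "('a::real_inner \<Rightarrow> real) \<Rightarrow> 'a \<Rightarrow> 'a" where
  "grad F x = (THE D. GDERIV F x :> D)"

(* For convex F the two branches agree where F is differentiable (see the lemma
   subdifferential_convex below). The first branch is there for nonconvex differentiable F,
   where the set in the second branch may be empty. *)
definition subdifferential :: "('a::real_inner \<Rightarrow> real) \<Rightarrow> 'a \<Rightarrow> 'a set" where
  "subdifferential F x =
     (if F differentiable (at x) then {grad F x}
      else {s. \<forall>z. F z \<ge> F x + s \<bullet> (z - x)})"

(* E[Z | F] is determined only up to a null set, separately for each Z. A condition of the form
   "with probability 1, for all x, E[Z x | F] ..." on an uncountable family Z is therefore read
   as: the E[Z x | F] have versions for which it holds with probability 1 for all x at once. *)
definition cond_exp_version ::
  "'a measure \<Rightarrow> 'a measure \<Rightarrow> ('a \<Rightarrow> real^'n) \<Rightarrow> ('a \<Rightarrow> real^'n) \<Rightarrow> bool" where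
  "cond_exp_version M F Z Y \<longleftrightarrow>
     integrable M Z \<and> Y \<in> borel_measurable F \<and>
     (\<forall>i. AE \<omega> in M. Y \<omega> $ i = real_cond_exp M F (\<lambda>\<omega>. Z \<omega> $ i) \<omega>)"

(* For nonnegative Z the values are kept in ennreal: real_cond_exp returns 0 where the
   conditional expectation is infinite, which would make an upper bound on it meaningless. *)
definition nn_cond_exp_version ::
  "'a measure \<Rightarrow> 'a measure \<Rightarrow> ('a \<Rightarrow> ennreal) \<Rightarrow> ('a \<Rightarrow> ennreal) \<Rightarrow> bool" where
  "nn_cond_exp_version M F Z Y \<longleftrightarrow>
     Z \<in> borel_measurable M \<and> Y \<in> borel_measurable F \<and>
     (AE \<omega> in M. Y \<omega> = nn_cond_exp M F Z \<omega>)"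

(* An n x m matrix has type real^'m^'n; Gs is the noisy generalized gradient of g, and its
   values outside X are irrelevant. vimage_algebra (space M) (v 0) V is the sigma-algebra
   generated by v 0. Measurability of the random functions is what makes the iterates random
   variables. *)
locale stochastic_composition = prob_space M
  for M :: "'a measure" +
  fixes W :: "'w measure" and V :: "'v measure"
    and w :: "nat \<Rightarrow> 'a \<Rightarrow> 'w" and v :: "nat \<Rightarrow> 'a \<Rightarrow> 'v"
    and X :: "(real^'n) set"
    and f :: "real^'m \<Rightarrow> real" and g :: "real^'n \<Rightarrow> real^'m"
    and fs :: "'v \<Rightarrow> real^'m \<Rightarrow> real" and gs :: "'w \<Rightarrow> real^'n \<Rightarrow> real^'m"
    and Gs :: "'w \<Rightarrow> real^'n \<Rightarrow> real^'m^'n"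
    and Cg Cf Vg Lf :: real
  assumes fs_measurable: "case_prod fs \<in> borel_measurable (V \<Otimes>\<^sub>M borel)"
    and gs_measurable: "case_prod gs \<in> borel_measurable (W \<Otimes>\<^sub>M borel)"
    and Gs_measurable: "case_prod Gs \<in> borel_measurable (W \<Otimes>\<^sub>M restrict_space borel X)"
    and fs_differentiable: "\<And>c y. c \<in> space V \<Longrightarrow> fs c differentiable (at y)"
    and f_expectation:
      "\<And>y. integrable M (\<lambda>\<omega>. fs (v 0 \<omega>) y)" "\<And>y. f y = expectation (\<lambda>\<omega>. fs (v 0 \<omega>) y)"
    and g_expectation:
      "\<And>x. integrable M (\<lambda>\<omega>. gs (w 0 \<omega>) x)" "\<And>x. g x = expectation (\<lambda>\<omega>. gs (w 0 \<omega>) x)"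
    and optimal_exists: "\<exists>z. is_arg_min (f \<circ> g) (\<lambda>x. x \<in> X) z"
    and constants_pos: "Cg > 0" "Cf > 0" "Vg > 0" "Lf > 0"
    and f_C1: "\<And>y. f differentiable (at y)" "continuous_on UNIV (grad f)"
    and g_continuous: "continuous_on UNIV g"
    and X_props: "X \<noteq> {}" "closed X" "convex X"
    and independent: "indep_vars (\<lambda>_. W \<Otimes>\<^sub>M V) (\<lambda>k \<omega>. (w k \<omega>, v k \<omega>)) UNIV"
    and identically_distributed:
      "\<And>k. distr M (W \<Otimes>\<^sub>M V) (\<lambda>\<omega>. (w k \<omega>, v k \<omega>)) =
            distr M (W \<Otimes>\<^sub>M V) (\<lambda>\<omega>. (w 0 \<omega>, v 0 \<omega>))"
    and gs_unbiased:
      "\<exists>E. (\<forall>x\<in>X. cond_exp_version M (vimage_algebra (space M) (v 0) V)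
                     (\<lambda>\<omega>. gs (w 0 \<omega>) x) (E x)) \<and>
           (AE \<omega> in M. \<forall>x\<in>X. E x \<omega> = g x)"
    and gradient_unbiased:
      "\<exists>E. (\<forall>x\<in>X. cond_exp_version M (vimage_algebra (space M) (v 0) V)
                     (\<lambda>\<omega>. Gs (w 0 \<omega>) x *v grad (fs (v 0 \<omega>)) (g x)) (E x)) \<and>
           (AE \<omega> in M. \<forall>x\<in>X. E x \<omega> \<in> subdifferential (f \<circ> g) x)"
    and g_lipschitz: "Cg-lipschitz_on UNIV g"
    and Gs_second_moment:
      "\<exists>E. (\<forall>x\<in>X. nn_cond_exp_version M (vimage_algebra (space M) (v 0) V)
                     (\<lambda>\<omega>. ennreal ((onorm (\<lambda>z. Gs (w 0 \<omega>) x *v z))\<^sup>2)) (E x)) \<and>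
           (AE \<omega> in M. \<forall>x\<in>X. E x \<omega> \<le> ennreal Cg)"
    and gs_variance:
      "\<exists>E. (\<forall>x\<in>X. nn_cond_exp_version M (vimage_algebra (space M) (v 0) V)
                     (\<lambda>\<omega>. ennreal ((norm (gs (w 0 \<omega>) x - g x))\<^sup>2)) (E x)) \<and>
           (AE \<omega> in M. \<forall>x\<in>X. E x \<omega> \<le> ennreal Vg)"
    and fs_second_moment:
      "\<exists>E. (\<forall>y. nn_cond_exp_version M (vimage_algebra (space M) (w 0) W)
                     (\<lambda>\<omega>. ennreal ((norm (grad (fs (v 0 \<omega>)) y))\<^sup>2)) (E y)) \<and>
           (AE \<omega> in M. \<forall>y. E y \<omega> \<le> ennreal Cf)"
    \<comment> \<open>Stated for the law of v 0, so that it passes to every v k.\<close>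
    and fs_gradient_lipschitz: "AE c in distr M V (v 0). Lf-lipschitz_on UNIV (grad (fs c))"
    and f_gradient_lipschitz: "\<exists>L. L-lipschitz_on UNIV (grad f)"

lemma grad_eqI: "GDERIV F x :> D \<Longrightarrow> grad F x = D"
  unfolding grad_def gderiv_def
  by (rule the_equality, assumption)
     (metis has_derivative_unique inner_commute vector_eq_ldot)

lemma GDERIV_grad:
  fixes F :: "'a::euclidean_space \<Rightarrow> real"
  assumes "F differentiable (at x)"
  shows "GDERIV F x :> grad F x"
proof -
  obtain F' where F': "(F has_derivative F') (at x)"
    using assms by (auto simp: differentiable_def)
  then interpret linear F'
    by (rule has_derivative_linear)
  have "F' = (\<lambda>h. h \<bullet> (\<Sum>b\<in>Basis. F' b *\<^sub>R b))"
  proof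
    fix h
    have "F' h = F' (\<Sum>b\<in>Basis. (h \<bullet> b) *\<^sub>R b)"
      by (simp add: euclidean_representation)
    also have "\<dots> = h \<bullet> (\<Sum>b\<in>Basis. F' b *\<^sub>R b)"
      by (simp add: sum scale inner_sum_right mult.commute)
    finally show "F' h = h \<bullet> (\<Sum>b\<in>Basis. F' b *\<^sub>R b)" .
  qed
  then have "GDERIV F x :> (\<Sum>b\<in>Basis. F' b *\<^sub>R b)"
    using F' by (simp add: gderiv_def)
  then show ?thesis
    using grad_eqI by metis
qed

lemma subdifferential_convex:
  fixes F :: "'a::euclidean_space \<Rightarrow> real"
  assumes conv: "convex_on UNIV F"
  shows "subdifferential F x = {s. \<forall>z. F z \<ge> F x + s \<bullet> (z - x)}"
proof (cases "F differentiable (at x)")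
  case True
  then have D: "(F has_derivative (\<lambda>h. h \<bullet> grad F x)) (at x)"
    using GDERIV_grad by (auto simp: gderiv_def)
  have "F z \<ge> F x + grad F x \<bullet> (z - x)" for z
  proof -
    define p where "p = (\<lambda>t::real. F (x + t *\<^sub>R (z - x)))"
    have "((\<lambda>t::real. x + t *\<^sub>R (z - x)) has_derivative (\<lambda>t. t *\<^sub>R (z - x))) (at 0)"
      by (auto intro!: derivative_eq_intros)
    moreover have "(F has_derivative (\<lambda>h. h \<bullet> grad F x)) (at (x + 0 *\<^sub>R (z - x)))"
      using D by simp
    ultimately have "(p has_derivative (\<lambda>t. (t *\<^sub>R (z - x)) \<bullet> grad F x)) (at 0)"
      unfolding p_def by (rule has_derivative_compose)
    then have "(p has_field_derivative (grad F x \<bullet> (z - x))) (at 0)"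
      by (rule has_derivative_imp_has_field_derivative) (simp add: inner_commute)
    moreover have "convex_on UNIV p"
    proof (rule convex_onI)
      fix t a b :: real
      assume "0 < t" "t < 1"
      have "x + ((1 - t) * a + t * b) *\<^sub>R (z - x)
          = (1 - t) *\<^sub>R (x + a *\<^sub>R (z - x)) + t *\<^sub>R (x + b *\<^sub>R (z - x))"
        by (simp add: algebra_simps)
      then show "p ((1 - t) *\<^sub>R a + t *\<^sub>R b) \<le> (1 - t) * p a + t * p b"
        using convex_onD[OF conv, of t] \<open>0 < t\<close> \<open>t < 1\<close> by (simp add: p_def)
    qed simp
    ultimately have "p 1 - p 0 \<ge> (grad F x \<bullet> (z - x)) * (1 - 0)"
      by (intro convex_on_imp_above_tangent[where A = UNIV]) auto
    then show ?thesis
      by (simp add: p_def)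
  qed
  moreover have "s = grad F x" if "\<forall>z. F z \<ge> F x + s \<bullet> (z - x)" for s
  proof -
    have "((\<lambda>z. F z - s \<bullet> (z - x)) has_derivative (\<lambda>h. h \<bullet> grad F x - s \<bullet> h)) (at x)"
      using D by (auto intro!: derivative_eq_intros)
    then have "(\<lambda>h. h \<bullet> grad F x - s \<bullet> h) = (\<lambda>h. 0)"
      using that by (intro differential_zero_maxmin[where S = UNIV]) (auto simp: algebra_simps)
    then have "(grad F x - s) \<bullet> h = 0" for h
      by (metis inner_commute inner_diff_left)
    then show ?thesis
      by (metis inner_eq_zero_iff right_minus_eq)
  qed
  ultimately show ?thesis
    using True by (auto simp: subdifferential_def)
qed (simp add: subdifferential_def)

end

theory Submission
  imports Defs
begin

text \<open>
  The lag \<open>norm (y k - g (x k))\<close> contracts by the factor \<open>1 - \<beta> k\<close> in mean square, up to summable errors,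
  so \<open>\<beta> k * E[(norm (y (k+1) - g (x k)))\<^sup>2]\<close> is summable. Split the search direction
  into the mean gradient, a martingale difference, and the bias caused by evaluating \<open>\<nabla>f\<^sub>v\<close> at \<open>y (k+1)\<close>
  instead of \<open>g (x k)\<close>. By Young's inequality the bias costs \<open>\<alpha>\<^sup>2/\<beta>\<close> plus the summable lag terms. Hence
  a Lyapunov function (the squared distance to a solution in the convex case, \<open>F - F\<^sup>*\<close> in the smooth
  case) obeys a recursion with deterministic coefficients. Taking expectations bounds
  its moments, so that the martingale part is bounded in \<open>L\<^sup>2\<close> and converges almost surely by
  Kolmogorov's maximal inequality; the other error terms have summable expectations. The rest is
  deterministic: Fejer monotonicity in the convex case, and in the smooth case the fact
  that \<open>x (k+1) = x k - \<alpha> k \<nabla>F (x k) + r k\<close> with \<open>\<Sum> r k\<close> convergent and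
  \<open>\<Sum> \<alpha> k (norm (\<nabla>F (x k)))\<^sup>2\<close> finite.
\<close>

subsection \<open>Deterministic recursions\<close>

text \<open>The direction at step \<open>k\<close> is evaluated at \<open>y (Suc k)\<close>, which
  already contains the sample \<open>w k\<close>. So it is not an unbiased gradient, and its second
  moment does not follow from bounds at a fixed point: the bound on the gradient of
  \<open>fs\<close> must be applied conditionally on \<open>w k\<close>, with a weight that depends
  on \<open>w k\<close>.

  No moments of the iterates are given, so integrability is proved along with each recursion.
  Expectations precede the pathwise statements because the bias is charged
  \<open>\<alpha>\<^sup>2/\<beta>\<close> times the squared field that multiplies the direction, and
  the summability of these terms rests on a bounded mean of the Lyapunov function.

  Independence enters only as the product form of the joint law of past and current sample. The
  conditional expectations in the hypotheses are averaged out for a single sample at once.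

  In the smooth case the iterates may be unbounded, which rules out a compactness argument. The
  gradient is shown to vanish along the whole sequence, and limit points inherit this by
  continuity.\<close>

lemma almost_supermartingale_recursion:
  fixes d q \<eta> \<mu> :: "nat \<Rightarrow> real"
  assumes nonneg: "\<And>k. 0 \<le> d k" "\<And>k. 0 \<le> q k" "\<And>k. 0 \<le> \<eta> k" "\<And>k. 0 \<le> \<mu> k"
    and step: "\<And>k. d (Suc k) \<le> (1 + \<eta> k) * d k - q k + \<mu> k"
    and summable: "summable \<eta>" "summable \<mu>"
  shows "\<exists>B. \<forall>k. d k \<le> B" and "summable q"
proof -
  \<comment> \<open>The constant comes from \<open>1 + \<eta> k \<le> exp (\<eta> k)\<close>: the
    growth factors multiply to at most the exponential of the whole sum, and each
    \<open>\<mu> k\<close> is amplified by no more than that.\<close>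
  define B where "B = exp (suminf \<eta>) * (d 0 + suminf \<mu>)"
  have "d k \<le> exp (sum \<eta> {..<k}) * (d 0 + sum \<mu> {..<k})" for k
  proof (induction k)
    case (Suc k)
    have e1: "1 \<le> exp (sum \<eta> {..<Suc k})"
      using nonneg by (simp add: sum_nonneg)
    have "(1 + \<eta> k) * d k \<le> exp (\<eta> k) * (exp (sum \<eta> {..<k}) * (d 0 + sum \<mu> {..<k}))"
      using Suc nonneg by (intro mult_mono) auto
    also have "\<dots> = exp (sum \<eta> {..<Suc k}) * (d 0 + sum \<mu> {..<k})"
      by (simp add: exp_add)
    finally have "d (Suc k) \<le> exp (sum \<eta> {..<Suc k}) * (d 0 + sum \<mu> {..<k}) + 1 * \<mu> k"
      using step[of k] nonneg(2)[of k] by simp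
    also have "\<dots> \<le> exp (sum \<eta> {..<Suc k}) * (d 0 + sum \<mu> {..<k})
        + exp (sum \<eta> {..<Suc k}) * \<mu> k"
      using e1 nonneg by (intro add_left_mono mult_right_mono)
    also have "\<dots> = exp (sum \<eta> {..<Suc k}) * (d 0 + sum \<mu> {..<Suc k})"
      by (simp add: algebra_simps)
    finally show ?case .
  qed simp
  moreover have "exp (sum \<eta> {..<k}) * (d 0 + sum \<mu> {..<k}) \<le> B" for k
    unfolding B_def using nonneg summable
    by (intro mult_mono add_mono add_nonneg_nonneg sum_nonneg suminf_nonneg)
       (auto intro!: sum_le_suminf)
  ultimately have B: "d k \<le> B" for k
    by (meson order_trans)
  then show "\<exists>B. \<forall>k. d k \<le> B"
    by blast
  have "0 \<le> B"
    using nonneg(1) B by (meson order_trans)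
  \<comment> \<open>With \<open>d\<close> bounded by \<open>B\<close>, the growth
    \<open>\<eta> k * d k\<close> is a summable error and the recursion telescopes.\<close>
  have "sum q {..<n} \<le> d 0 - d n + (\<Sum>k<n. B * \<eta> k + \<mu> k)" for n
  proof (induction n)
    case (Suc n)
    have "\<eta> n * d n \<le> B * \<eta> n"
      using mult_left_mono[OF B nonneg(3)] by (simp add: mult.commute)
    then show ?case
      using Suc step[of n] by (simp add: algebra_simps)
  qed simp
  moreover have "(\<Sum>k<n. B * \<eta> k + \<mu> k) \<le> (\<Sum>k. B * \<eta> k + \<mu> k)" for n
    using nonneg summable \<open>0 \<le> B\<close>
    by (intro sum_le_suminf summable_add summable_mult) auto
  ultimately have "sum q {..<n} \<le> d 0 + (\<Sum>k. B * \<eta> k + \<mu> k)" for n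
    using nonneg(1)[of n] by (meson add_mono diff_le_eq le_add_same_cancel1 order_trans)
  then show "summable q"
    using nonneg(2) by (intro summableI_nonneg_bounded)
qed

text \<open>Subtracting the partial sums of \<open>m\<close> leaves a decreasing sequence bounded
  below. The errors may have either sign and need only converge conditionally, as those of the
  martingale part do.\<close>

lemma convergent_almost_decreasing:
  fixes u m :: "nat \<Rightarrow> real"
  assumes "\<And>k. 0 \<le> u k" "\<And>k. u (Suc k) \<le> u k + m k" "summable m"
  shows "convergent u"
proof -
  define t where "t = (\<lambda>n. u n - (\<Sum>k<n. m k))"
  have dec: "decseq t"
    unfolding t_def using assms(2) by (intro decseq_SucI) (auto simp: algebra_simps)
  have sums: "(\<lambda>n. \<Sum>k<n. m k) \<longlonglongrightarrow> suminf m"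
    using assms(3) summable_LIMSEQ by blast
  then obtain K where "\<And>n. \<bar>\<Sum>k<n. m k\<bar> \<le> K"
    using convergent_imp_Bseq[OF convergentI[OF sums]] unfolding Bseq_def real_norm_def by blast
  then have "- K \<le> t n" for n
    unfolding t_def using assms(1)[of n] by (smt (verit))
  then obtain l where "t \<longlonglongrightarrow> l"
    using decseq_convergent[OF dec] by metis
  from tendsto_add[OF this sums] show ?thesis
    by (auto simp: t_def convergent_def)
qed

text \<open>Otherwise \<open>\<epsilon> * \<alpha>\<close> would eventually be dominated by a
  summable series, against the divergence of the stepsizes. This supplies nearly optimal times in
  the convex case and times of small gradient in the smooth case.\<close>

lemma small_infinitely_often:
  fixes \<alpha> q :: "nat \<Rightarrow> real"
  assumes "filterlim (\<lambda>N. \<Sum>k<N. \<alpha> k) at_top sequentially"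
    and "\<And>k. 0 < \<alpha> k" "summable (\<lambda>k. \<alpha> k * q k)" "0 < \<epsilon>"
  shows "\<exists>k\<ge>N. q k < \<epsilon>"
proof (rule ccontr)
  assume *: "\<not> (\<exists>k\<ge>N. q k < \<epsilon>)"
  have "summable (\<lambda>k. \<epsilon> * \<alpha> k)"
  proof (rule summable_comparison_test'[OF assms(3), of N])
    fix n assume "N \<le> n"
    then have "\<epsilon> \<le> q n"
      using * by auto
    then show "norm (\<epsilon> * \<alpha> n) \<le> \<alpha> n * q n"
      using assms(2)[of n] assms(4) by (simp add: abs_mult mult.commute)
  qed
  then have "summable \<alpha>"
    using assms(4) by (simp add: summable_mult_D)
  then show False
    using assms(1) summable_LIMSEQ
    by (metis filterlim_at_top_imp_at_infinity not_tendsto_and_filterlim_at_infinity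
        sequentially_bot)
qed

text \<open>From any late time, run until the field is small: up to then the steps it drives are
  dominated by the summable \<open>\<alpha> k * (norm (D (x k)))\<^sup>2\<close>.\<close>

lemma perturbed_flow_field_tendsto_0:
  fixes x r :: "nat \<Rightarrow> 'b::euclidean_space" and D :: "'b \<Rightarrow> 'b"
  assumes \<alpha>: "filterlim (\<lambda>N. \<Sum>k<N. \<alpha> k) at_top sequentially" "\<And>k. 0 < \<alpha> k"
    and step: "\<And>k. x (Suc k) = x k - \<alpha> k *\<^sub>R D (x k) + r k"
    and lip: "L-lipschitz_on UNIV D"
    and sumD: "summable (\<lambda>k. \<alpha> k * (norm (D (x k)))\<^sup>2)" and sumr: "summable r"
  shows "(\<lambda>k. D (x k)) \<longlonglongrightarrow> 0"
proof -
  have L: "0 \<le> L"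
    using lip lipschitz_on_nonneg by blast
  \<comment> \<open>The field at the stopping time contributes \<open>\<epsilon>\<close>, and a
    displacement of at most \<open>2 * \<epsilon>\<close> contributes
    \<open>2 * L * \<epsilon>\<close>; the remaining \<open>\<epsilon>\<close> is slack.\<close>
  have "\<exists>N. \<forall>n\<ge>N. norm (D (x n)) < (2 + 2 * L) * \<epsilon>" if \<epsilon>: "0 < \<epsilon>" for \<epsilon>
  proof -
    \<comment> \<open>The tolerance is \<open>\<epsilon>\<^sup>2\<close> because the tail gets
      divided by \<open>\<epsilon>\<close>: where the norm of the field is at least
      \<open>\<epsilon>\<close>, it is at most its square over \<open>\<epsilon>\<close>.\<close>
    obtain N1 where N1: "\<And>m n. m \<ge> N1 \<Longrightarrow> norm (\<Sum>k=m..<n. \<alpha> k * (norm (D (x k)))\<^sup>2) < \<epsilon>\<^sup>2"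
      using sumD \<epsilon> unfolding summable_Cauchy by (metis zero_less_power)
    obtain N2 where N2: "\<And>m n. m \<ge> N2 \<Longrightarrow> norm (\<Sum>k=m..<n. r k) < \<epsilon>"
      using sumr \<epsilon> unfolding summable_Cauchy by metis
    have "norm (D (x n)) < (2 + 2 * L) * \<epsilon>" if n: "n \<ge> max N1 N2" for n
    proof -
      obtain p0 where p0: "p0 \<ge> n" "(norm (D (x p0)))\<^sup>2 < \<epsilon>\<^sup>2"
        using small_infinitely_often[OF \<alpha> sumD, of "\<epsilon>\<^sup>2" n] \<epsilon> by auto
      define p where "p = (LEAST p. p \<ge> n \<and> norm (D (x p)) < \<epsilon>)"
      have "\<exists>p. p \<ge> n \<and> norm (D (x p)) < \<epsilon>"
        using p0 \<epsilon> power2_less_imp_less by (metis less_imp_le)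
      then have p: "p \<ge> n" "norm (D (x p)) < \<epsilon>"
        unfolding p_def by (metis (mono_tags, lifting) LeastI_ex)+
      have large: "\<epsilon> \<le> norm (D (x k))" if "k \<in> {n..<p}" for k
        using that not_less_Least[of k "\<lambda>p. p \<ge> n \<and> norm (D (x p)) < \<epsilon>"] unfolding p_def by auto
      have tele: "x m - x n = - (\<Sum>k=n..<m. \<alpha> k *\<^sub>R D (x k)) + (\<Sum>k=n..<m. r k)" if "m \<ge> n" for m
        using that
      proof (induction m rule: dec_induct)
        case (step m)
        then show ?case
          using assms(3)[of m] by simp
      qed simp
      have "norm (\<Sum>k=n..<p. \<alpha> k *\<^sub>R D (x k)) \<le> (\<Sum>k=n..<p. \<alpha> k * norm (D (x k)))"
        by (rule order_trans[OF norm_sum]) (simp add: \<alpha>(2) abs_of_pos)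
      also have "\<dots> \<le> (\<Sum>k=n..<p. (\<alpha> k * (norm (D (x k)))\<^sup>2) / \<epsilon>)"
      proof (rule sum_mono)
        fix k assume "k \<in> {n..<p}"
        then have "\<alpha> k * norm (D (x k)) * \<epsilon> \<le> \<alpha> k * norm (D (x k)) * norm (D (x k))"
          using large \<alpha>(2)[of k] by (intro mult_left_mono) auto
        then show "\<alpha> k * norm (D (x k)) \<le> \<alpha> k * (norm (D (x k)))\<^sup>2 / \<epsilon>"
          using \<epsilon> by (simp add: field_simps power2_eq_square)
      qed
      also have "\<dots> = (\<Sum>k=n..<p. \<alpha> k * (norm (D (x k)))\<^sup>2) / \<epsilon>"
        by (simp add: sum_divide_distrib)
      also have "\<dots> \<le> \<epsilon>"
        using N1[of n p] n \<epsilon> by (simp add: field_simps power2_eq_square)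
      finally have "norm (x p - x n) \<le> 2 * \<epsilon>"
        using tele[OF p(1)] N2[of n p] n norm_triangle_ineq4 by (smt (verit) max.boundedE
            norm_triangle_ineq norm_minus_cancel)
      then have "norm (D (x p) - D (x n)) \<le> L * (2 * \<epsilon>)"
        using lipschitz_onD[OF lip, of "x p" "x n"] L
        by (smt (verit) UNIV_I dist_norm mult_left_mono)
      moreover have "norm (D (x n)) \<le> norm (D (x p)) + norm (D (x p) - D (x n))"
        by (metis norm_minus_commute norm_triangle_sub)
      ultimately show ?thesis
        using p(2) \<epsilon> by (simp add: algebra_simps)
    qed
    then show ?thesis
      by blast
  qed
  note * = this
  show ?thesis
  proof (rule LIMSEQ_I)
    fix e :: real assume "0 < e"
    moreover have "0 < 2 + 2 * L"
      using L by simp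
    ultimately show "\<exists>N. \<forall>n\<ge>N. norm (D (x n) - 0) < e"
      using *[of "e / (2 + 2 * L)"] by simp
  qed
qed

subsection \<open>Square-integrable martingales\<close>

lemma (in prob_space) AE_summable_expectation:
  fixes Y :: "nat \<Rightarrow> 'a \<Rightarrow> real"
  assumes "\<And>k \<omega>. 0 \<le> Y k \<omega>" "\<And>k. integrable M (Y k)" "summable (\<lambda>k. expectation (Y k))"
  shows "AE \<omega> in M. summable (\<lambda>k. Y k \<omega>)"
proof -
  have [measurable]: "Y k \<in> borel_measurable M" for k
    using assms(2) by auto
  have "(\<integral>\<^sup>+\<omega>. (\<Sum>k. ennreal (Y k \<omega>)) \<partial>M) = (\<Sum>k. ennreal (expectation (Y k)))"
    using assms by (simp add: nn_integral_suminf nn_integral_eq_integral)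
  also have "\<dots> = ennreal (\<Sum>k. expectation (Y k))"
    using assms by (intro suminf_ennreal2 Bochner_Integration.integral_nonneg) auto
  finally have "AE \<omega> in M. (\<Sum>k. ennreal (Y k \<omega>)) \<noteq> \<infinity>"
    by (intro nn_integral_PInf_AE) auto
  then show ?thesis
    by (rule AE_mp) (use assms(1) in \<open>auto intro!: AE_I2 summable_suminf_not_top\<close>)
qed

lemma integrable_mult_of_squares:
  fixes f g :: "'b \<Rightarrow> real"
  assumes [measurable]: "f \<in> borel_measurable M" "g \<in> borel_measurable M"
    and "integrable M (\<lambda>x. (f x)\<^sup>2)" "integrable M (\<lambda>x. (g x)\<^sup>2)"
  shows "integrable M (\<lambda>x. f x * g x)"
proof (rule Bochner_Integration.integrable_bound)
  show "integrable M (\<lambda>x. (f x)\<^sup>2 + (g x)\<^sup>2)"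
    using assms by auto
  have "\<bar>a * b\<bar> \<le> a\<^sup>2 + b\<^sup>2" for a b :: real
  proof -
    have "2 * (\<bar>a\<bar> * \<bar>b\<bar>) \<le> a\<^sup>2 + b\<^sup>2"
      using sum_squares_bound[of "\<bar>a\<bar>" "\<bar>b\<bar>"] by (simp add: mult.assoc)
    moreover have "0 \<le> \<bar>a\<bar> * \<bar>b\<bar>"
      by simp
    ultimately show ?thesis
      unfolding abs_mult by linarith
  qed
  then show "AE x in M. norm (f x * g x) \<le> norm ((f x)\<^sup>2 + (g x)\<^sup>2)"
    by (intro AE_I2) (simp add: order_trans[OF _ abs_ge_self])
qed auto

text \<open>Moment bounds are first derived for the extended integral, where nothing has to be
  integrable beforehand, and are then transferred to the real one.\<close>

lemma integrable_of_nn_integral_bound: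
  fixes h :: "'b \<Rightarrow> real"
  assumes [measurable]: "h \<in> borel_measurable N" and nonneg: "\<And>\<omega>. 0 \<le> h \<omega>"
    and bound: "(\<integral>\<^sup>+\<omega>. ennreal (h \<omega>) \<partial>N) \<le> ennreal c" and c: "0 \<le> c"
  shows "integrable N h" and "integral\<^sup>L N h \<le> c"
proof -
  have "(\<integral>\<^sup>+\<omega>. ennreal (norm (h \<omega>)) \<partial>N) < \<infinity>"
    using bound nonneg by (simp add: le_less_trans)
  then show h: "integrable N h"
    by (intro integrableI_bounded) auto
  show "integral\<^sup>L N h \<le> c"
    using nn_integral_eq_integral[OF h] nonneg bound c by simp
qed

text \<open>\<open>stopped_sum D \<epsilon> N n\<close> is the increment of the partial sums of \<open>D\<close> over the \<open>n\<close> indices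
  from \<open>N\<close> on, frozen as soon as its absolute value reaches \<open>\<epsilon>\<close>.\<close>

primrec stopped_sum :: "(nat \<Rightarrow> 'a \<Rightarrow> real) \<Rightarrow> real \<Rightarrow> nat \<Rightarrow> nat \<Rightarrow> 'a \<Rightarrow> real" where
  "stopped_sum D \<epsilon> N 0 \<omega> = 0"
| "stopped_sum D \<epsilon> N (Suc n) \<omega> = stopped_sum D \<epsilon> N n \<omega> +
     (if \<bar>stopped_sum D \<epsilon> N n \<omega>\<bar> < \<epsilon> then D (N + n) \<omega> else 0)"

lemma stopped_sum_mono:
  assumes "\<epsilon> \<le> \<bar>stopped_sum D \<epsilon> N n \<omega>\<bar>" "n \<le> m"
  shows "stopped_sum D \<epsilon> N m \<omega> = stopped_sum D \<epsilon> N n \<omega>"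
  using assms(2) by (induction m rule: dec_induct) (use assms(1) in auto)

lemma stopped_sum_eq:
  assumes "\<And>m. \<bar>stopped_sum D \<epsilon> N m \<omega>\<bar> < \<epsilon>"
  shows "stopped_sum D \<epsilon> N n \<omega> = (\<Sum>k=N..<N+n. D k \<omega>)"
proof (induction n)
  case (Suc n)
  then show ?case
    using assms[of n] by simp
qed simp

context prob_space
begin

text \<open>\<open>orth\<close> is the martingale difference property, tested against
  square-integrable variables of the past, so no conditional expectation occurs. Whether the sum is
  frozen is known before the next increment, hence stopping preserves orthogonality and can only
  reduce the second moments.\<close>

lemma stopped_sum_second_moment:
  fixes D :: "nat \<Rightarrow> 'a \<Rightarrow> real" and F :: "nat \<Rightarrow> 'a measure"
  assumes sub: "\<And>k. (\<lambda>\<omega>. \<omega>) \<in> measurable M (F k)"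
    and mono: "\<And>k. (\<lambda>\<omega>. \<omega>) \<in> measurable (F (Suc k)) (F k)"
    and adapted: "\<And>k. D k \<in> borel_measurable (F (Suc k))"
    and square: "\<And>k. integrable M (\<lambda>\<omega>. (D k \<omega>)\<^sup>2)"
    and orth: "\<And>k Z. Z \<in> borel_measurable (F k) \<Longrightarrow> integrable M (\<lambda>\<omega>. (Z \<omega>)\<^sup>2) \<Longrightarrow>
        expectation (\<lambda>\<omega>. D k \<omega> * Z \<omega>) = 0"
  shows "stopped_sum D \<epsilon> N n \<in> borel_measurable (F (N + n))"
    and "integrable M (\<lambda>\<omega>. (stopped_sum D \<epsilon> N n \<omega>)\<^sup>2)"
    and "expectation (\<lambda>\<omega>. (stopped_sum D \<epsilon> N n \<omega>)\<^sup>2) \<le>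
        (\<Sum>k=N..<N+n. expectation (\<lambda>\<omega>. (D k \<omega>)\<^sup>2))"
proof (induction n)
  case 0
  have "stopped_sum D \<epsilon> N 0 = (\<lambda>_. 0)"
    by auto
  then show "stopped_sum D \<epsilon> N 0 \<in> borel_measurable (F (N + 0))"
    "integrable M (\<lambda>\<omega>. (stopped_sum D \<epsilon> N 0 \<omega>)\<^sup>2)"
    "expectation (\<lambda>\<omega>. (stopped_sum D \<epsilon> N 0 \<omega>)\<^sup>2) \<le>
        (\<Sum>k=N..<N+0. expectation (\<lambda>\<omega>. (D k \<omega>)\<^sup>2))"
    by simp_all
next
  case (Suc n)
  let ?T = "stopped_sum D \<epsilon> N n" and ?D = "D (N + n)"
  let ?I = "\<lambda>\<omega>. if \<bar>?T \<omega>\<bar> < \<epsilon> then ?D \<omega> else 0"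
  \<comment> \<open>In the cross term of the square, the indicator is moved from the increment to
    \<open>?T\<close>. The resulting \<open>?Z\<close> belongs to the past, so \<open>orth\<close>
    applies.\<close>
  let ?Z = "\<lambda>\<omega>. if \<bar>?T \<omega>\<bar> < \<epsilon> then ?T \<omega> else 0"
  have T[measurable]: "?T \<in> borel_measurable (F (Suc (N + n)))"
    using measurable_compose[OF mono Suc(1)] by simp
  note D[measurable] = adapted[of "N + n"]
  have "stopped_sum D \<epsilon> N (Suc n) = (\<lambda>\<omega>. ?T \<omega> + ?I \<omega>)"
    by auto
  moreover have "(\<lambda>\<omega>. ?T \<omega> + ?I \<omega>) \<in> borel_measurable (F (Suc (N + n)))"
    by measurable
  ultimately show "stopped_sum D \<epsilon> N (Suc n) \<in> borel_measurable (F (N + Suc n))"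
    by simp
  have [measurable]: "?T \<in> borel_measurable M" "?D \<in> borel_measurable M"
    using measurable_compose[OF sub T] measurable_compose[OF sub D] by auto
  have I2: "integrable M (\<lambda>\<omega>. (?I \<omega>)\<^sup>2)"
    by (rule Bochner_Integration.integrable_bound[OF square[of "N + n"]]) (auto intro!: AE_I2)
  have Z2: "integrable M (\<lambda>\<omega>. (?Z \<omega>)\<^sup>2)"
    by (rule Bochner_Integration.integrable_bound[OF Suc(2)]) (auto intro!: AE_I2)
  have ZD: "integrable M (\<lambda>\<omega>. ?D \<omega> * ?Z \<omega>)"
    by (rule integrable_mult_of_squares) (use square Z2 in auto)
  have Z0: "expectation (\<lambda>\<omega>. ?D \<omega> * ?Z \<omega>) = 0"
    by (rule orth[OF _ Z2]) (use Suc(1) in measurable)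
  have eq: "(stopped_sum D \<epsilon> N (Suc n) \<omega>)\<^sup>2 = (?T \<omega>)\<^sup>2 + (?I \<omega>)\<^sup>2 + 2 * (?D \<omega> * ?Z \<omega>)" for \<omega>
    by (auto simp: power2_sum)
  show "integrable M (\<lambda>\<omega>. (stopped_sum D \<epsilon> N (Suc n) \<omega>)\<^sup>2)"
    unfolding eq using Suc(2) I2 ZD by auto
  have "expectation (\<lambda>\<omega>. (?I \<omega>)\<^sup>2) \<le> expectation (\<lambda>\<omega>. (?D \<omega>)\<^sup>2)"
    using I2 square by (intro integral_mono) auto
  then show "expectation (\<lambda>\<omega>. (stopped_sum D \<epsilon> N (Suc n) \<omega>)\<^sup>2) \<le>
      (\<Sum>k=N..<N+Suc n. expectation (\<lambda>\<omega>. (D k \<omega>)\<^sup>2))"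
    unfolding eq using Suc(2) I2 ZD Z0 Suc(3) by simp
qed

theorem L2_martingale_converges:
  fixes D :: "nat \<Rightarrow> 'a \<Rightarrow> real" and F :: "nat \<Rightarrow> 'a measure"
  assumes sub: "\<And>k. (\<lambda>\<omega>. \<omega>) \<in> measurable M (F k)"
    and mono: "\<And>k. (\<lambda>\<omega>. \<omega>) \<in> measurable (F (Suc k)) (F k)"
    and adapted: "\<And>k. D k \<in> borel_measurable (F (Suc k))"
    and square: "\<And>k. integrable M (\<lambda>\<omega>. (D k \<omega>)\<^sup>2)"
    and orth: "\<And>k Z. Z \<in> borel_measurable (F k) \<Longrightarrow> integrable M (\<lambda>\<omega>. (Z \<omega>)\<^sup>2) \<Longrightarrow>
        expectation (\<lambda>\<omega>. D k \<omega> * Z \<omega>) = 0"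
    and sum: "summable (\<lambda>k. expectation (\<lambda>\<omega>. (D k \<omega>)\<^sup>2))"
  shows "AE \<omega> in M. summable (\<lambda>k. D k \<omega>)"
proof -
  note stopped = stopped_sum_second_moment[where D=D and F=F, OF sub mono adapted square orth]
  have T[measurable]: "stopped_sum D \<epsilon> N n \<in> borel_measurable M" for \<epsilon> N n
    using measurable_compose[OF sub stopped(1)] by auto
  define B where "B = (\<lambda>\<epsilon> N. {\<omega> \<in> space M. \<exists>n. \<epsilon> \<le> \<bar>stopped_sum D \<epsilon> N n \<omega>\<bar>})"
  have B[measurable]: "B \<epsilon> N \<in> sets M" for \<epsilon> N
    unfolding B_def by measurable
  have tail_nonneg: "0 \<le> (\<Sum>k=N..<N+n. expectation (\<lambda>\<omega>. (D k \<omega>)\<^sup>2))" for N n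
    by (intro sum_nonneg) auto
  have "AE \<omega> in M. \<exists>N. \<omega> \<notin> B \<epsilon> N" if \<epsilon>: "0 < \<epsilon>" for \<epsilon>
  proof -
    have small: "\<exists>N. measure M (B \<epsilon> N) \<le> \<delta>" if \<delta>: "0 < \<delta>" for \<delta>
    proof -
      have "0 < \<delta> * \<epsilon>\<^sup>2"
        using \<delta> \<epsilon> by simp
      then obtain N where N: "\<And>n. norm (\<Sum>k=N..<n. expectation (\<lambda>\<omega>. (D k \<omega>)\<^sup>2)) < \<delta> * \<epsilon>\<^sup>2"
        using sum unfolding summable_Cauchy by blast
      define A where "A = (\<lambda>n. {\<omega> \<in> space M. \<epsilon> \<le> \<bar>stopped_sum D \<epsilon> N n \<omega>\<bar>})"
      \<comment> \<open>Freezing makes the events grow with \<open>n\<close>. A bound at each fixed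
        time therefore bounds their union, which is how Markov's inequality becomes a maximal
        inequality.\<close>
      have "incseq A"
        using stopped_sum_mono unfolding A_def incseq_def by (smt (verit) mem_Collect_eq subsetI)
      then have "(\<lambda>n. measure M (A n)) \<longlonglongrightarrow> measure M (\<Union>n. A n)"
        by (intro finite_Lim_measure_incseq) (auto simp: A_def)
      moreover have "measure M (A n) \<le> \<delta>" for n
      proof -
        have "measure M (A n) = measure M {\<omega> \<in> space M. \<epsilon>\<^sup>2 \<le> (stopped_sum D \<epsilon> N n \<omega>)\<^sup>2}"
          unfolding A_def using \<epsilon> by (intro arg_cong[where f="measure M"] Collect_cong)
            (metis abs_le_square_iff abs_of_pos)
        also have "\<dots> \<le> expectation (\<lambda>\<omega>. (stopped_sum D \<epsilon> N n \<omega>)\<^sup>2) / \<epsilon>\<^sup>2"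
          using \<epsilon> stopped(2) by (intro integral_Markov_inequality_measure[where A="space M"]) auto
        also have "\<dots> \<le> \<delta>"
          using stopped(3)[where N=N and n=n and \<epsilon>=\<epsilon>] N[of "N + n"] \<epsilon> by (simp add: field_simps)
        finally show ?thesis .
      qed
      ultimately have "measure M (\<Union>n. A n) \<le> \<delta>"
        by (intro LIMSEQ_le_const2) auto
      moreover have "(\<Union>n. A n) = B \<epsilon> N"
        by (auto simp: A_def B_def)
      ultimately show ?thesis
        by auto
    qed
    have "measure M (\<Inter>N. B \<epsilon> N) \<le> \<delta>" if "0 < \<delta>" for \<delta>
      using small[OF that] finite_measure_mono[of "\<Inter>N. B \<epsilon> N" "B \<epsilon> _"]
      by (meson B INT_lower UNIV_I order_trans)
    then have "measure M (\<Inter>N. B \<epsilon> N) = 0"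
      by (meson field_le_epsilon measure_nonneg antisym add_nonneg_nonneg dense_ge)
    then have "(\<Inter>N. B \<epsilon> N) \<in> null_sets M"
      by (auto simp: null_sets_def emeasure_eq_measure)
    then show ?thesis
      by (rule AE_I') auto
  qed
  then have "AE \<omega> in M. \<forall>i. \<exists>N. \<omega> \<notin> B (1 / Suc i) N"
    by (simp add: AE_all_countable)
  then show ?thesis
  proof (rule AE_mp, intro AE_I2 impI)
    fix \<omega> assume \<omega>: "\<omega> \<in> space M" "\<forall>i. \<exists>N. \<omega> \<notin> B (1 / Suc i) N"
    show "summable (\<lambda>k. D k \<omega>)"
      unfolding summable_Cauchy
    proof (intro allI impI)
      fix e :: real assume "0 < e"
      \<comment> \<open>Half of \<open>e\<close>, since a block from \<open>m\<close> to
        \<open>n\<close> is the difference of two increments that start at \<open>N\<close>.\<close>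
      then obtain i where i: "1 / Suc i < e / 2"
        using nat_approx_posE[of "e / 2"] by auto
      obtain N where N: "\<omega> \<notin> B (1 / Suc i) N"
        using \<omega>(2) by auto
      then have lt: "\<bar>stopped_sum D (1 / Suc i) N n \<omega>\<bar> < 1 / Suc i" for n
        using \<omega>(1) by (auto simp: B_def not_le)
      have S: "\<bar>\<Sum>k=N..<N+n. D k \<omega>\<bar> < e / 2" for n
        using lt[of n] stopped_sum_eq[OF lt, of n] i by auto
      have "norm (\<Sum>k=m..<n. D k \<omega>) < e" if "m \<ge> N" for m n
      proof (cases "m \<le> n")
        case True
        have "(\<Sum>k=m..<n. D k \<omega>) = (\<Sum>k=N..<N+(n-N). D k \<omega>) - (\<Sum>k=N..<N+(m-N). D k \<omega>)"
          using that True sum.atLeastLessThan_concat[of N m n "\<lambda>k. D k \<omega>"] by simp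
        then show ?thesis
          unfolding real_norm_def using S[of "n - N"] S[of "m - N"] by linarith
      qed (use \<open>0 < e\<close> in simp)
      then show "\<exists>N. \<forall>m\<ge>N. \<forall>n. norm (\<Sum>k=m..<n. D k \<omega>) < e"
        by blast
    qed
  qed
qed

end

subsection \<open>Moments of a single sample\<close>

lemma borel_measurable_matrix_vector_mult[measurable (raw)]:
  fixes A :: "'b \<Rightarrow> real^'m^'n" and u :: "'b \<Rightarrow> real^'m"
  assumes "A \<in> borel_measurable N" "u \<in> borel_measurable N"
  shows "(\<lambda>x. A x *v u x) \<in> borel_measurable N"
  using assms by (rule borel_measurable_continuous_Pair)
    (auto simp: matrix_vector_mult_def intro!: continuous_intros)

lemma norm_matrix_vector_le:
  fixes A :: "real^'m^'n"
  shows "norm (A *v u) \<le> onorm ((*v) A) * norm u"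
  by (rule onorm) simp

lemma onorm_matrix_diff_le:
  fixes A B :: "real^'m^'n"
  shows "\<bar>onorm ((*v) A) - onorm ((*v) B)\<bar> \<le> (\<Sum>i\<in>UNIV. \<Sum>j\<in>UNIV. \<bar>A $ i $ j - B $ i $ j\<bar>)"
proof -
  have *: "onorm ((*v) A) \<le> onorm ((*v) B) + (\<Sum>i\<in>UNIV. \<Sum>j\<in>UNIV. \<bar>A $ i $ j - B $ i $ j\<bar>)"
    for A B :: "real^'m^'n"
  proof -
    have "onorm (\<lambda>u. B *v u + (A - B) *v u) \<le> onorm ((*v) B) + onorm ((*v) (A - B))"
      by (rule onorm_triangle) auto
    also have "(\<lambda>u. B *v u + (A - B) *v u) = (*v) A"
      by (auto simp: matrix_vector_mult_diff_rdistrib)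
    also have "onorm ((*v) (A - B)) \<le> (\<Sum>i\<in>UNIV. \<Sum>j\<in>UNIV. \<bar>(A - B) $ i $ j\<bar>)"
      by (rule onorm_le_matrix_component_sum)
    finally show ?thesis
      by simp
  qed
  show ?thesis
    using *[of A B] *[of B A] by (simp add: abs_minus_commute abs_le_iff)
qed

lemma borel_measurable_onorm_matrix[measurable]:
  "(\<lambda>A :: real^'m^'n. onorm ((*v) A)) \<in> borel_measurable borel"
proof (rule borel_measurable_continuous_onI, rule continuous_at_imp_continuous_on, safe)
  fix A :: "real^'m^'n"
  have "((\<lambda>B. \<Sum>i\<in>UNIV. \<Sum>j\<in>UNIV. \<bar>B $ i $ j - A $ i $ j\<bar>) \<longlongrightarrow>
      (\<Sum>i\<in>UNIV. \<Sum>j\<in>UNIV. \<bar>A $ i $ j - A $ i $ j\<bar>)) (at A)"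
    by (intro tendsto_intros)
  then have "((\<lambda>B. \<Sum>i\<in>UNIV. \<Sum>j\<in>UNIV. \<bar>B $ i $ j - A $ i $ j\<bar>) \<longlongrightarrow> 0) (at A)"
    by simp
  then have "((\<lambda>B. onorm ((*v) B) - onorm ((*v) A)) \<longlongrightarrow> 0) (at A)"
    by (rule Lim_null_comparison[rotated]) (simp only: real_norm_def onorm_matrix_diff_le always_eventually simp_thms)
  then show "isCont (\<lambda>A :: real^'m^'n. onorm ((*v) A)) A"
    unfolding isCont_def by (rule LIM_zero_cancel)
qed

text \<open>\<open>grad\<close> is given by a description operator, so joint measurability has to
  come from a pointwise limit of difference quotients along each basis vector.\<close>

lemma borel_measurable_grad:
  fixes F :: "'c \<Rightarrow> 'b::euclidean_space \<Rightarrow> real"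
  assumes F[measurable]: "case_prod F \<in> borel_measurable (N \<Otimes>\<^sub>M borel)"
    and diff: "\<And>c y. c \<in> space N \<Longrightarrow> F c differentiable (at y)"
  shows "(\<lambda>(c, y). grad (F c) y) \<in> borel_measurable (N \<Otimes>\<^sub>M borel)"
proof (rule iffD2[OF borel_measurable_euclidean_space], rule ballI)
  fix b :: 'b assume b: "b \<in> Basis"
  show "(\<lambda>z. (case z of (c, y) \<Rightarrow> grad (F c) y) \<bullet> b) \<in> borel_measurable (N \<Otimes>\<^sub>M borel)"
  proof (rule borel_measurable_LIMSEQ_real)
    let ?q = "\<lambda>n (c, y). (F c (y + inverse (real (Suc n)) *\<^sub>R b) - F c y) / inverse (real (Suc n))"
    show "?q n \<in> borel_measurable (N \<Otimes>\<^sub>M borel)" for n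
      by measurable
    fix z assume "z \<in> space (N \<Otimes>\<^sub>M (borel :: 'b measure))"
    then obtain c y where z: "z = (c, y)" "c \<in> space N"
      by (auto simp: space_pair_measure)
    have "(F c has_derivative (\<lambda>h. h \<bullet> grad (F c) y)) (at (y + 0 *\<^sub>R b))"
      using GDERIV_grad[OF diff[OF z(2)]] by (simp add: gderiv_def)
    moreover have "((\<lambda>t. y + t *\<^sub>R b) has_derivative (\<lambda>t. t *\<^sub>R b)) (at 0)"
      by (auto intro!: derivative_eq_intros)
    ultimately have "((\<lambda>t. F c (y + t *\<^sub>R b)) has_derivative (\<lambda>t. (t *\<^sub>R b) \<bullet> grad (F c) y)) (at 0)"
      by (rule has_derivative_compose[rotated])
    then have "((\<lambda>t. F c (y + t *\<^sub>R b)) has_field_derivative (grad (F c) y \<bullet> b)) (at 0)"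
      by (rule has_derivative_imp_has_field_derivative) (simp add: inner_commute)
    then have "(\<lambda>t. (F c (y + t *\<^sub>R b) - F c y) / t) \<midarrow>0\<rightarrow> grad (F c) y \<bullet> b"
      by (simp add: DERIV_def)
    moreover have "filterlim (\<lambda>n. inverse (real (Suc n))) (at 0) sequentially"
      unfolding filterlim_at using LIMSEQ_inverse_real_of_nat by auto
    ultimately have "(\<lambda>n. (F c (y + inverse (real (Suc n)) *\<^sub>R b) - F c y) / inverse (real (Suc n)))
        \<longlonglongrightarrow> grad (F c) y \<bullet> b"
      by (rule filterlim_compose)
    then show "(\<lambda>n. ?q n z) \<longlonglongrightarrow> (case z of (c, y) \<Rightarrow> grad (F c) y) \<bullet> b"
      using z(1) by simp
  qed
qed

text \<open>The weight is pulled out of the conditional expectation. The weight 1 gives plain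
  moments; weights depending on \<open>w 0\<close> give the bounds at evaluation points that vary
  with \<open>w 0\<close>.\<close>

lemma nn_cond_exp_version_bound:
  assumes "sigma_finite_subalgebra M F" and version: "nn_cond_exp_version M F Z Y"
    and le: "AE \<omega> in M. Y \<omega> \<le> c" and h: "h \<in> borel_measurable F"
  shows "(\<integral>\<^sup>+\<omega>. h \<omega> * Z \<omega> \<partial>M) \<le> c * (\<integral>\<^sup>+\<omega>. h \<omega> \<partial>M)"
proof -
  interpret sigma_finite_subalgebra M F
    by fact
  have "h \<in> borel_measurable M"
    using h subalg by (rule measurable_from_subalg[rotated])
  have "(\<integral>\<^sup>+\<omega>. h \<omega> * Z \<omega> \<partial>M) = (\<integral>\<^sup>+\<omega>. h \<omega> * nn_cond_exp M F Z \<omega> \<partial>M)"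
    using nn_cond_exp_intg[OF h] version by (simp add: nn_cond_exp_version_def)
  also have "\<dots> \<le> (\<integral>\<^sup>+\<omega>. c * h \<omega> \<partial>M)"
  proof (rule nn_integral_mono_AE)
    have "AE \<omega> in M. Y \<omega> = nn_cond_exp M F Z \<omega>"
      using version by (simp add: nn_cond_exp_version_def)
    with le show "AE \<omega> in M. h \<omega> * nn_cond_exp M F Z \<omega> \<le> c * h \<omega>"
    proof eventually_elim
      case (elim \<omega>)
      then show ?case
        using mult_right_mono[of "nn_cond_exp M F Z \<omega>" c "h \<omega>"] by (simp add: mult.commute)
    qed
  qed
  also have "\<dots> = c * (\<integral>\<^sup>+\<omega>. h \<omega> \<partial>M)"
    using \<open>h \<in> borel_measurable M\<close> by (rule nn_integral_cmult)
  finally show ?thesis .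
qed

text \<open>The tower property, taken by coordinates because \<open>real_cond_exp\<close> is
  scalar.\<close>

lemma cond_exp_version_integral:
  fixes Z Y :: "'a \<Rightarrow> real^'n"
  assumes "sigma_finite_subalgebra M F" and version: "cond_exp_version M F Z Y"
  shows "integrable M Y" and "integral\<^sup>L M Y = integral\<^sup>L M Z"
proof -
  interpret sigma_finite_subalgebra M F
    by fact
  have Z: "integrable M Z" and "Y \<in> borel_measurable F"
    and eq: "\<And>i. AE \<omega> in M. Y \<omega> $ i = real_cond_exp M F (\<lambda>\<omega>. Z \<omega> $ i) \<omega>"
    using version by (auto simp: cond_exp_version_def)
  then have [measurable]: "Y \<in> borel_measurable M"
    using subalg by (blast intro: measurable_from_subalg)
  have [measurable]: "(\<lambda>\<omega>. Y \<omega> $ i) \<in> borel_measurable M" for i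
    by (rule measurable_compose[OF _ borel_measurable_continuous_onI]) (auto intro!: continuous_intros)
  have Zi: "integrable M (\<lambda>\<omega>. Z \<omega> $ i)" for i
    by (rule integrable_bounded_linear[OF bounded_linear_vec_nth Z])
  have Yi: "integrable M (\<lambda>\<omega>. Y \<omega> $ i)" for i
    using real_cond_exp_int(1)[OF Zi] eq by (subst integrable_cong_AE) auto
  have int_Yi: "(\<integral>\<omega>. Y \<omega> $ i \<partial>M) = (\<integral>\<omega>. Z \<omega> $ i \<partial>M)" for i
    using integral_cong_AE[OF _ _ eq[of i]] real_cond_exp_int(2)[OF Zi] by simp
  have "integrable M (\<lambda>\<omega>. \<Sum>i\<in>UNIV. (Y \<omega> $ i) *\<^sub>R axis i (1::real))"
    using Yi by (intro Bochner_Integration.integrable_sum integrable_scaleR_left)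
  moreover have "(\<Sum>i\<in>UNIV. (Y \<omega> $ i) *\<^sub>R axis i (1::real)) = Y \<omega>" for \<omega>
    using basis_expansion[of "Y \<omega>"] by (simp add: scalar_mult_eq_scaleR)
  ultimately show Y: "integrable M Y"
    by simp
  show "integral\<^sup>L M Y = integral\<^sup>L M Z"
    using int_Yi integral_bounded_linear[OF bounded_linear_vec_nth Y]
      integral_bounded_linear[OF bounded_linear_vec_nth Z] by (simp add: vec_eq_iff)
qed

context stochastic_composition
begin

definition sample :: "nat \<Rightarrow> 'a \<Rightarrow> 'w \<times> 'v" where
  "sample k \<omega> = (w k \<omega>, v k \<omega>)"

definition law :: "('w \<times> 'v) measure" where
  "law = distr M (W \<Otimes>\<^sub>M V) (sample 0)"

text \<open>\<open>Gs\<close> is measurable only over \<open>X\<close>, so the iterates are treated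
  as random elements of this space and not merely of \<open>borel\<close>.\<close>

abbreviation XB :: "(real^'n) measure" where
  "XB \<equiv> restrict_space borel X"

text \<open>The noisy chain-rule gradient with \<open>\<nabla>f\<^sub>v\<close> evaluated at the auxiliary point \<open>u\<close>,
  and the mean of its unbiased version \<open>u = g x\<close>.\<close>

definition noisy_grad :: "'w \<times> 'v \<Rightarrow> real^'n \<Rightarrow> real^'m \<Rightarrow> real^'n" where
  "noisy_grad p z u = Gs (fst p) z *v grad (fs (snd p)) u"

definition mean_grad :: "real^'n \<Rightarrow> real^'n" where
  "mean_grad z = (\<integral>p. noisy_grad p z (g z) \<partial>law)"

definition Gnorm :: "'w \<Rightarrow> real^'n \<Rightarrow> real" where
  "Gnorm c z = onorm ((*v) (Gs c z))"

lemma sample_measurable[measurable]: "sample k \<in> measurable M (W \<Otimes>\<^sub>M V)"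
  using independent unfolding indep_vars_def sample_def by auto

lemma w_measurable[measurable]: "w k \<in> measurable M W"
  and v_measurable[measurable]: "v k \<in> measurable M V"
  using measurable_compose[OF sample_measurable measurable_fst]
    measurable_compose[OF sample_measurable measurable_snd] by (auto simp: sample_def)

lemma prob_space_law: "prob_space law"
  unfolding law_def by (rule prob_space_distr) measurable

lemma sets_law[measurable_cong, simp]: "sets law = sets (W \<Otimes>\<^sub>M V)"
  by (simp add: law_def)

lemma distr_sample: "distr M (W \<Otimes>\<^sub>M V) (sample k) = law"
  using identically_distributed[of k] by (simp add: law_def sample_def[abs_def])

lemma distr_v: "distr M V (v k) = distr M V (v 0)"
proof -
  have "distr M V (v k) = distr law V snd" for k
    unfolding distr_sample[of k, symmetric] by (subst distr_distr) (auto simp: sample_def comp_def)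
  then show ?thesis
    by metis
qed

lemma AE_gradient_lipschitz:
  "AE \<omega> in M. \<forall>k. Lf-lipschitz_on UNIV (grad (fs (v k \<omega>)))"
proof -
  have "AE \<omega> in M. Lf-lipschitz_on UNIV (grad (fs (v k \<omega>)))" for k
    using fs_gradient_lipschitz unfolding distr_v[of k, symmetric] by (rule AE_distrD[rotated]) simp
  then show ?thesis
    by (simp add: AE_all_countable)
qed

lemma g_measurable[measurable]: "g \<in> borel_measurable borel"
  using g_continuous by (rule borel_measurable_continuous_onI)

lemma id_XB[measurable]: "(\<lambda>z. z) \<in> measurable XB borel"
  by (rule measurable_restrict_space1) simp

lemma gs_comp_measurable[measurable (raw)]:
  assumes "a \<in> measurable N W" "b \<in> borel_measurable N"
  shows "(\<lambda>i. gs (a i) (b i)) \<in> borel_measurable N"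
  using measurable_compose[OF measurable_Pair[OF assms] gs_measurable] by simp

lemma Gs_comp_measurable[measurable (raw)]:
  assumes "a \<in> measurable N W" "b \<in> measurable N XB"
  shows "(\<lambda>i. Gs (a i) (b i)) \<in> borel_measurable N"
  using measurable_compose[OF measurable_Pair[OF assms] Gs_measurable] by simp

lemma Gnorm_comp_measurable[measurable (raw)]:
  assumes [measurable]: "a \<in> measurable N W" "b \<in> measurable N XB"
  shows "(\<lambda>i. Gnorm (a i) (b i)) \<in> borel_measurable N"
  unfolding Gnorm_def by measurable

lemma grad_fs_comp_measurable[measurable (raw)]:
  assumes "a \<in> measurable N V" "b \<in> borel_measurable N"
  shows "(\<lambda>i. grad (fs (a i)) (b i)) \<in> borel_measurable N"
  using measurable_compose[OF measurable_Pair[OF assms] borel_measurable_grad[OF fs_measurable]]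
    fs_differentiable by simp

lemma noisy_grad_measurable[measurable (raw)]:
  assumes [measurable]: "a \<in> measurable N (W \<Otimes>\<^sub>M V)" "b \<in> measurable N XB" "u \<in> borel_measurable N"
  shows "(\<lambda>i. noisy_grad (a i) (b i) (u i)) \<in> borel_measurable N"
  unfolding noisy_grad_def by measurable

lemma const_XB[measurable (raw)]: "z \<in> X \<Longrightarrow> (\<lambda>_. z) \<in> measurable N XB"
  by (simp add: space_restrict_space)

lemma Gnorm_nonneg: "0 \<le> Gnorm c z"
  unfolding Gnorm_def by (rule onorm_pos_le) simp

lemma norm_noisy_grad_le: "norm (noisy_grad p z u) \<le> Gnorm (fst p) z * norm (grad (fs (snd p)) u)"
  unfolding noisy_grad_def Gnorm_def by (rule norm_matrix_vector_le)

lemma noisy_grad_diff_le: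
  assumes "Lf-lipschitz_on UNIV (grad (fs (snd p)))"
  shows "norm (noisy_grad p z u - noisy_grad p z u') \<le> Gnorm (fst p) z * (Lf * norm (u - u'))"
proof -
  have "norm (noisy_grad p z u - noisy_grad p z u') \<le>
      Gnorm (fst p) z * norm (grad (fs (snd p)) u - grad (fs (snd p)) u')"
    unfolding noisy_grad_def Gnorm_def matrix_vector_mult_diff_distrib[symmetric]
    by (rule norm_matrix_vector_le)
  also have "\<dots> \<le> Gnorm (fst p) z * (Lf * norm (u - u'))"
    using lipschitz_onD[OF assms, of u u'] Gnorm_nonneg
    by (intro mult_left_mono) (auto simp: dist_norm)
  finally show ?thesis .
qed

lemma finite_subalgebra_v: "sigma_finite_subalgebra M (vimage_algebra (space M) (v 0) V)"
  and finite_subalgebra_w: "sigma_finite_subalgebra M (vimage_algebra (space M) (w 0) W)"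
  by (intro finite_measure_subalgebra_is_sigma_finite finite_measure_subalgebra.intro
      finite_measure_subalgebra_axioms.intro finite_measure_axioms;
      simp add: subalgebra_def sets_image_in_sets)+

lemma nn_integral_law:
  assumes "h \<in> borel_measurable (W \<Otimes>\<^sub>M V)"
  shows "(\<integral>\<^sup>+p. h p \<partial>law) = (\<integral>\<^sup>+\<omega>. h (w 0 \<omega>, v 0 \<omega>) \<partial>M)"
  unfolding law_def using assms by (subst nn_integral_distr) (auto simp: sample_def)

lemma Gnorm_second_moment:
  assumes z[measurable]: "z \<in> X"
  shows "(\<integral>\<^sup>+p. ennreal ((Gnorm (fst p) z)\<^sup>2) \<partial>law) \<le> ennreal Cg"
proof -
  obtain E where E: "\<And>z. z \<in> X \<Longrightarrow> nn_cond_exp_version M (vimage_algebra (space M) (v 0) V)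
                     (\<lambda>\<omega>. ennreal ((Gnorm (w 0 \<omega>) z)\<^sup>2)) (E z)"
    and le: "AE \<omega> in M. \<forall>z\<in>X. E z \<omega> \<le> ennreal Cg"
    using Gs_second_moment unfolding Gnorm_def by auto
  have "(\<integral>\<^sup>+\<omega>. 1 * ennreal ((Gnorm (w 0 \<omega>) z)\<^sup>2) \<partial>M) \<le> ennreal Cg * (\<integral>\<^sup>+\<omega>. 1 \<partial>M)"
    using le z by (intro nn_cond_exp_version_bound[OF finite_subalgebra_v E[OF z]]) auto
  then show ?thesis
    using z by (simp add: nn_integral_law emeasure_space_1)
qed

lemma gs_second_moment:
  assumes z[measurable]: "z \<in> X"
  shows "(\<integral>\<^sup>+p. ennreal ((norm (gs (fst p) z - g z))\<^sup>2) \<partial>law) \<le> ennreal Vg"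
proof -
  obtain E where E: "\<And>z. z \<in> X \<Longrightarrow> nn_cond_exp_version M (vimage_algebra (space M) (v 0) V)
                     (\<lambda>\<omega>. ennreal ((norm (gs (w 0 \<omega>) z - g z))\<^sup>2)) (E z)"
    and le: "AE \<omega> in M. \<forall>z\<in>X. E z \<omega> \<le> ennreal Vg"
    using gs_variance by auto
  have "(\<integral>\<^sup>+\<omega>. 1 * ennreal ((norm (gs (w 0 \<omega>) z - g z))\<^sup>2) \<partial>M) \<le> ennreal Vg * (\<integral>\<^sup>+\<omega>. 1 \<partial>M)"
    using le z by (intro nn_cond_exp_version_bound[OF finite_subalgebra_v E[OF z]]) auto
  then show ?thesis
    using z by (simp add: nn_integral_law emeasure_space_1)
qed

text \<open>The bound on \<open>E[\<parallel>\<nabla>f\<^sub>v(y)\<parallel>\<^sup>2 | w]\<close> extends from fixed \<open>y\<close> to \<open>y = u(w)\<close>: finite sums give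
  simple functions \<open>u\<close>, and Fatou's lemma with the continuity of \<open>\<nabla>f\<^sub>v\<close> the rest. This is needed
  because the evaluation point \<open>y\<^sub>k\<^sub>+\<^sub>1\<close> depends on \<open>w\<^sub>k\<close>.\<close>

lemma weighted_grad_moment:
  assumes h[measurable]: "h \<in> borel_measurable W" and u[measurable]: "u \<in> borel_measurable W"
    and finite: "\<And>c. h c < \<top>"
  shows "(\<integral>\<^sup>+\<omega>. h (w 0 \<omega>) * ennreal ((norm (grad (fs (v 0 \<omega>)) (u (w 0 \<omega>))))\<^sup>2) \<partial>M) \<le>
      ennreal Cf * (\<integral>\<^sup>+\<omega>. h (w 0 \<omega>) \<partial>M)"
proof -
  let ?Fw = "vimage_algebra (space M) (w 0) W"
  define Q where "Q = (\<lambda>r \<omega>. ennreal ((norm (grad (fs (v 0 \<omega>)) r))\<^sup>2))"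
  have Q[measurable]: "Q r \<in> borel_measurable M" for r
    unfolding Q_def by measurable
  obtain E where E: "\<And>r. nn_cond_exp_version M ?Fw (Q r) (E r)"
    and le: "AE \<omega> in M. \<forall>r. E r \<omega> \<le> ennreal Cf"
    using fs_second_moment unfolding Q_def by auto
  have w_Fw: "w 0 \<in> measurable ?Fw W"
    by (intro measurable_vimage_algebra1) (auto intro: measurable_space)
  have single: "(\<integral>\<^sup>+\<omega>. h' (w 0 \<omega>) * Q r \<omega> \<partial>M) \<le> ennreal Cf * (\<integral>\<^sup>+\<omega>. h' (w 0 \<omega>) \<partial>M)"
    if "h' \<in> borel_measurable W" for h' r
    using le by (intro nn_cond_exp_version_bound[OF finite_subalgebra_w E])
      (auto intro: measurable_compose[OF w_Fw that])
  have simple: "(\<integral>\<^sup>+\<omega>. h (w 0 \<omega>) * Q (s (w 0 \<omega>)) \<omega> \<partial>M) \<le> ennreal Cf * (\<integral>\<^sup>+\<omega>. h (w 0 \<omega>) \<partial>M)"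
    if s: "simple_function W s" for s
  proof -
    let ?R = "s ` space W"
    let ?h = "\<lambda>r c. h c * indicator (s -` {r} \<inter> space W) c"
    have fin: "finite ?R"
      using s by (rule simple_functionD)
    have [measurable]: "s -` {r} \<inter> space W \<in> sets W" for r
      using s by (rule simple_functionD)
    \<comment> \<open>\<open>F\<close> is left open because the partition into level sets of
      \<open>s\<close> is used twice: with \<open>Q\<close> to reach fixed evaluation points, and
      with the constant 1 to reassemble the weight.\<close>
    have split: "h (w 0 \<omega>) * F (s (w 0 \<omega>)) = (\<Sum>r\<in>?R. ?h r (w 0 \<omega>) * F r)"
      if "\<omega> \<in> space M" for \<omega> and F :: "real^'m \<Rightarrow> ennreal"
    proof -
      have w: "w 0 \<omega> \<in> space W"
        using that by (rule measurable_space[OF w_measurable])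
      have "(\<Sum>r\<in>?R. ?h r (w 0 \<omega>) * F r) =
          (\<Sum>r\<in>?R. if r = s (w 0 \<omega>) then h (w 0 \<omega>) * F r else 0)"
        using w by (intro sum.cong) (auto simp: indicator_def)
      then show ?thesis
        using fin w by (simp add: sum.delta)
    qed
    have "(\<integral>\<^sup>+\<omega>. h (w 0 \<omega>) * Q (s (w 0 \<omega>)) \<omega> \<partial>M) = (\<integral>\<^sup>+\<omega>. (\<Sum>r\<in>?R. ?h r (w 0 \<omega>) * Q r \<omega>) \<partial>M)"
      by (intro nn_integral_cong split)
    also have "\<dots> = (\<Sum>r\<in>?R. \<integral>\<^sup>+\<omega>. ?h r (w 0 \<omega>) * Q r \<omega> \<partial>M)"
      by (rule nn_integral_sum) measurable
    also have "\<dots> \<le> (\<Sum>r\<in>?R. ennreal Cf * (\<integral>\<^sup>+\<omega>. ?h r (w 0 \<omega>) \<partial>M))"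
      by (intro sum_mono single) measurable
    also have "\<dots> = ennreal Cf * (\<Sum>r\<in>?R. \<integral>\<^sup>+\<omega>. ?h r (w 0 \<omega>) \<partial>M)"
      by (simp add: sum_distrib_left)
    also have "(\<Sum>r\<in>?R. \<integral>\<^sup>+\<omega>. ?h r (w 0 \<omega>) \<partial>M) = (\<integral>\<^sup>+\<omega>. (\<Sum>r\<in>?R. ?h r (w 0 \<omega>)) \<partial>M)"
      by (rule nn_integral_sum[symmetric]) measurable
    also have "\<dots> = (\<integral>\<^sup>+\<omega>. h (w 0 \<omega>) \<partial>M)"
      using split[of _ "\<lambda>_. 1"] by (intro nn_integral_cong) simp
    finally show ?thesis .
  qed
  obtain s where s: "\<And>i. simple_function W (s i)" "\<And>c. c \<in> space W \<Longrightarrow> (\<lambda>i. s i c) \<longlonglongrightarrow> u c"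
    using borel_measurable_implies_sequence_metric[OF u] by metis
  have [measurable]: "s i \<in> borel_measurable W" for i
    using s(1) by (rule borel_measurable_simple_function)
  let ?q = "\<lambda>i \<omega>. h (w 0 \<omega>) * Q (s i (w 0 \<omega>)) \<omega>"
  have "(\<integral>\<^sup>+\<omega>. h (w 0 \<omega>) * Q (u (w 0 \<omega>)) \<omega> \<partial>M) \<le> (\<integral>\<^sup>+\<omega>. liminf (\<lambda>i. ?q i \<omega>) \<partial>M)"
  proof (rule nn_integral_mono_AE)
    show "AE \<omega> in M. h (w 0 \<omega>) * Q (u (w 0 \<omega>)) \<omega> \<le> liminf (\<lambda>i. ?q i \<omega>)"
      using AE_gradient_lipschitz AE_space
    proof eventually_elim
      case (elim \<omega>)
      have "w 0 \<omega> \<in> space W"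
        using elim(2) by (rule measurable_space[OF w_measurable])
      moreover have "continuous_on UNIV (grad (fs (v 0 \<omega>)))"
        using elim(1) lipschitz_on_continuous_on by blast
      ultimately have "(\<lambda>i. grad (fs (v 0 \<omega>)) (s i (w 0 \<omega>))) \<longlonglongrightarrow> grad (fs (v 0 \<omega>)) (u (w 0 \<omega>))"
        using s(2) by (auto intro: continuous_on_tendsto_compose)
      then have "(\<lambda>i. Q (s i (w 0 \<omega>)) \<omega>) \<longlonglongrightarrow> Q (u (w 0 \<omega>)) \<omega>"
        unfolding Q_def by (intro tendsto_ennrealI tendsto_intros)
      \<comment> \<open>Finiteness of the weight matters here: multiplication by
        \<open>\<top>\<close> is not continuous at 0.\<close>
      then have "(\<lambda>i. ?q i \<omega>) \<longlonglongrightarrow> h (w 0 \<omega>) * Q (u (w 0 \<omega>)) \<omega>"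
        by (rule ennreal_tendsto_cmult[OF finite])
      then have "liminf (\<lambda>i. ?q i \<omega>) = h (w 0 \<omega>) * Q (u (w 0 \<omega>)) \<omega>"
        by (intro lim_imp_Liminf) auto
      then show ?case
        by simp
    qed
  qed
  also have "\<dots> \<le> liminf (\<lambda>i. \<integral>\<^sup>+\<omega>. ?q i \<omega> \<partial>M)"
    unfolding Q_def by (rule nn_integral_liminf) measurable
  also have "\<dots> \<le> ennreal Cf * (\<integral>\<^sup>+\<omega>. h (w 0 \<omega>) \<partial>M)"
    by (rule Liminf_le) (auto intro: simple s(1) always_eventually)
  finally show ?thesis
    unfolding Q_def .
qed

text \<open>The squared \<open>Gnorm\<close> is a weight depending on \<open>w\<close> only. The
  conditional bound given \<open>w\<close> is applied first and yields \<open>Cf\<close>, at a point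
  \<open>u\<close> that may vary with \<open>w\<close>; the mean of the weight then yields
  \<open>Cg\<close>.\<close>

lemma noisy_grad_second_moment_weighted:
  assumes z[measurable]: "z \<in> X" and u[measurable]: "u \<in> borel_measurable W"
  shows "(\<integral>\<^sup>+p. ennreal ((norm (noisy_grad p z (u (fst p))))\<^sup>2) \<partial>law) \<le> ennreal (Cg * Cf)"
proof -
  have "(\<integral>\<^sup>+p. ennreal ((norm (noisy_grad p z (u (fst p))))\<^sup>2) \<partial>law) \<le>
      (\<integral>\<^sup>+p. ennreal ((Gnorm (fst p) z)\<^sup>2) * ennreal ((norm (grad (fs (snd p)) (u (fst p))))\<^sup>2) \<partial>law)"
  proof (rule nn_integral_mono)
    fix p
    have "(norm (noisy_grad p z (u (fst p))))\<^sup>2 \<le> (Gnorm (fst p) z * norm (grad (fs (snd p)) (u (fst p))))\<^sup>2"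
      by (intro power_mono norm_noisy_grad_le) simp
    then show "ennreal ((norm (noisy_grad p z (u (fst p))))\<^sup>2) \<le>
        ennreal ((Gnorm (fst p) z)\<^sup>2) * ennreal ((norm (grad (fs (snd p)) (u (fst p))))\<^sup>2)"
      by (simp add: ennreal_mult[symmetric] power_mult_distrib ennreal_leI)
  qed
  also have "\<dots> = (\<integral>\<^sup>+\<omega>. ennreal ((Gnorm (w 0 \<omega>) z)\<^sup>2) *
      ennreal ((norm (grad (fs (v 0 \<omega>)) (u (w 0 \<omega>))))\<^sup>2) \<partial>M)"
    by (subst nn_integral_law) simp_all
  also have "\<dots> \<le> ennreal Cf * (\<integral>\<^sup>+\<omega>. ennreal ((Gnorm (w 0 \<omega>) z)\<^sup>2) \<partial>M)"
    by (rule weighted_grad_moment) simp_all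
  also have "(\<integral>\<^sup>+\<omega>. ennreal ((Gnorm (w 0 \<omega>) z)\<^sup>2) \<partial>M) = (\<integral>\<^sup>+p. ennreal ((Gnorm (fst p) z)\<^sup>2) \<partial>law)"
    by (subst nn_integral_law) simp_all
  also have "ennreal Cf * \<dots> \<le> ennreal Cf * ennreal Cg"
    using Gnorm_second_moment[OF z] by (rule mult_left_mono) simp
  also have "\<dots> = ennreal (Cg * Cf)"
    using constants_pos by (simp add: ennreal_mult[symmetric] mult.commute)
  finally show ?thesis .
qed

lemma
  assumes z[measurable]: "z \<in> X"
  shows integrable_noisy_grad_square: "integrable law (\<lambda>p. (norm (noisy_grad p z (g z)))\<^sup>2)"
    and noisy_grad_second_moment: "(\<integral>p. (norm (noisy_grad p z (g z)))\<^sup>2 \<partial>law) \<le> Cg * Cf"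
    and integrable_noisy_grad: "integrable law (\<lambda>p. noisy_grad p z (g z))"
proof -
  interpret law: prob_space law
    by (rule prob_space_law)
  show sq: "integrable law (\<lambda>p. (norm (noisy_grad p z (g z)))\<^sup>2)"
    and "(\<integral>p. (norm (noisy_grad p z (g z)))\<^sup>2 \<partial>law) \<le> Cg * Cf"
    using noisy_grad_second_moment_weighted[OF z, of "\<lambda>_. g z"] constants_pos
    by (auto intro!: integrable_of_nn_integral_bound)
  have "integrable law (\<lambda>p. norm (noisy_grad p z (g z)))"
    by (rule law.square_integrable_imp_integrable) (use sq in simp_all)
  then show "integrable law (\<lambda>p. noisy_grad p z (g z))"
    by (rule integrable_norm_cancel) measurable
qed

lemma norm_mean_grad_le:
  assumes z[measurable]: "z \<in> X"
  shows "(norm (mean_grad z))\<^sup>2 \<le> Cg * Cf"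
proof -
  interpret law: prob_space law
    by (rule prob_space_law)
  let ?U = "\<lambda>p. norm (noisy_grad p z (g z))"
  have "norm (mean_grad z) \<le> (\<integral>p. ?U p \<partial>law)"
    unfolding mean_grad_def by (rule integral_norm_bound)
  then have "(norm (mean_grad z))\<^sup>2 \<le> (\<integral>p. ?U p \<partial>law)\<^sup>2"
    by (rule power_mono) simp
  \<comment> \<open>Jensen's inequality for the square, in the form that a variance is
    nonnegative.\<close>
  also have "\<dots> \<le> (\<integral>p. (?U p)\<^sup>2 \<partial>law)"
    using law.variance_eq[of ?U] law.variance_positive[of ?U]
      integrable_norm[OF integrable_noisy_grad[OF z]] integrable_noisy_grad_square[OF z] by simp
  finally show ?thesis
    using noisy_grad_second_moment[OF z] by simp
qed

lemma mean_grad_measurable[measurable]: "mean_grad \<in> borel_measurable XB"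
proof -
  interpret law: prob_space law
    by (rule prob_space_law)
  show ?thesis
    unfolding mean_grad_def[abs_def] by measurable
qed

lemma noise_second_moment:
  assumes z[measurable]: "z \<in> X"
  shows "(\<integral>\<^sup>+p. ennreal ((norm (noisy_grad p z (g z) - mean_grad z))\<^sup>2) \<partial>law) \<le> ennreal (4 * (Cg * Cf))"
proof -
  interpret law: prob_space law
    by (rule prob_space_law)
  have "(\<integral>\<^sup>+p. ennreal ((norm (noisy_grad p z (g z) - mean_grad z))\<^sup>2) \<partial>law) \<le>
      (\<integral>\<^sup>+p. ennreal (2 * (norm (noisy_grad p z (g z)))\<^sup>2 + 2 * (Cg * Cf)) \<partial>law)"
  proof (intro nn_integral_mono ennreal_leI)
    fix p
    have "(norm (noisy_grad p z (g z) - mean_grad z))\<^sup>2 \<le>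
        (norm (noisy_grad p z (g z)) + norm (mean_grad z))\<^sup>2"
      by (intro power_mono norm_triangle_ineq4) simp
    \<comment> \<open>Each of the two squares has mean at most \<open>Cg * Cf\<close> and is counted
      twice, hence the factor 4.\<close>
    also have "\<dots> \<le> 2 * (norm (noisy_grad p z (g z)))\<^sup>2 + 2 * (norm (mean_grad z))\<^sup>2"
      using sum_squares_bound[of "norm (noisy_grad p z (g z))" "norm (mean_grad z)"]
      by (simp add: power2_sum)
    also have "\<dots> \<le> 2 * (norm (noisy_grad p z (g z)))\<^sup>2 + 2 * (Cg * Cf)"
      using norm_mean_grad_le[OF z] by simp
    finally show "(norm (noisy_grad p z (g z) - mean_grad z))\<^sup>2 \<le>
        2 * (norm (noisy_grad p z (g z)))\<^sup>2 + 2 * (Cg * Cf)" .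
  qed
  also have "\<dots> = ennreal (\<integral>p. 2 * (norm (noisy_grad p z (g z)))\<^sup>2 + 2 * (Cg * Cf) \<partial>law)"
    using integrable_noisy_grad_square[OF z] constants_pos by (intro nn_integral_eq_integral) auto
  also have "\<dots> \<le> ennreal (4 * (Cg * Cf))"
    using integrable_noisy_grad_square[OF z] noisy_grad_second_moment[OF z]
    by (intro ennreal_leI) (simp add: law.prob_space mult.commute)
  finally show ?thesis .
qed

lemma integral_noise_eq_0:
  assumes "z \<in> X"
  shows "(\<integral>p. noisy_grad p z (g z) - mean_grad z \<partial>law) = 0"
proof -
  interpret law: prob_space law
    by (rule prob_space_law)
  show ?thesis
    using integrable_noisy_grad[OF assms] by (simp add: mean_grad_def law.prob_space)
qed

text \<open>The sampling error \<open>gs - g\<close> is centred, so the cross term vanishes. The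
  weight \<open>1 - b\<close> of the old value is the source of the contraction.\<close>

lemma tracking_second_moment:
  assumes z[measurable]: "z \<in> X" and b: "0 \<le> b" "b \<le> 1"
  shows "(\<integral>\<^sup>+p. ennreal ((norm ((1 - b) *\<^sub>R u + b *\<^sub>R gs (fst p) z - g z))\<^sup>2) \<partial>law) \<le>
    ennreal ((1 - b)\<^sup>2 * (norm (u - g z))\<^sup>2 + b\<^sup>2 * Vg)"
proof -
  interpret law: prob_space law
    by (rule prob_space_law)
  let ?d = "\<lambda>p. gs (fst p) z - g z" and ?e = "u - g z"
  have "integrable (distr M (W \<Otimes>\<^sub>M V) (sample 0)) (\<lambda>p. gs (fst p) z)"
    using g_expectation(1)[of z] by (subst integrable_distr_eq) (auto simp: sample_def)
  moreover have "(\<integral>p. gs (fst p) z \<partial>distr M (W \<Otimes>\<^sub>M V) (sample 0)) = g z"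
    using g_expectation(2)[of z] by (subst integral_distr) (auto simp: sample_def)
  ultimately have int: "integrable law (\<lambda>p. gs (fst p) z)" and mean: "(\<integral>p. gs (fst p) z \<partial>law) = g z"
    by (simp_all add: law_def)
  have d: "integrable law ?d" and d0: "(\<integral>p. ?d p \<partial>law) = 0"
    using int mean by (simp_all add: law.prob_space)
  have sq: "integrable law (\<lambda>p. (norm (?d p))\<^sup>2)" and var: "(\<integral>p. (norm (?d p))\<^sup>2 \<partial>law) \<le> Vg"
    using gs_second_moment[OF z] constants_pos by (auto intro!: integrable_of_nn_integral_bound)
  have inner: "integrable law (\<lambda>p. ?e \<bullet> ?d p)"
    using d by (rule integrable_inner_right)
  have inner0: "(\<integral>p. ?e \<bullet> ?d p \<partial>law) = 0"
    using integral_inner_right[OF d, of ?e] d0 by simp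
  have eq: "(norm ((1 - b) *\<^sub>R u + b *\<^sub>R gs (fst p) z - g z))\<^sup>2 =
      (1 - b)\<^sup>2 * (norm ?e)\<^sup>2 + 2 * b * (1 - b) * (?e \<bullet> ?d p) + b\<^sup>2 * (norm (?d p))\<^sup>2" for p
  proof -
    have sq: "(norm (c *\<^sub>R a + b *\<^sub>R d))\<^sup>2 = c\<^sup>2 * (norm a)\<^sup>2 + 2 * b * c * (a \<bullet> d) + b\<^sup>2 * (norm d)\<^sup>2"
      for a d :: "real^'m" and c
      unfolding power2_norm_eq_inner inner_add_left inner_add_right inner_scaleR_left inner_scaleR_right
      by (simp add: inner_commute[of d a] power2_eq_square algebra_simps)
    have "(1 - b) *\<^sub>R u + b *\<^sub>R gs (fst p) z - g z = (1 - b) *\<^sub>R ?e + b *\<^sub>R ?d p"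
      by (simp add: algebra_simps)
    then show ?thesis
      by (simp only: sq)
  qed
  have "integrable law (\<lambda>p. (norm ((1 - b) *\<^sub>R u + b *\<^sub>R gs (fst p) z - g z))\<^sup>2)"
    unfolding eq using sq inner by (intro Bochner_Integration.integrable_add integrable_mult_right) auto
  then have "(\<integral>\<^sup>+p. ennreal ((norm ((1 - b) *\<^sub>R u + b *\<^sub>R gs (fst p) z - g z))\<^sup>2) \<partial>law) =
      ennreal (\<integral>p. (norm ((1 - b) *\<^sub>R u + b *\<^sub>R gs (fst p) z - g z))\<^sup>2 \<partial>law)"
    by (rule nn_integral_eq_integral) simp
  also have "(\<integral>p. (norm ((1 - b) *\<^sub>R u + b *\<^sub>R gs (fst p) z - g z))\<^sup>2 \<partial>law) =
      (1 - b)\<^sup>2 * (norm ?e)\<^sup>2 + b\<^sup>2 * (\<integral>p. (norm (?d p))\<^sup>2 \<partial>law)"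
    unfolding eq using sq inner inner0 by (simp add: law.prob_space del: inner_diff_left inner_diff_right)
  also have "ennreal \<dots> \<le> ennreal ((1 - b)\<^sup>2 * (norm ?e)\<^sup>2 + b\<^sup>2 * Vg)"
    using var by (intro ennreal_leI add_left_mono mult_left_mono) auto
  finally show ?thesis .
qed

text \<open>Unbiasedness given \<open>v 0\<close> is averaged once more: \<open>mean_grad z\<close>
  is the mean of a random vector that almost surely lies in the subdifferential. Both regimes start
  from this representation.\<close>

lemma mean_grad_version:
  assumes z: "z \<in> X"
  obtains E where "integrable M E" "mean_grad z = expectation E"
    "AE \<omega> in M. E \<omega> \<in> subdifferential (f \<circ> g) z"
proof -
  obtain E where E: "\<And>z. z \<in> X \<Longrightarrow> cond_exp_version M (vimage_algebra (space M) (v 0) V)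
                     (\<lambda>\<omega>. Gs (w 0 \<omega>) z *v grad (fs (v 0 \<omega>)) (g z)) (E z)"
    and sub: "AE \<omega> in M. \<forall>z\<in>X. E z \<omega> \<in> subdifferential (f \<circ> g) z"
    using gradient_unbiased by blast
  note version = cond_exp_version_integral[OF finite_subalgebra_v E[OF z]]
  have "mean_grad z = (\<integral>\<omega>. Gs (w 0 \<omega>) z *v grad (fs (v 0 \<omega>)) (g z) \<partial>M)"
    unfolding mean_grad_def law_def using z
    by (subst integral_distr) (auto simp: noisy_grad_def sample_def)
  then show thesis
    using version sub z by (intro that[of "E z"]) auto
qed

text \<open>The subgradient inequality is affine in the subgradient, so it passes to the
  mean.\<close>

lemma mean_grad_subgradient:
  assumes conv: "convex_on UNIV (f \<circ> g)" and z: "z \<in> X"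
  shows "(f \<circ> g) z' \<ge> (f \<circ> g) z + mean_grad z \<bullet> (z' - z)"
proof -
  obtain E where E: "integrable M E" "mean_grad z = expectation E"
    and sub: "AE \<omega> in M. E \<omega> \<in> subdifferential (f \<circ> g) z"
    using mean_grad_version[OF z] .
  have "AE \<omega> in M. E \<omega> \<bullet> (z' - z) \<le> (f \<circ> g) z' - (f \<circ> g) z"
    using sub unfolding subdifferential_convex[OF conv] by eventually_elim (auto simp: algebra_simps)
  then have "expectation (\<lambda>\<omega>. E \<omega> \<bullet> (z' - z)) \<le> expectation (\<lambda>\<omega>. (f \<circ> g) z' - (f \<circ> g) z)"
    using E(1) by (intro integral_mono_AE integrable_inner_left) auto
  then show ?thesis
    using integral_inner_left[OF E(1), of "z' - z"] E(2) by (simp add: prob_space)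
qed

lemma mean_grad_eq_grad:
  assumes "(f \<circ> g) differentiable (at z)" and z: "z \<in> X"
  shows "mean_grad z = grad (f \<circ> g) z"
proof -
  obtain E where E: "integrable M E" "mean_grad z = expectation E"
    and sub: "AE \<omega> in M. E \<omega> \<in> subdifferential (f \<circ> g) z"
    using mean_grad_version[OF z] .
  have "AE \<omega> in M. E \<omega> = grad (f \<circ> g) z"
    using sub assms(1) by (auto simp: subdifferential_def)
  then have "expectation E = expectation (\<lambda>\<omega>. grad (f \<circ> g) z)"
    using E(1) by (intro integral_cong_AE) auto
  then show ?thesis
    using E(2) by (simp add: prob_space)
qed

subsection \<open>Independence of the past\<close>

definition history :: "nat \<Rightarrow> 'a \<Rightarrow> nat \<Rightarrow> 'w \<times> 'v" where
  "history k \<omega> = (\<lambda>j\<in>{..<k}. sample j \<omega>)"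

text \<open>Sample \<open>k\<close> is excluded: \<open>x k\<close> and \<open>y k\<close> are
  measurable for \<open>past k\<close>, and sample \<open>k\<close> is independent of it, whereas
  \<open>y (Suc k)\<close> uses sample \<open>k\<close> and belongs to
  \<open>past (Suc k)\<close>.\<close>

definition past :: "nat \<Rightarrow> 'a measure" where
  "past k = vimage_algebra (space M) (history k) (PiM {..<k} (\<lambda>_. W \<Otimes>\<^sub>M V))"

lemma space_past[simp]: "space (past k) = space M"
  by (simp add: past_def)

lemma history_measurable: "history k \<in> measurable M (PiM {..<k} (\<lambda>_. W \<Otimes>\<^sub>M V))"
  unfolding history_def by measurable

lemma history_past: "history k \<in> measurable (past k) (PiM {..<k} (\<lambda>_. W \<Otimes>\<^sub>M V))"
  unfolding past_def using history_measurable
  by (intro measurable_vimage_algebra1) (auto intro: measurable_space)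

lemma past_sub: "(\<lambda>\<omega>. \<omega>) \<in> measurable M (past k)"
  unfolding past_def using history_measurable by (intro measurable_vimage_algebra2) auto

lemma past_mono: "(\<lambda>\<omega>. \<omega>) \<in> measurable (past (Suc k)) (past k)"
proof -
  have "(\<lambda>\<omega>. restrict (history (Suc k) \<omega>) {..<k}) \<in>
      measurable (past (Suc k)) (PiM {..<k} (\<lambda>_. W \<Otimes>\<^sub>M V))"
    by (rule measurable_compose[OF history_past measurable_restrict_subset]) auto
  also have "(\<lambda>\<omega>. restrict (history (Suc k) \<omega>) {..<k}) = history k"
    by (auto simp: history_def fun_eq_iff)
  finally show ?thesis
    unfolding past_def[of k] by (intro measurable_vimage_algebra2) auto
qed

lemma sample_past: "sample k \<in> measurable (past (Suc k)) (W \<Otimes>\<^sub>M V)"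
proof -
  have "(\<lambda>\<omega>. history (Suc k) \<omega> k) \<in> measurable (past (Suc k)) (W \<Otimes>\<^sub>M V)"
    by (rule measurable_compose[OF history_past measurable_component_singleton]) simp
  then show ?thesis
    by (simp add: history_def)
qed

text \<open>Independence in the form that Fubini's theorem needs. The target \<open>N\<close> is
  arbitrary so that pairs such as \<open>(x k \<omega>, y k \<omega>)\<close> can be frozen
  together.\<close>

lemma distr_past_sample:
  assumes Q: "Q \<in> measurable (past k) N"
  shows "distr M N Q \<Otimes>\<^sub>M law = distr M (N \<Otimes>\<^sub>M (W \<Otimes>\<^sub>M V)) (\<lambda>\<omega>. (Q \<omega>, sample k \<omega>))"
proof -
  let ?P = "\<lambda>A. PiM A (\<lambda>_::nat. W \<Otimes>\<^sub>M V)"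
  let ?R = "\<lambda>\<omega>. restrict (\<lambda>i. sample i \<omega>) {k}"
  have Q_M[measurable]: "Q \<in> measurable M N"
    using measurable_compose[OF past_sub Q] .
  interpret law: prob_space law
    by (rule prob_space_law)
  interpret Q: prob_space "distr M N Q"
    by (rule prob_space_distr) simp
  have "indep_var (?P {..<k}) (\<lambda>\<omega>. restrict (\<lambda>i. sample i \<omega>) {..<k}) (?P {k}) ?R"
    using independent by (intro indep_var_restrict[where I=UNIV]) (auto simp: sample_def[abs_def])
  then have ind: "indep_set (sets (past k)) (sigma_sets (space M) {?R -` A \<inter> space M |A. A \<in> sets (?P {k})})"
    unfolding indep_var_eq past_def sets_vimage_algebra history_def[abs_def] by blast
  show ?thesis
  proof (rule pair_measure_eqI)
    show "sets (distr M N Q \<Otimes>\<^sub>M law) = sets (distr M (N \<Otimes>\<^sub>M (W \<Otimes>\<^sub>M V)) (\<lambda>\<omega>. (Q \<omega>, sample k \<omega>)))"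
      by (simp add: sets_pair_measure_cong[OF sets_distr sets_law])
    fix A B assume "A \<in> sets (distr M N Q)" "B \<in> sets law"
    then have A[measurable]: "A \<in> sets N" and B[measurable]: "B \<in> sets (W \<Otimes>\<^sub>M V)"
      by auto
    let ?a = "Q -` A \<inter> space M" and ?b = "sample k -` B \<inter> space M"
    \<comment> \<open>Independence is available for blocks of samples, so an event about sample
      \<open>k\<close> is rewritten as an event about the block consisting of \<open>k\<close>
      alone.\<close>
    have "?b = ?R -` {h \<in> space (?P {k}). h k \<in> B} \<inter> space M"
      using measurable_space[OF sample_measurable[of k]] by (auto simp: space_PiM)
    moreover have "{h \<in> space (?P {k}). h k \<in> B} \<in> sets (?P {k})"
      by measurable
    ultimately have "?b \<in> sigma_sets (space M) {?R -` A \<inter> space M |A. A \<in> sets (?P {k})}"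
      by (intro sigma_sets.Basic) blast
    moreover have "?a \<in> sets (past k)"
      using measurable_sets[OF Q A] by simp
    ultimately have "prob (?a \<inter> ?b) = prob ?a * prob ?b"
      using indep_setD[OF ind] by blast
    moreover have "(\<lambda>\<omega>. (Q \<omega>, sample k \<omega>)) -` (A \<times> B) \<inter> space M = ?a \<inter> ?b"
      by auto
    ultimately show "emeasure (distr M N Q) A * emeasure law B =
        emeasure (distr M (N \<Otimes>\<^sub>M (W \<Otimes>\<^sub>M V)) (\<lambda>\<omega>. (Q \<omega>, sample k \<omega>))) (A \<times> B)"
      unfolding distr_sample[of k, symmetric]
      by (simp add: emeasure_distr emeasure_eq_measure ennreal_mult)
  qed unfold_locales
qed

text \<open>Freezing: a quantity \<open>Q\<close> of the past may be treated as a constant when averaging over the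
  current sample. This replaces conditional expectations given the past.\<close>

lemma nn_integral_freeze_le:
  assumes Q: "Q \<in> measurable (past k) N" and \<Phi>[measurable]: "\<Phi> \<in> borel_measurable (N \<Otimes>\<^sub>M (W \<Otimes>\<^sub>M V))"
    and le: "\<And>q. q \<in> space N \<Longrightarrow> (\<integral>\<^sup>+p. \<Phi> (q, p) \<partial>law) \<le> B q"
  shows "(\<integral>\<^sup>+\<omega>. \<Phi> (Q \<omega>, sample k \<omega>) \<partial>M) \<le> (\<integral>\<^sup>+\<omega>. B (Q \<omega>) \<partial>M)"
proof -
  interpret law: prob_space law
    by (rule prob_space_law)
  have [measurable]: "Q \<in> measurable M N"
    using measurable_compose[OF past_sub Q] .
  have eq: "distr M N Q \<Otimes>\<^sub>M law = distr M (N \<Otimes>\<^sub>M (W \<Otimes>\<^sub>M V)) (\<lambda>\<omega>. (Q \<omega>, sample k \<omega>))"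
    using Q by (rule distr_past_sample)
  have "(\<integral>\<^sup>+\<omega>. \<Phi> (Q \<omega>, sample k \<omega>) \<partial>M) = (\<integral>\<^sup>+z. \<Phi> z \<partial>(distr M N Q \<Otimes>\<^sub>M law))"
    unfolding eq by (subst nn_integral_distr) simp_all
  also have "\<dots> = (\<integral>\<^sup>+q. \<integral>\<^sup>+p. \<Phi> (q, p) \<partial>law \<partial>distr M N Q)"
    by (rule law.nn_integral_fst[symmetric]) measurable
  also have "\<dots> = (\<integral>\<^sup>+\<omega>. \<integral>\<^sup>+p. \<Phi> (Q \<omega>, p) \<partial>law \<partial>M)"
    by (subst nn_integral_distr) measurable
  also have "\<dots> \<le> (\<integral>\<^sup>+\<omega>. B (Q \<omega>) \<partial>M)"
    by (intro nn_integral_mono le measurable_space[of Q M]) auto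
  finally show ?thesis .
qed

lemma integral_freeze_eq_0:
  fixes \<Phi> :: "_ \<Rightarrow> real"
  assumes Q: "Q \<in> measurable (past k) N" and \<Phi>[measurable]: "\<Phi> \<in> borel_measurable (N \<Otimes>\<^sub>M (W \<Otimes>\<^sub>M V))"
    and int: "integrable M (\<lambda>\<omega>. \<Phi> (Q \<omega>, sample k \<omega>))"
    and zero: "\<And>q. q \<in> space N \<Longrightarrow> (\<integral>p. \<Phi> (q, p) \<partial>law) = 0"
  shows "expectation (\<lambda>\<omega>. \<Phi> (Q \<omega>, sample k \<omega>)) = 0"
proof -
  have [measurable]: "Q \<in> measurable M N"
    using measurable_compose[OF past_sub Q] .
  interpret law: prob_space law
    by (rule prob_space_law)
  interpret Q: prob_space "distr M N Q"
    by (rule prob_space_distr) simp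
  interpret P: pair_sigma_finite "distr M N Q" law ..
  have eq: "distr M N Q \<Otimes>\<^sub>M law = distr M (N \<Otimes>\<^sub>M (W \<Otimes>\<^sub>M V)) (\<lambda>\<omega>. (Q \<omega>, sample k \<omega>))"
    using Q by (rule distr_past_sample)
  have "expectation (\<lambda>\<omega>. \<Phi> (Q \<omega>, sample k \<omega>)) = (\<integral>z. \<Phi> z \<partial>(distr M N Q \<Otimes>\<^sub>M law))"
    unfolding eq by (subst integral_distr) simp_all
  \<comment> \<open>Fubini for a signed integrand: the integrability given on \<open>M\<close>
    carries over to the product through \<open>eq\<close>.\<close>
  also have "\<dots> = (\<integral>q. \<integral>p. \<Phi> (q, p) \<partial>law \<partial>distr M N Q)"
    using int by (intro P.integral_fst'[symmetric]) (simp add: eq integrable_distr_eq)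
  also have "\<dots> = (\<integral>q. 0 \<partial>distr M N Q)"
    by (intro Bochner_Integration.integral_cong) (auto simp: zero)
  finally show ?thesis
    by simp
qed

end

subsection \<open>Moments along the iteration\<close>

locale scgd = stochastic_composition M W V w v X f g fs gs Gs Cg Cf Vg Lf
  for M :: "'a measure" and W :: "'w measure" and V :: "'v measure"
    and w :: "nat \<Rightarrow> 'a \<Rightarrow> 'w" and v :: "nat \<Rightarrow> 'a \<Rightarrow> 'v"
    and X :: "(real^'n) set"
    and f :: "real^'m \<Rightarrow> real" and g :: "real^'n \<Rightarrow> real^'m"
    and fs :: "'v \<Rightarrow> real^'m \<Rightarrow> real" and gs :: "'w \<Rightarrow> real^'n \<Rightarrow> real^'m"
    and Gs :: "'w \<Rightarrow> real^'n \<Rightarrow> real^'m^'n"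
    and Cg Cf Vg Lf :: real +
  fixes \<alpha> \<beta> :: "nat \<Rightarrow> real"
    and x0 :: "real^'n" and y0 :: "real^'m"
    and x :: "nat \<Rightarrow> 'a \<Rightarrow> real^'n" and y :: "nat \<Rightarrow> 'a \<Rightarrow> real^'m"
  assumes steps: "\<And>k. 0 < \<alpha> k \<and> \<alpha> k \<le> 1" "\<And>k. 0 < \<beta> k \<and> \<beta> k \<le> 1"
    and sum_alpha: "filterlim (\<lambda>N. \<Sum>k<N. \<alpha> k) at_top sequentially"
    and sum_squares: "summable (\<lambda>k. (\<alpha> k)\<^sup>2 + (\<beta> k)\<^sup>2 + (\<alpha> k)\<^sup>2 / \<beta> k)"
    and x0: "x0 \<in> X"
    and init: "\<And>\<omega>. \<omega> \<in> space M \<Longrightarrow> x 0 \<omega> = x0" "\<And>\<omega>. \<omega> \<in> space M \<Longrightarrow> y 0 \<omega> = y0"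
    and y_step: "\<And>k \<omega>. \<omega> \<in> space M \<Longrightarrow>
      y (Suc k) \<omega> = (1 - \<beta> k) *\<^sub>R y k \<omega> + \<beta> k *\<^sub>R gs (w k \<omega>) (x k \<omega>)"
    and x_step: "\<And>k \<omega>. \<omega> \<in> space M \<Longrightarrow>
      x (Suc k) \<omega> = closest_point X
        (x k \<omega> - \<alpha> k *\<^sub>R (Gs (w k \<omega>) (x k \<omega>) *v grad (fs (v k \<omega>)) (y (Suc k) \<omega>)))"
begin

definition dir :: "nat \<Rightarrow> 'a \<Rightarrow> real^'n" where
  "dir k \<omega> = noisy_grad (sample k \<omega>) (x k \<omega>) (y (Suc k) \<omega>)"

definition unbiased_dir :: "nat \<Rightarrow> 'a \<Rightarrow> real^'n" where
  "unbiased_dir k \<omega> = noisy_grad (sample k \<omega>) (x k \<omega>) (g (x k \<omega>))"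

definition noise :: "nat \<Rightarrow> 'a \<Rightarrow> real^'n" where
  "noise k \<omega> = unbiased_dir k \<omega> - mean_grad (x k \<omega>)"

text \<open>The two errors are half a step apart. \<open>dir k\<close> is evaluated at
  \<open>y (Suc k)\<close>, so its bias is governed by \<open>tracking k\<close>; the recursion
  closes through \<open>lag (Suc k)\<close>, which compares the same \<open>y (Suc k)\<close> with
  \<open>g\<close> at the moved point.\<close>

definition tracking :: "nat \<Rightarrow> 'a \<Rightarrow> real" where
  "tracking k \<omega> = norm (y (Suc k) \<omega> - g (x k \<omega>))"

definition lag :: "nat \<Rightarrow> 'a \<Rightarrow> real" where
  "lag k \<omega> = norm (y k \<omega> - g (x k \<omega>))"

lemma x_Suc: "\<omega> \<in> space M \<Longrightarrow> x (Suc k) \<omega> = closest_point X (x k \<omega> - \<alpha> k *\<^sub>R dir k \<omega>)"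
  using x_step by (simp add: dir_def noisy_grad_def sample_def)

lemma x_in_X: "\<omega> \<in> space M \<Longrightarrow> x k \<omega> \<in> X"
  using X_props x0 by (cases k) (auto simp: init x_Suc closest_point_in_set)

lemma closest_point_measurable: "closest_point X \<in> borel_measurable borel"
  using X_props by (intro borel_measurable_continuous_onI continuous_on_closest_point)

text \<open>The induction is joint, and within a step \<open>y (Suc k)\<close> precedes
  \<open>x (Suc k)\<close>, whose direction it enters. The recursions hold on \<open>space M\<close>
  only, so measurability is transferred by congruence.\<close>

lemma xy_past: "x k \<in> measurable (past k) XB \<and> y k \<in> borel_measurable (past k)"
proof (induction k)
  case 0
  have "x 0 \<in> measurable (past 0) XB \<longleftrightarrow> (\<lambda>_. x0) \<in> measurable (past 0) XB"
    by (rule measurable_cong) (simp add: init)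
  moreover have "y 0 \<in> borel_measurable (past 0) \<longleftrightarrow> (\<lambda>_. y0) \<in> borel_measurable (past 0)"
    by (rule measurable_cong) (simp add: init)
  ultimately show ?case
    using x0 by simp
next
  case (Suc k)
  have xk[measurable]: "x k \<in> measurable (past (Suc k)) XB"
    and yk[measurable]: "y k \<in> borel_measurable (past (Suc k))"
    using Suc measurable_compose[OF past_mono] by auto
  note sample_past[measurable]
  have wk[measurable]: "w k \<in> measurable (past (Suc k)) W" and vk[measurable]: "v k \<in> measurable (past (Suc k)) V"
    using measurable_compose[OF sample_past measurable_fst]
      measurable_compose[OF sample_past measurable_snd] by (auto simp: sample_def)
  have [measurable]: "x k \<in> borel_measurable (past (Suc k))"
    using measurable_compose[OF xk id_XB] .
  have "y (Suc k) \<in> borel_measurable (past (Suc k)) \<longleftrightarrow>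
      (\<lambda>\<omega>. (1 - \<beta> k) *\<^sub>R y k \<omega> + \<beta> k *\<^sub>R gs (w k \<omega>) (x k \<omega>)) \<in> borel_measurable (past (Suc k))"
    by (rule measurable_cong) (simp add: y_step)
  then have y[measurable]: "y (Suc k) \<in> borel_measurable (past (Suc k))"
    by simp
  have "x (Suc k) \<in> borel_measurable (past (Suc k)) \<longleftrightarrow>
      (\<lambda>\<omega>. closest_point X (x k \<omega> - \<alpha> k *\<^sub>R dir k \<omega>)) \<in> borel_measurable (past (Suc k))"
    by (rule measurable_cong) (simp add: x_Suc)
  moreover have "(\<lambda>\<omega>. closest_point X (x k \<omega> - \<alpha> k *\<^sub>R dir k \<omega>)) \<in> borel_measurable (past (Suc k))"
    unfolding dir_def by (rule measurable_compose[OF _ closest_point_measurable]) measurable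
  ultimately have "x (Suc k) \<in> measurable (past (Suc k)) XB"
    by (intro measurable_restrict_space2) (auto simp: x_in_X)
  with y show ?case
    by simp
qed

lemmas x_past = xy_past[THEN conjunct1] and y_past = xy_past[THEN conjunct2]

lemma x_XB[measurable]: "x k \<in> measurable M XB"
  and y_measurable[measurable]: "y k \<in> borel_measurable M"
  using measurable_compose[OF past_sub x_past] measurable_compose[OF past_sub y_past] by auto

lemma x_measurable[measurable]: "x k \<in> borel_measurable M"
  using measurable_compose[OF x_XB id_XB] .

lemma derived_measurable[measurable]:
  "dir k \<in> borel_measurable M" "unbiased_dir k \<in> borel_measurable M" "noise k \<in> borel_measurable M"
  "tracking k \<in> borel_measurable M" "lag k \<in> borel_measurable M"
proof -
  show [measurable]: "dir k \<in> borel_measurable M" "unbiased_dir k \<in> borel_measurable M"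
    unfolding dir_def[abs_def] unbiased_dir_def[abs_def] by measurable
  show "noise k \<in> borel_measurable M" "tracking k \<in> borel_measurable M" "lag k \<in> borel_measurable M"
    unfolding noise_def[abs_def] tracking_def[abs_def] lag_def[abs_def] by measurable
qed

lemma noise_past: "noise k \<in> borel_measurable (past (Suc k))"
proof -
  note sample_past[measurable]
  have x[measurable]: "x k \<in> measurable (past (Suc k)) XB"
    using measurable_compose[OF past_mono x_past] .
  have [measurable]: "x k \<in> borel_measurable (past (Suc k))"
    using measurable_compose[OF x id_XB] .
  show ?thesis
    unfolding noise_def[abs_def] unbiased_dir_def[abs_def] by measurable
qed

lemma
  shows integrable_dir: "integrable M (\<lambda>\<omega>. (norm (dir k \<omega>))\<^sup>2)"
    and dir_second_moment: "expectation (\<lambda>\<omega>. (norm (dir k \<omega>))\<^sup>2) \<le> Cg * Cf"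
proof -
  \<comment> \<open>With \<open>x k\<close> and \<open>y k\<close> frozen, \<open>y (Suc k)\<close>
    is a function of the current \<open>w\<close> alone, which the bound for a single sample admits
    as evaluation point.\<close>
  let ?\<Phi> = "\<lambda>q. ennreal ((norm (noisy_grad (snd q) (fst (fst q))
      ((1 - \<beta> k) *\<^sub>R snd (fst q) + \<beta> k *\<^sub>R gs (fst (snd q)) (fst (fst q)))))\<^sup>2)"
  have "(\<integral>\<^sup>+\<omega>. ennreal ((norm (dir k \<omega>))\<^sup>2) \<partial>M) = (\<integral>\<^sup>+\<omega>. ?\<Phi> ((x k \<omega>, y k \<omega>), sample k \<omega>) \<partial>M)"
    by (intro nn_integral_cong) (simp add: dir_def y_step sample_def)
  also have "\<dots> \<le> (\<integral>\<^sup>+\<omega>. ennreal (Cg * Cf) \<partial>M)"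
  proof (rule nn_integral_freeze_le[where B="\<lambda>_. ennreal (Cg * Cf)" and N="XB \<Otimes>\<^sub>M borel"])
    show "(\<lambda>\<omega>. (x k \<omega>, y k \<omega>)) \<in> measurable (past k) (XB \<Otimes>\<^sub>M borel)"
      using x_past y_past by (rule measurable_Pair)
    fix q assume "q \<in> space (XB \<Otimes>\<^sub>M (borel :: (real^'m) measure))"
    then obtain z u where q: "q = (z, u)" "z \<in> X"
      by (auto simp: space_pair_measure space_restrict_space)
    then show "(\<integral>\<^sup>+p. ?\<Phi> (q, p) \<partial>law) \<le> ennreal (Cg * Cf)"
      using noisy_grad_second_moment_weighted[OF q(2), of "\<lambda>c. (1 - \<beta> k) *\<^sub>R u + \<beta> k *\<^sub>R gs c z"]
      by simp
  qed measurable
  finally have "(\<integral>\<^sup>+\<omega>. ennreal ((norm (dir k \<omega>))\<^sup>2) \<partial>M) \<le> ennreal (Cg * Cf)"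
    by (simp add: emeasure_space_1)
  then show "integrable M (\<lambda>\<omega>. (norm (dir k \<omega>))\<^sup>2)"
    "expectation (\<lambda>\<omega>. (norm (dir k \<omega>))\<^sup>2) \<le> Cg * Cf"
    using constants_pos by (auto intro!: integrable_of_nn_integral_bound)
qed

text \<open>The weight depends on \<open>x k\<close> only, so it is constant while sample
  \<open>k\<close> is averaged. Both pairs of claims are instances of one statement about a function
  \<open>R\<close> whose mean over a sample is at most \<open>c\<close>.\<close>

lemma
  assumes \<phi>[measurable]: "\<phi> \<in> borel_measurable XB"
    and int: "integrable M (\<lambda>\<omega>. (norm (\<phi> (x k \<omega>) :: real^'n))\<^sup>2)"
  shows integrable_weighted_Gnorm:
      "integrable M (\<lambda>\<omega>. (Gnorm (w k \<omega>) (x k \<omega>))\<^sup>2 * (norm (\<phi> (x k \<omega>)))\<^sup>2)"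
    and weighted_Gnorm_le: "expectation (\<lambda>\<omega>. (Gnorm (w k \<omega>) (x k \<omega>))\<^sup>2 * (norm (\<phi> (x k \<omega>)))\<^sup>2) \<le>
      Cg * expectation (\<lambda>\<omega>. (norm (\<phi> (x k \<omega>)))\<^sup>2)"
    and integrable_weighted_noise: "integrable M (\<lambda>\<omega>. (norm (noise k \<omega>))\<^sup>2 * (norm (\<phi> (x k \<omega>)))\<^sup>2)"
    and weighted_noise_le: "expectation (\<lambda>\<omega>. (norm (noise k \<omega>))\<^sup>2 * (norm (\<phi> (x k \<omega>)))\<^sup>2) \<le>
      4 * (Cg * Cf) * expectation (\<lambda>\<omega>. (norm (\<phi> (x k \<omega>)))\<^sup>2)"
proof -
  have main: "integrable M (\<lambda>\<omega>. R (x k \<omega>, sample k \<omega>) * (norm (\<phi> (x k \<omega>)))\<^sup>2) \<and>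
      expectation (\<lambda>\<omega>. R (x k \<omega>, sample k \<omega>) * (norm (\<phi> (x k \<omega>)))\<^sup>2) \<le>
        c * expectation (\<lambda>\<omega>. (norm (\<phi> (x k \<omega>)))\<^sup>2)"
    if [measurable]: "R \<in> borel_measurable (XB \<Otimes>\<^sub>M (W \<Otimes>\<^sub>M V))" and c: "0 \<le> c" and nonneg: "\<And>z p. 0 \<le> R (z, p)"
      and R: "\<And>z. z \<in> X \<Longrightarrow> (\<integral>\<^sup>+p. ennreal (R (z, p)) \<partial>law) \<le> ennreal c"
    for R :: "(real^'n) \<times> 'w \<times> 'v \<Rightarrow> real" and c :: real
  proof -
    let ?\<Phi> = "\<lambda>(z, p). ennreal (R (z, p) * (norm (\<phi> z))\<^sup>2)"
    have "(\<integral>\<^sup>+\<omega>. ?\<Phi> (x k \<omega>, sample k \<omega>) \<partial>M) \<le> (\<integral>\<^sup>+\<omega>. ennreal (c * (norm (\<phi> (x k \<omega>)))\<^sup>2) \<partial>M)"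
    proof (rule nn_integral_freeze_le[where N=XB, OF x_past])
      fix z assume "z \<in> space XB"
      then have z[measurable]: "z \<in> X"
        by (simp add: space_restrict_space)
      have "(\<integral>\<^sup>+p. ?\<Phi> (z, p) \<partial>law) = (\<integral>\<^sup>+p. ennreal (R (z, p)) * ennreal ((norm (\<phi> z))\<^sup>2) \<partial>law)"
        using nonneg by (simp add: ennreal_mult)
      also have "\<dots> = (\<integral>\<^sup>+p. ennreal (R (z, p)) \<partial>law) * ennreal ((norm (\<phi> z))\<^sup>2)"
        by (rule nn_integral_multc) measurable
      also have "\<dots> \<le> ennreal c * ennreal ((norm (\<phi> z))\<^sup>2)"
        using R[OF z] by (rule mult_right_mono) simp
      also have "\<dots> = ennreal (c * (norm (\<phi> z))\<^sup>2)"
        using c by (simp add: ennreal_mult)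
      finally show "(\<integral>\<^sup>+p. ?\<Phi> (z, p) \<partial>law) \<le> ennreal (c * (norm (\<phi> z))\<^sup>2)" .
    qed measurable
    also have "\<dots> = ennreal (\<integral>\<omega>. c * (norm (\<phi> (x k \<omega>)))\<^sup>2 \<partial>M)"
      using int c by (intro nn_integral_eq_integral) auto
    finally have "(\<integral>\<^sup>+\<omega>. ennreal (R (x k \<omega>, sample k \<omega>) * (norm (\<phi> (x k \<omega>)))\<^sup>2) \<partial>M) \<le>
        ennreal (c * expectation (\<lambda>\<omega>. (norm (\<phi> (x k \<omega>)))\<^sup>2))"
      by simp
    then show ?thesis
      using c by (auto intro!: integrable_of_nn_integral_bound mult_nonneg_nonneg nonneg)
  qed
  have "(\<lambda>(z, p). (Gnorm (fst p) z)\<^sup>2) \<in> borel_measurable (XB \<Otimes>\<^sub>M (W \<Otimes>\<^sub>M V))"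
    by measurable
  from main[OF this, of Cg] show
    "integrable M (\<lambda>\<omega>. (Gnorm (w k \<omega>) (x k \<omega>))\<^sup>2 * (norm (\<phi> (x k \<omega>)))\<^sup>2)"
    "expectation (\<lambda>\<omega>. (Gnorm (w k \<omega>) (x k \<omega>))\<^sup>2 * (norm (\<phi> (x k \<omega>)))\<^sup>2) \<le>
      Cg * expectation (\<lambda>\<omega>. (norm (\<phi> (x k \<omega>)))\<^sup>2)"
    using Gnorm_second_moment constants_pos by (auto simp: sample_def)
  have "(\<lambda>(z, p). (norm (noisy_grad p z (g z) - mean_grad z))\<^sup>2) \<in> borel_measurable (XB \<Otimes>\<^sub>M (W \<Otimes>\<^sub>M V))"
    by measurable
  from main[OF this, of "4 * (Cg * Cf)"] show
    "integrable M (\<lambda>\<omega>. (norm (noise k \<omega>))\<^sup>2 * (norm (\<phi> (x k \<omega>)))\<^sup>2)"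
    "expectation (\<lambda>\<omega>. (norm (noise k \<omega>))\<^sup>2 * (norm (\<phi> (x k \<omega>)))\<^sup>2) \<le>
      4 * (Cg * Cf) * expectation (\<lambda>\<omega>. (norm (\<phi> (x k \<omega>)))\<^sup>2)"
    using noise_second_moment constants_pos by (auto simp: noise_def unbiased_dir_def)
qed

end

section \<open>Young's inequality, Fejer convergence and the descent inequality\<close>

lemma young_inequality:
  fixes b s t :: real
  assumes "0 < b"
  shows "2 * s * t \<le> b * s\<^sup>2 + t\<^sup>2 / b"
proof -
  have "0 \<le> b * (s - t / b)\<^sup>2"
    using assms by simp
  also have "\<dots> = b * s\<^sup>2 - 2 * s * t + t\<^sup>2 / b"
    using assms by (simp add: power2_eq_square field_simps)
  finally show ?thesis
    by simp
qed

text \<open>Fejer monotonicity: convergence of the distances to a dense set of solutions turns one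
  accumulation point in the solution set into the limit.\<close>

lemma fejer_convergence:
  fixes u :: "nat \<Rightarrow> 'b::euclidean_space" and F :: "'b \<Rightarrow> real"
  assumes S: "S = {z \<in> X. F z \<le> m}" "S \<noteq> {}" and X: "closed X" "\<And>k. u k \<in> X"
    and F: "continuous_on UNIV F"
    and D: "D \<subseteq> S" "S \<subseteq> closure D"
    and conv: "\<And>z. z \<in> D \<Longrightarrow> convergent (\<lambda>k. (norm (u k - z))\<^sup>2)"
    and small: "\<And>\<epsilon> N. 0 < \<epsilon> \<Longrightarrow> \<exists>k\<ge>N. F (u k) < m + \<epsilon>"
  shows "\<exists>l\<in>S. u \<longlonglongrightarrow> l"
proof -
  obtain z0 where z0: "z0 \<in> D"
    using S(2) D(2) by fastforce
  obtain B where B: "\<And>k. norm ((norm (u k - z0))\<^sup>2) \<le> B"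
    using convergent_imp_Bseq[OF conv[OF z0]] unfolding Bseq_def by blast
  \<comment> \<open>\<open>1 + B\<close> stands in for the square root of \<open>B\<close>, since
    \<open>B\<close> is at most the square of \<open>1 + B\<close>.\<close>
  have "norm (u k - z0) \<le> 1 + B" for k
  proof (rule power2_le_imp_le)
    show "(norm (u k - z0))\<^sup>2 \<le> (1 + B)\<^sup>2"
      using B[of k] by (simp add: power2_sum) (smt (verit) zero_le_power2)
    show "0 \<le> 1 + B"
      using B[of k] norm_ge_zero by (smt (verit))
  qed
  then have bdd: "bounded (range u)"
    by (intro boundedI[of _ "1 + B + norm z0"]) (smt (verit) norm_triangle_sub rangeE)
  have "\<exists>k. \<forall>n. k n \<ge> n \<and> F (u (k n)) < m + 1 / Suc n"
    by (rule choice) (use small in simp)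
  then obtain k where k: "\<And>n. k n \<ge> n" "\<And>n. F (u (k n)) < m + 1 / Suc n"
    by blast
  have "bounded (range (u \<circ> k))"
    using bdd by (rule bounded_subset) auto
  then obtain l r where r: "strict_mono (r :: nat \<Rightarrow> nat)" and l: "((u \<circ> k) \<circ> r) \<longlonglongrightarrow> l"
    using bounded_imp_convergent_subsequence by blast
  have kr: "filterlim (\<lambda>n. k (r n)) at_top sequentially"
    by (rule filterlim_at_top_mono[OF filterlim_ident])
      (use k(1) seq_suble[OF r] in \<open>auto intro: order_trans always_eventually\<close>)
  have "l \<in> X"
    using X l by (intro closed_sequentially[OF X(1) _ l]) auto
  moreover have "F l \<le> m"
  proof (rule LIMSEQ_le)
    show "(\<lambda>n. F (((u \<circ> k) \<circ> r) n)) \<longlonglongrightarrow> F l"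
      by (rule continuous_on_tendsto_compose[OF F l]) auto
    have "(\<lambda>n. m + 1 / Suc n) \<longlonglongrightarrow> m + 0"
      by (intro tendsto_intros LIMSEQ_Suc lim_1_over_n)
    then show "(\<lambda>n. m + 1 / Suc (r n)) \<longlonglongrightarrow> m"
      using LIMSEQ_subseq_LIMSEQ[OF _ r] by (fastforce simp: comp_def)
    show "\<exists>N. \<forall>n\<ge>N. F (((u \<circ> k) \<circ> r) n) \<le> m + 1 / Suc (r n)"
      using k(2) by (auto intro: less_imp_le)
  qed
  ultimately have lS: "l \<in> S"
    using S by blast
  have "u \<longlonglongrightarrow> l"
  proof (rule LIMSEQ_I)
    fix e :: real assume e: "0 < e"
    \<comment> \<open>\<open>l\<close> need not lie in \<open>D\<close>, so distances to
      \<open>l\<close> are not yet known to converge. A nearby \<open>z\<close> in \<open>D\<close>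
      has convergent distances, and their limit is identified along the subsequence.\<close>
    obtain z where z: "z \<in> D" "dist z l < e / 2"
      using lS D(2) e closure_approachable[of l D] by (metis half_gt_zero subsetD)
    obtain c where c: "(\<lambda>k. (norm (u k - z))\<^sup>2) \<longlonglongrightarrow> c"
      using conv[OF z(1)] unfolding convergent_def by blast
    have "(\<lambda>n. (norm (u (k (r n)) - z))\<^sup>2) \<longlonglongrightarrow> c"
      using filterlim_compose[OF c kr] .
    moreover have "(\<lambda>n. (norm (u (k (r n)) - z))\<^sup>2) \<longlonglongrightarrow> (norm (l - z))\<^sup>2"
      using l by (intro tendsto_intros) (simp add: comp_def)
    ultimately have "c = (norm (l - z))\<^sup>2"
      by (rule LIMSEQ_unique)
    also have "\<dots> < (e / 2)\<^sup>2"
      using z(2) by (intro power_strict_mono) (auto simp: dist_norm norm_minus_commute)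
    finally have "\<forall>\<^sub>F k in sequentially. (norm (u k - z))\<^sup>2 < (e / 2)\<^sup>2"
      by (rule order_tendstoD(2)[OF c])
    then obtain N where N: "\<And>n. n \<ge> N \<Longrightarrow> (norm (u n - z))\<^sup>2 < (e / 2)\<^sup>2"
      unfolding eventually_sequentially by blast
    have "norm (u n - l) < e" if "n \<ge> N" for n
    proof -
      have "norm (u n - z) < e / 2"
        by (rule power2_less_imp_less[OF N[OF that]]) (use e in simp)
      then show ?thesis
        using z(2) norm_triangle_lt[of "u n - z" "z - l" e] by (simp add: dist_norm)
    qed
    then show "\<exists>N. \<forall>n\<ge>N. norm (u n - l) < e"
      by blast
  qed
  with lS show ?thesis
    by blast
qed

text \<open>The mean value theorem at one intermediate point, with \<open>t < 1\<close>, gives the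
  constant \<open>L\<close>; integrating along the segment would give \<open>L / 2\<close>.\<close>

lemma lipschitz_gradient_descent:
  fixes F :: "'b::euclidean_space \<Rightarrow> real"
  assumes diff: "\<And>z. F differentiable (at z)" and lip: "L-lipschitz_on UNIV (grad F)"
  shows "F (z + h) \<le> F z + grad F z \<bullet> h + L * (norm h)\<^sup>2"
proof -
  have deriv: "((\<lambda>t. F (z + t *\<^sub>R h)) has_derivative (\<lambda>s. (s *\<^sub>R h) \<bullet> grad F (z + t *\<^sub>R h))) (at t)"
    for t :: real
  proof -
    have "((\<lambda>t. z + t *\<^sub>R h) has_derivative (\<lambda>s. s *\<^sub>R h)) (at t)"
      by (auto intro!: derivative_eq_intros)
    moreover have "(F has_derivative (\<lambda>h'. h' \<bullet> grad F (z + t *\<^sub>R h))) (at (z + t *\<^sub>R h))"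
      using GDERIV_grad[OF diff] by (simp add: gderiv_def)
    ultimately show ?thesis
      by (rule has_derivative_compose)
  qed
  have "\<exists>t\<in>{0<..<1 :: real}. F (z + 1 *\<^sub>R h) - F (z + 0 *\<^sub>R h) = ((1 - 0) *\<^sub>R h) \<bullet> grad F (z + t *\<^sub>R h)"
    by (rule mvt_simple, simp, rule has_derivative_at_withinI, rule deriv)
  then obtain t :: real where t: "t \<in> {0<..<1}"
    and eq: "F (z + 1 *\<^sub>R h) - F (z + 0 *\<^sub>R h) = ((1 - 0) *\<^sub>R h) \<bullet> grad F (z + t *\<^sub>R h)"
    by blast
  have "h \<bullet> (grad F (z + t *\<^sub>R h) - grad F z) \<le> norm h * norm (grad F (z + t *\<^sub>R h) - grad F z)"
    by (rule norm_cauchy_schwarz)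
  also have "\<dots> \<le> norm h * (L * norm (t *\<^sub>R h))"
    using lipschitz_onD[OF lip, of "z + t *\<^sub>R h" z] by (intro mult_left_mono) (auto simp: dist_norm)
  also have "\<dots> = t * (L * (norm h)\<^sup>2)"
    using t by (simp add: power2_eq_square)
  also have "\<dots> \<le> 1 * (L * (norm h)\<^sup>2)"
    using t lipschitz_on_nonneg[OF lip] by (intro mult_right_mono) auto
  finally show ?thesis
    using eq by (simp add: inner_commute[of h] inner_diff_left)
qed

section \<open>Tracking error, bias and noise along the iteration\<close>

context scgd
begin

lemma summable_steps: "summable (\<lambda>k. (\<alpha> k)\<^sup>2)" "summable (\<lambda>k. (\<beta> k)\<^sup>2)" "summable (\<lambda>k. (\<alpha> k)\<^sup>2 / \<beta> k)"
proof -
  have pos: "0 < \<beta> k" "0 \<le> (\<alpha> k)\<^sup>2 / \<beta> k" for k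
    using steps(2)[of k] by simp_all
  then show "summable (\<lambda>k. (\<alpha> k)\<^sup>2)" "summable (\<lambda>k. (\<beta> k)\<^sup>2)" "summable (\<lambda>k. (\<alpha> k)\<^sup>2 / \<beta> k)"
    by (auto intro!: summable_comparison_test'[OF sum_squares, of 0] simp: abs_of_pos)
qed

text \<open>Projection is nonexpansive and fixes \<open>z\<close>. A solution \<open>z\<close> gives
  the Fejer step; \<open>z = x k \<omega>\<close> bounds the length of the step.\<close>

lemma dist_x_Suc_le:
  assumes "\<omega> \<in> space M" "z \<in> X"
  shows "norm (x (Suc k) \<omega> - z) \<le> norm (x k \<omega> - \<alpha> k *\<^sub>R dir k \<omega> - z)"
  using closest_point_lipschitz[OF X_props(3,2,1), of "x k \<omega> - \<alpha> k *\<^sub>R dir k \<omega>" z] assms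
  by (simp add: x_Suc closest_point_self dist_norm)

text \<open>Moving from \<open>x k\<close> to \<open>x (Suc k)\<close> changes \<open>g\<close> by
  at most \<open>Cg * (\<alpha> k * norm (dir k \<omega>))\<close>. Young's inequality with weight
  \<open>\<beta> k\<close> costs the factor \<open>1 + \<beta> k\<close>, small enough for the
  contraction to absorb. The constant 2 merges the plain square with its quotient by
  \<open>\<beta> k\<close>, as \<open>\<beta> k \<le> 1\<close>.\<close>

lemma lag_Suc_le:
  assumes \<omega>: "\<omega> \<in> space M"
  shows "(lag (Suc k) \<omega>)\<^sup>2 \<le> (1 + \<beta> k) * (tracking k \<omega>)\<^sup>2 +
    2 * Cg\<^sup>2 * ((\<alpha> k)\<^sup>2 / \<beta> k) * (norm (dir k \<omega>))\<^sup>2"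
proof -
  let ?s = "tracking k \<omega>" and ?t = "Cg * (\<alpha> k * norm (dir k \<omega>))"
  have "norm (g (x k \<omega>) - g (x (Suc k) \<omega>)) \<le> Cg * norm (x (Suc k) \<omega> - x k \<omega>)"
    using lipschitz_onD[OF g_lipschitz, of "x (Suc k) \<omega>" "x k \<omega>"] by (simp add: dist_norm norm_minus_commute)
  also have "\<dots> \<le> ?t"
    using dist_x_Suc_le[OF \<omega> x_in_X[OF \<omega>], of k k] steps(1)[of k] constants_pos
    by (intro mult_left_mono) (auto simp: diff_right_commute)
  finally have "lag (Suc k) \<omega> \<le> ?s + ?t"
    unfolding lag_def tracking_def
    using norm_triangle_ineq[of "y (Suc k) \<omega> - g (x k \<omega>)" "g (x k \<omega>) - g (x (Suc k) \<omega>)"] by simp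
  then have "(lag (Suc k) \<omega>)\<^sup>2 \<le> (?s + ?t)\<^sup>2"
    by (rule power_mono) (simp add: lag_def)
  also have "\<dots> \<le> (1 + \<beta> k) * ?s\<^sup>2 + ?t\<^sup>2 / \<beta> k + ?t\<^sup>2"
    using young_inequality[of "\<beta> k" ?s ?t] steps(2)[of k] unfolding power2_sum by (simp add: algebra_simps)
  also have "\<dots> \<le> (1 + \<beta> k) * ?s\<^sup>2 + 2 * (?t\<^sup>2 / \<beta> k)"
  proof -
    have "?t\<^sup>2 \<le> ?t\<^sup>2 / \<beta> k"
      using steps(2)[of k] mult_left_le[of "\<beta> k" "?t\<^sup>2"] by (subst pos_le_divide_eq) simp_all
    then show ?thesis
      by simp
  qed
  also have "\<dots> = (1 + \<beta> k) * ?s\<^sup>2 + 2 * Cg\<^sup>2 * ((\<alpha> k)\<^sup>2 / \<beta> k) * (norm (dir k \<omega>))\<^sup>2"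
    by (simp add: power_mult_distrib)
  finally show ?thesis .
qed

lemma
  assumes int: "integrable M (\<lambda>\<omega>. (lag k \<omega>)\<^sup>2)"
  shows integrable_tracking: "integrable M (\<lambda>\<omega>. (tracking k \<omega>)\<^sup>2)"
    and tracking_moment_le: "expectation (\<lambda>\<omega>. (tracking k \<omega>)\<^sup>2) \<le>
      (1 - \<beta> k)\<^sup>2 * expectation (\<lambda>\<omega>. (lag k \<omega>)\<^sup>2) + (\<beta> k)\<^sup>2 * Vg"
proof -
  let ?\<Phi> = "\<lambda>q. ennreal ((norm ((1 - \<beta> k) *\<^sub>R snd (fst q) +
      \<beta> k *\<^sub>R gs (fst (snd q)) (fst (fst q)) - g (fst (fst q))))\<^sup>2)"
  let ?B = "\<lambda>(z, u). ennreal ((1 - \<beta> k)\<^sup>2 * (norm (u - g z))\<^sup>2 + (\<beta> k)\<^sup>2 * Vg)"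
  have "(\<integral>\<^sup>+\<omega>. ennreal ((tracking k \<omega>)\<^sup>2) \<partial>M) = (\<integral>\<^sup>+\<omega>. ?\<Phi> ((x k \<omega>, y k \<omega>), sample k \<omega>) \<partial>M)"
    by (intro nn_integral_cong) (simp add: tracking_def y_step sample_def)
  also have "\<dots> \<le> (\<integral>\<^sup>+\<omega>. ?B (x k \<omega>, y k \<omega>) \<partial>M)"
  proof (rule nn_integral_freeze_le[where B="?B" and N="XB \<Otimes>\<^sub>M borel"])
    show "(\<lambda>\<omega>. (x k \<omega>, y k \<omega>)) \<in> measurable (past k) (XB \<Otimes>\<^sub>M borel)"
      using x_past y_past by (rule measurable_Pair)
    fix q assume "q \<in> space (XB \<Otimes>\<^sub>M (borel :: (real^'m) measure))"
    then obtain z u where q: "q = (z, u)" "z \<in> X"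
      by (auto simp: space_pair_measure space_restrict_space)
    then show "(\<integral>\<^sup>+p. ?\<Phi> (q, p) \<partial>law) \<le> ?B q"
      using tracking_second_moment[OF q(2), of "\<beta> k" u] steps(2)[of k] by simp
  qed measurable
  also have "\<dots> = (\<integral>\<^sup>+\<omega>. ennreal ((1 - \<beta> k)\<^sup>2 * (lag k \<omega>)\<^sup>2 + (\<beta> k)\<^sup>2 * Vg) \<partial>M)"
    by (simp add: lag_def)
  also have "\<dots> = ennreal (expectation (\<lambda>\<omega>. (1 - \<beta> k)\<^sup>2 * (lag k \<omega>)\<^sup>2 + (\<beta> k)\<^sup>2 * Vg))"
    using int constants_pos by (intro nn_integral_eq_integral) auto
  also have "expectation (\<lambda>\<omega>. (1 - \<beta> k)\<^sup>2 * (lag k \<omega>)\<^sup>2 + (\<beta> k)\<^sup>2 * Vg) =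
      (1 - \<beta> k)\<^sup>2 * expectation (\<lambda>\<omega>. (lag k \<omega>)\<^sup>2) + (\<beta> k)\<^sup>2 * Vg"
    using int by (simp add: prob_space)
  finally have "(\<integral>\<^sup>+\<omega>. ennreal ((tracking k \<omega>)\<^sup>2) \<partial>M) \<le>
      ennreal ((1 - \<beta> k)\<^sup>2 * expectation (\<lambda>\<omega>. (lag k \<omega>)\<^sup>2) + (\<beta> k)\<^sup>2 * Vg)" .
  note bound = integrable_of_nn_integral_bound[OF _ _ this]
  show "integrable M (\<lambda>\<omega>. (tracking k \<omega>)\<^sup>2)"
    "expectation (\<lambda>\<omega>. (tracking k \<omega>)\<^sup>2) \<le>
      (1 - \<beta> k)\<^sup>2 * expectation (\<lambda>\<omega>. (lag k \<omega>)\<^sup>2) + (\<beta> k)\<^sup>2 * Vg"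
    by (rule bound; use constants_pos in simp)+
qed

lemma integrable_lag: "integrable M (\<lambda>\<omega>. (lag k \<omega>)\<^sup>2)"
proof (induction k)
  case 0
  have "integrable M (\<lambda>\<omega>. (lag 0 \<omega>)\<^sup>2) \<longleftrightarrow> integrable M (\<lambda>\<omega>. (norm (y0 - g x0))\<^sup>2)"
    by (rule Bochner_Integration.integrable_cong) (auto simp: lag_def init)
  then show ?case
    by simp
next
  case (Suc k)
  have "integrable M (\<lambda>\<omega>. (1 + \<beta> k) * (tracking k \<omega>)\<^sup>2 + 2 * Cg\<^sup>2 * ((\<alpha> k)\<^sup>2 / \<beta> k) * (norm (dir k \<omega>))\<^sup>2)"
    using integrable_tracking[OF Suc] integrable_dir[of k] by auto
  then show ?case
    by (rule Bochner_Integration.integrable_bound) (use lag_Suc_le in \<open>auto intro!: AE_I2 order_trans[OF _ abs_ge_self]\<close>)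
qed

lemma summable_tracking: "summable (\<lambda>k. \<beta> k * expectation (\<lambda>\<omega>. (tracking k \<omega>)\<^sup>2))"
proof -
  define a where "a = (\<lambda>k. expectation (\<lambda>\<omega>. (lag k \<omega>)\<^sup>2))"
  \<comment> \<open>The sampling variance enters with the factor
    \<open>1 + \<beta> k \<le> 2\<close>; the other term is the drift of \<open>g\<close>, with the
    second moment of \<open>dir\<close> bounded by \<open>Cg * Cf\<close>.\<close>
  define \<mu> where "\<mu> = (\<lambda>k. 2 * Vg * (\<beta> k)\<^sup>2 + 2 * Cg\<^sup>2 * (Cg * Cf) * ((\<alpha> k)\<^sup>2 / \<beta> k))"
  have a: "0 \<le> a k" for k
    by (simp add: a_def)
  have track: "expectation (\<lambda>\<omega>. (tracking k \<omega>)\<^sup>2) \<le> (1 - \<beta> k)\<^sup>2 * a k + (\<beta> k)\<^sup>2 * Vg" for k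
    unfolding a_def using integrable_lag by (rule tracking_moment_le)
  have rec: "a (Suc k) \<le> (1 + 0) * a k - \<beta> k * a k + \<mu> k" for k
  proof -
    have b: "0 < \<beta> k" "\<beta> k \<le> 1"
      using steps(2)[of k] by auto
    have "a (Suc k) \<le> expectation (\<lambda>\<omega>. (1 + \<beta> k) * (tracking k \<omega>)\<^sup>2 +
        2 * Cg\<^sup>2 * ((\<alpha> k)\<^sup>2 / \<beta> k) * (norm (dir k \<omega>))\<^sup>2)"
      unfolding a_def using integrable_tracking[OF integrable_lag, of k] integrable_dir[of k] integrable_lag
      by (intro integral_mono lag_Suc_le) auto
    also have "\<dots> = (1 + \<beta> k) * expectation (\<lambda>\<omega>. (tracking k \<omega>)\<^sup>2) +
        2 * Cg\<^sup>2 * ((\<alpha> k)\<^sup>2 / \<beta> k) * expectation (\<lambda>\<omega>. (norm (dir k \<omega>))\<^sup>2)"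
      using integrable_tracking[OF integrable_lag, of k] integrable_dir[of k] by simp
    also have "\<dots> \<le> (1 + \<beta> k) * ((1 - \<beta> k)\<^sup>2 * a k + (\<beta> k)\<^sup>2 * Vg) +
        2 * Cg\<^sup>2 * ((\<alpha> k)\<^sup>2 / \<beta> k) * (Cg * Cf)"
      using b track dir_second_moment by (intro add_mono mult_left_mono) auto
    \<comment> \<open>One factor \<open>1 - \<beta> k\<close> of the contraction combines with
      \<open>1 + \<beta> k\<close> to at most 1, and the other one remains as decrease.\<close>
    also have "\<dots> = (1 - (\<beta> k)\<^sup>2) * ((1 - \<beta> k) * a k) + (1 + \<beta> k) * (Vg * (\<beta> k)\<^sup>2) +
        2 * Cg\<^sup>2 * (Cg * Cf) * ((\<alpha> k)\<^sup>2 / \<beta> k)"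
      by (simp add: algebra_simps power2_eq_square)
    also have "\<dots> \<le> 1 * ((1 - \<beta> k) * a k) + 2 * (Vg * (\<beta> k)\<^sup>2) +
        2 * Cg\<^sup>2 * (Cg * Cf) * ((\<alpha> k)\<^sup>2 / \<beta> k)"
      using b a constants_pos by (intro add_mono mult_right_mono) auto
    finally show ?thesis
      by (simp add: \<mu>_def algebra_simps)
  qed
  have "summable (\<lambda>k. \<beta> k * a k)"
  proof (rule almost_supermartingale_recursion(2)[where d=a and \<eta>="\<lambda>_. 0" and \<mu>=\<mu>, OF a _ _ _ rec])
    show "summable \<mu>"
      unfolding \<mu>_def by (intro summable_add summable_mult summable_steps)
    show "0 \<le> \<mu> k" "0 \<le> \<beta> k * a k" for k
      using steps(2)[of k] constants_pos a[of k] by (simp_all add: \<mu>_def)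
  qed auto
  \<comment> \<open>The recursion controls the lag before the update of \<open>y\<close>. The update
    contracts it and adds at most \<open>(\<beta> k)\<^sup>2 * Vg\<close>.\<close>
  then have "summable (\<lambda>k. \<beta> k * a k + Vg * (\<beta> k)\<^sup>2)"
    by (intro summable_add summable_mult summable_steps)
  then show ?thesis
  proof (rule summable_comparison_test'[where N=0])
    fix k
    have b: "0 < \<beta> k" "\<beta> k \<le> 1"
      using steps(2)[of k] by auto
    have "\<beta> k * expectation (\<lambda>\<omega>. (tracking k \<omega>)\<^sup>2) \<le> \<beta> k * ((1 - \<beta> k)\<^sup>2 * a k + (\<beta> k)\<^sup>2 * Vg)"
      using track b by (intro mult_left_mono) auto
    also have "\<dots> = (1 - \<beta> k)\<^sup>2 * (\<beta> k * a k) + \<beta> k * ((\<beta> k)\<^sup>2 * Vg)"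
      by (simp add: algebra_simps)
    also have "\<dots> \<le> 1 * (\<beta> k * a k) + 1 * ((\<beta> k)\<^sup>2 * Vg)"
      using b a constants_pos by (intro add_mono mult_right_mono) (auto simp: power_le_one)
    finally show "norm (\<beta> k * expectation (\<lambda>\<omega>. (tracking k \<omega>)\<^sup>2)) \<le> \<beta> k * a k + Vg * (\<beta> k)\<^sup>2"
      using b by (simp add: mult.commute)
  qed
qed

text \<open>Bounds \<open>\<alpha> k * norm (\<phi> (x k)) * norm (dir k - unbiased_dir k)\<close> by Young's inequality.\<close>

definition bias_bound :: "(real^'n \<Rightarrow> real^'n) \<Rightarrow> nat \<Rightarrow> 'a \<Rightarrow> real" where
  "bias_bound \<phi> k \<omega> = Lf\<^sup>2 * ((\<alpha> k)\<^sup>2 / \<beta> k) * ((Gnorm (w k \<omega>) (x k \<omega>))\<^sup>2 * (norm (\<phi> (x k \<omega>)))\<^sup>2) +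
     \<beta> k * (tracking k \<omega>)\<^sup>2"

lemma bias_bound_nonneg: "0 \<le> bias_bound \<phi> k \<omega>"
  unfolding bias_bound_def using steps(2)[of k] by simp

text \<open>The Lipschitz property of the sampled gradients is the only almost sure ingredient, so
  one null set serves every \<open>k\<close> and every field \<open>\<phi>\<close>.\<close>

lemma AE_bias_le:
  "AE \<omega> in M. \<forall>k. \<forall>\<phi>. \<alpha> k * (norm (\<phi> (x k \<omega>)) * norm (dir k \<omega> - unbiased_dir k \<omega>)) \<le> bias_bound \<phi> k \<omega>"
  using AE_gradient_lipschitz
proof eventually_elim
  case (elim \<omega>)
  show ?case
  proof (intro allI)
    fix k and \<phi> :: "real^'n \<Rightarrow> real^'n"
    let ?s = "tracking k \<omega>" and ?n = "Gnorm (w k \<omega>) (x k \<omega>)"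
    let ?t = "Lf * \<alpha> k * (?n * norm (\<phi> (x k \<omega>)))"
    have n: "0 \<le> ?n" "0 \<le> ?s"
      by (auto simp: Gnorm_nonneg tracking_def)
    have "norm (dir k \<omega> - unbiased_dir k \<omega>) \<le> ?n * (Lf * ?s)"
      using noisy_grad_diff_le[of "sample k \<omega>" "x k \<omega>"] elim
      unfolding dir_def unbiased_dir_def tracking_def by (simp add: sample_def)
    then have "\<alpha> k * (norm (\<phi> (x k \<omega>)) * norm (dir k \<omega> - unbiased_dir k \<omega>)) \<le>
        \<alpha> k * (norm (\<phi> (x k \<omega>)) * (?n * (Lf * ?s)))"
      using steps(1)[of k] by (intro mult_left_mono) auto
    also have "\<dots> = ?s * ?t"
      by simp
    also have "\<dots> \<le> 2 * ?s * ?t"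
      using n steps(1)[of k] constants_pos by simp
    also have "\<dots> \<le> \<beta> k * ?s\<^sup>2 + ?t\<^sup>2 / \<beta> k"
      using steps(2)[of k] by (intro young_inequality) auto
    also have "\<dots> = bias_bound \<phi> k \<omega>"
      by (simp add: bias_bound_def power_mult_distrib)
    finally show "\<alpha> k * (norm (\<phi> (x k \<omega>)) * norm (dir k \<omega> - unbiased_dir k \<omega>)) \<le> bias_bound \<phi> k \<omega>" .
  qed
qed

context
  fixes \<phi> :: "real^'n \<Rightarrow> real^'n"
  assumes \<phi>[measurable]: "\<phi> \<in> borel_measurable XB"
begin

lemma
  assumes int: "integrable M (\<lambda>\<omega>. (norm (\<phi> (x k \<omega>)))\<^sup>2)"
  shows integrable_bias_bound: "integrable M (bias_bound \<phi> k)"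
    and expectation_bias_bound_le: "expectation (bias_bound \<phi> k) \<le>
      Lf\<^sup>2 * ((\<alpha> k)\<^sup>2 / \<beta> k) * (Cg * expectation (\<lambda>\<omega>. (norm (\<phi> (x k \<omega>)))\<^sup>2)) +
      \<beta> k * expectation (\<lambda>\<omega>. (tracking k \<omega>)\<^sup>2)"
proof -
  note ints = integrable_weighted_Gnorm[OF \<phi> int] integrable_tracking[OF integrable_lag, of k]
  show "integrable M (bias_bound \<phi> k)"
    unfolding bias_bound_def[abs_def] using ints by auto
  have "expectation (bias_bound \<phi> k) =
      Lf\<^sup>2 * ((\<alpha> k)\<^sup>2 / \<beta> k) * expectation (\<lambda>\<omega>. (Gnorm (w k \<omega>) (x k \<omega>))\<^sup>2 * (norm (\<phi> (x k \<omega>)))\<^sup>2) +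
      \<beta> k * expectation (\<lambda>\<omega>. (tracking k \<omega>)\<^sup>2)"
    unfolding bias_bound_def[abs_def] using ints by simp
  also have "\<dots> \<le> Lf\<^sup>2 * ((\<alpha> k)\<^sup>2 / \<beta> k) * (Cg * expectation (\<lambda>\<omega>. (norm (\<phi> (x k \<omega>)))\<^sup>2)) +
      \<beta> k * expectation (\<lambda>\<omega>. (tracking k \<omega>)\<^sup>2)"
    using weighted_Gnorm_le[OF \<phi> int] steps(2)[of k] by (intro add_right_mono mult_left_mono) auto
  finally show "expectation (bias_bound \<phi> k) \<le> \<dots>" .
qed

text \<open>\<open>\<phi> (x k \<omega>)\<close> and \<open>Z\<close> are known before sample
  \<open>k\<close>; freezing them leaves an inner product with centred noise. \<open>Z = 1\<close>
  gives mean zero, and arbitrary \<open>Z\<close> gives the orthogonality that the martingale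
  theorem asks for.\<close>

lemma noise_orthogonal:
  assumes int: "integrable M (\<lambda>\<omega>. (norm (\<phi> (x k \<omega>)))\<^sup>2)"
    and Z: "Z \<in> borel_measurable (past k)" "integrable M (\<lambda>\<omega>. (Z \<omega>)\<^sup>2)"
  shows "integrable M (\<lambda>\<omega>. (\<phi> (x k \<omega>) \<bullet> noise k \<omega>)\<^sup>2)"
    and "expectation (\<lambda>\<omega>. (\<phi> (x k \<omega>) \<bullet> noise k \<omega>)\<^sup>2) \<le>
      4 * (Cg * Cf) * expectation (\<lambda>\<omega>. (norm (\<phi> (x k \<omega>)))\<^sup>2)"
    and "integrable M (\<lambda>\<omega>. \<phi> (x k \<omega>) \<bullet> noise k \<omega> * Z \<omega>)"
    and "expectation (\<lambda>\<omega>. \<phi> (x k \<omega>) \<bullet> noise k \<omega> * Z \<omega>) = 0"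
proof -
  have [measurable]: "Z \<in> borel_measurable M"
    using measurable_compose[OF past_sub Z(1)] .
  have le: "(\<phi> (x k \<omega>) \<bullet> noise k \<omega>)\<^sup>2 \<le> (norm (noise k \<omega>))\<^sup>2 * (norm (\<phi> (x k \<omega>)))\<^sup>2" for \<omega>
    using Cauchy_Schwarz_ineq[of "\<phi> (x k \<omega>)" "noise k \<omega>"]
    by (simp add: power2_norm_eq_inner mult.commute)
  show sq: "integrable M (\<lambda>\<omega>. (\<phi> (x k \<omega>) \<bullet> noise k \<omega>)\<^sup>2)"
    by (rule Bochner_Integration.integrable_bound[OF integrable_weighted_noise[OF \<phi> int]])
      (use le in auto)
  have "expectation (\<lambda>\<omega>. (\<phi> (x k \<omega>) \<bullet> noise k \<omega>)\<^sup>2) \<le>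
      expectation (\<lambda>\<omega>. (norm (noise k \<omega>))\<^sup>2 * (norm (\<phi> (x k \<omega>)))\<^sup>2)"
    using sq integrable_weighted_noise[OF \<phi> int] le by (rule integral_mono)
  also note weighted_noise_le[OF \<phi> int]
  finally show "expectation (\<lambda>\<omega>. (\<phi> (x k \<omega>) \<bullet> noise k \<omega>)\<^sup>2) \<le>
      4 * (Cg * Cf) * expectation (\<lambda>\<omega>. (norm (\<phi> (x k \<omega>)))\<^sup>2)" .
  show prod: "integrable M (\<lambda>\<omega>. \<phi> (x k \<omega>) \<bullet> noise k \<omega> * Z \<omega>)"
    using sq Z(2) by (intro integrable_mult_of_squares) auto
  let ?\<Phi> = "\<lambda>q. (\<phi> (fst (fst q)) \<bullet> (noisy_grad (snd q) (fst (fst q)) (g (fst (fst q))) -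
      mean_grad (fst (fst q)))) * snd (fst q)"
  have "expectation (\<lambda>\<omega>. ?\<Phi> ((x k \<omega>, Z \<omega>), sample k \<omega>)) = 0"
  proof (rule integral_freeze_eq_0[where N="XB \<Otimes>\<^sub>M borel"])
    show "(\<lambda>\<omega>. (x k \<omega>, Z \<omega>)) \<in> measurable (past k) (XB \<Otimes>\<^sub>M borel)"
      using x_past Z(1) by (rule measurable_Pair)
    show "integrable M (\<lambda>\<omega>. ?\<Phi> ((x k \<omega>, Z \<omega>), sample k \<omega>))"
      using prod by (simp add: noise_def unbiased_dir_def)
    fix q assume "q \<in> space (XB \<Otimes>\<^sub>M (borel :: real measure))"
    then obtain z t where q: "q = (z, t)" and z: "z \<in> X"
      by (auto simp: space_pair_measure space_restrict_space)
    interpret law: prob_space law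
      by (rule prob_space_law)
    have "integrable law (\<lambda>p. noisy_grad p z (g z) - mean_grad z)"
      using integrable_noisy_grad[OF z] by auto
    then have "(\<integral>p. \<phi> z \<bullet> (noisy_grad p z (g z) - mean_grad z) \<partial>law) = 0"
      using integral_noise_eq_0[OF z] by (subst integral_inner_right) auto
    then show "(\<integral>p. ?\<Phi> (q, p) \<partial>law) = 0"
      by (simp add: q)
  qed measurable
  then show "expectation (\<lambda>\<omega>. \<phi> (x k \<omega>) \<bullet> noise k \<omega> * Z \<omega>) = 0"
    by (simp add: noise_def unbiased_dir_def)
qed

text \<open>A uniform moment bound multiplies \<open>\<alpha>\<^sup>2/\<beta>\<close> in the bias
  and \<open>\<alpha>\<^sup>2\<close> in the variance of the noise. This serves the field of a
  Lyapunov function and, with constant \<open>\<phi>\<close>, the error vectors of the smooth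
  case.\<close>

lemma
  assumes int: "\<And>k. integrable M (\<lambda>\<omega>. (norm (\<phi> (x k \<omega>)))\<^sup>2)"
    and bound: "\<And>k. expectation (\<lambda>\<omega>. (norm (\<phi> (x k \<omega>)))\<^sup>2) \<le> B"
  shows AE_summable_bias_bound: "AE \<omega> in M. summable (\<lambda>k. bias_bound \<phi> k \<omega>)"
    and AE_summable_noise: "AE \<omega> in M. summable (\<lambda>k. \<alpha> k * (\<phi> (x k \<omega>) \<bullet> noise k \<omega>))"
proof -
  show "AE \<omega> in M. summable (\<lambda>k. bias_bound \<phi> k \<omega>)"
  proof (rule AE_summable_expectation)
    have "summable (\<lambda>k. Lf\<^sup>2 * Cg * B * ((\<alpha> k)\<^sup>2 / \<beta> k) + \<beta> k * expectation (\<lambda>\<omega>. (tracking k \<omega>)\<^sup>2))"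
      by (intro summable_add summable_mult summable_steps summable_tracking)
    then show "summable (\<lambda>k. expectation (bias_bound \<phi> k))"
    proof (rule summable_comparison_test'[where N=0])
      fix k
      have "expectation (bias_bound \<phi> k) \<le> Lf\<^sup>2 * ((\<alpha> k)\<^sup>2 / \<beta> k) * (Cg * B) +
          \<beta> k * expectation (\<lambda>\<omega>. (tracking k \<omega>)\<^sup>2)"
        using expectation_bias_bound_le[OF int, of k] bound[of k] steps(2)[of k] constants_pos
        by (elim order_trans, intro add_right_mono mult_left_mono) auto
      then show "norm (expectation (bias_bound \<phi> k)) \<le> Lf\<^sup>2 * Cg * B * ((\<alpha> k)\<^sup>2 / \<beta> k) +
          \<beta> k * expectation (\<lambda>\<omega>. (tracking k \<omega>)\<^sup>2)"
        by (simp add: bias_bound_nonneg Bochner_Integration.integral_nonneg mult_ac)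
    qed
  qed (auto simp: bias_bound_nonneg integrable_bias_bound[OF int])
  let ?D = "\<lambda>k \<omega>. \<alpha> k * (\<phi> (x k \<omega>) \<bullet> noise k \<omega>)"
  have Z1: "(\<lambda>_. 1 :: real) \<in> borel_measurable (past k)" "integrable M (\<lambda>\<omega>. (1 :: real)\<^sup>2)" for k
    by auto
  show "AE \<omega> in M. summable (\<lambda>k. ?D k \<omega>)"
  proof (rule L2_martingale_converges[where F=past])
    show "?D k \<in> borel_measurable (past (Suc k))" for k
    proof -
      note noise_past[measurable]
      have [measurable]: "x k \<in> measurable (past (Suc k)) XB"
        using measurable_compose[OF past_mono x_past] .
      show ?thesis
        by measurable
    qed
    show "integrable M (\<lambda>\<omega>. (?D k \<omega>)\<^sup>2)" for k
      using noise_orthogonal(1)[OF int Z1] by (simp add: power_mult_distrib)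
    show "expectation (\<lambda>\<omega>. ?D k \<omega> * Z \<omega>) = 0"
      if "Z \<in> borel_measurable (past k)" "integrable M (\<lambda>\<omega>. (Z \<omega>)\<^sup>2)" for k Z
      using noise_orthogonal(4)[OF int that] by (simp add: mult.assoc)
    have "summable (\<lambda>k. (4 * (Cg * Cf) * B) * (\<alpha> k)\<^sup>2)"
      by (intro summable_mult summable_steps)
    then show "summable (\<lambda>k. expectation (\<lambda>\<omega>. (?D k \<omega>)\<^sup>2))"
    proof (rule summable_comparison_test'[where N=0])
      fix k
      have "expectation (\<lambda>\<omega>. (\<phi> (x k \<omega>) \<bullet> noise k \<omega>)\<^sup>2) \<le> 4 * (Cg * Cf) * B"
        using noise_orthogonal(2)[OF int Z1, of k] bound[of k] constants_pos
        by (elim order_trans, intro mult_left_mono) auto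
      then have "(\<alpha> k)\<^sup>2 * expectation (\<lambda>\<omega>. (\<phi> (x k \<omega>) \<bullet> noise k \<omega>)\<^sup>2) \<le> (\<alpha> k)\<^sup>2 * (4 * (Cg * Cf) * B)"
        by (rule mult_left_mono) simp
      then show "norm (expectation (\<lambda>\<omega>. (?D k \<omega>)\<^sup>2)) \<le> (4 * (Cg * Cf) * B) * (\<alpha> k)\<^sup>2"
        using noise_orthogonal(1)[OF int Z1, of k] by (simp add: power_mult_distrib mult.commute)
    qed
  qed (rule past_sub past_mono)+
qed

end

subsection \<open>Lyapunov functions and convergence\<close>

text \<open>Both regimes are instances: the squared distance to \<open>z\<close> with
  \<open>\<phi> u = 2 *\<^sub>R (u - z)\<close>, and the optimality gap with
  \<open>\<phi> = grad (f \<circ> g)\<close>. The bias scales with the square of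
  \<open>\<phi>\<close>; \<open>growth\<close> bounds this by \<open>1 + \<Psi>\<close>, so that the
  recursion for the mean of \<open>\<Psi>\<close> closes.\<close>

lemma lyapunov:
  fixes \<Psi> :: "real^'n \<Rightarrow> real" and \<phi> :: "real^'n \<Rightarrow> real^'n"
  assumes \<Psi>[measurable]: "\<Psi> \<in> borel_measurable XB" and \<phi>[measurable]: "\<phi> \<in> borel_measurable XB"
    and nonneg: "\<And>z. z \<in> X \<Longrightarrow> 0 \<le> \<Psi> z"
    and growth: "\<And>z. z \<in> X \<Longrightarrow> (norm (\<phi> z))\<^sup>2 \<le> B * (1 + \<Psi> z)" and B: "0 \<le> B"
    and descent: "\<And>z. z \<in> X \<Longrightarrow> 0 \<le> \<phi> z \<bullet> mean_grad z" and K: "0 \<le> K"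
    and step: "\<And>k \<omega>. \<omega> \<in> space M \<Longrightarrow> \<Psi> (x (Suc k) \<omega>) \<le>
      \<Psi> (x k \<omega>) - \<alpha> k * (\<phi> (x k \<omega>) \<bullet> dir k \<omega>) + K * (\<alpha> k)\<^sup>2 * (norm (dir k \<omega>))\<^sup>2"
  shows "AE \<omega> in M. convergent (\<lambda>k. \<Psi> (x k \<omega>))"
    and "AE \<omega> in M. summable (\<lambda>k. \<alpha> k * (\<phi> (x k \<omega>) \<bullet> mean_grad (x k \<omega>)))"
proof -
  \<comment> \<open>Kept conditional on integrability at time \<open>k\<close>, because it is used
    inside the induction that establishes it.\<close>
  have int_\<phi>': "integrable M (\<lambda>\<omega>. (norm (\<phi> (x k \<omega>)))\<^sup>2) \<and>
      expectation (\<lambda>\<omega>. (norm (\<phi> (x k \<omega>)))\<^sup>2) \<le> B * (1 + expectation (\<lambda>\<omega>. \<Psi> (x k \<omega>)))"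
    if int: "integrable M (\<lambda>\<omega>. \<Psi> (x k \<omega>))" for k
  proof
    have int': "integrable M (\<lambda>\<omega>. B * (1 + \<Psi> (x k \<omega>)))"
      using int by auto
    then show \<phi>2: "integrable M (\<lambda>\<omega>. (norm (\<phi> (x k \<omega>)))\<^sup>2)"
      by (rule Bochner_Integration.integrable_bound)
        (use growth x_in_X in \<open>auto intro!: AE_I2 order_trans[OF _ abs_ge_self]\<close>)
    have "expectation (\<lambda>\<omega>. (norm (\<phi> (x k \<omega>)))\<^sup>2) \<le> expectation (\<lambda>\<omega>. B * (1 + \<Psi> (x k \<omega>)))"
      using \<phi>2 int' by (rule integral_mono) (use growth x_in_X in auto)
    also have "\<dots> = B * (1 + expectation (\<lambda>\<omega>. \<Psi> (x k \<omega>)))"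
      using int by (simp add: prob_space)
    finally show "expectation (\<lambda>\<omega>. (norm (\<phi> (x k \<omega>)))\<^sup>2) \<le> \<dots>" .
  qed
  have int_\<Psi>: "integrable M (\<lambda>\<omega>. \<Psi> (x k \<omega>))" for k
  proof (induction k)
    case 0
    have "integrable M (\<lambda>\<omega>. \<Psi> (x 0 \<omega>)) \<longleftrightarrow> integrable M (\<lambda>\<omega>. \<Psi> x0)"
      by (rule Bochner_Integration.integrable_cong) (auto simp: init)
    then show ?case
      by simp
  next
    case (Suc k)
    have prod: "integrable M (\<lambda>\<omega>. norm (\<phi> (x k \<omega>)) * norm (dir k \<omega>))"
      using int_\<phi>'[OF Suc] integrable_dir by (intro integrable_mult_of_squares) auto
    have inner: "integrable M (\<lambda>\<omega>. \<phi> (x k \<omega>) \<bullet> dir k \<omega>)"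
      by (rule Bochner_Integration.integrable_bound[OF prod])
        (use Cauchy_Schwarz_ineq2 in \<open>auto intro!: AE_I2\<close>)
    have "integrable M (\<lambda>\<omega>. \<Psi> (x k \<omega>) - \<alpha> k * (\<phi> (x k \<omega>) \<bullet> dir k \<omega>) +
        K * (\<alpha> k)\<^sup>2 * (norm (dir k \<omega>))\<^sup>2)"
      using Suc inner integrable_dir[of k]
      by (intro Bochner_Integration.integrable_add Bochner_Integration.integrable_diff integrable_mult_right) auto
    then show ?case
    proof (rule Bochner_Integration.integrable_bound)
      show "AE \<omega> in M. norm (\<Psi> (x (Suc k) \<omega>)) \<le> norm (\<Psi> (x k \<omega>) - \<alpha> k * (\<phi> (x k \<omega>) \<bullet> dir k \<omega>) +
        K * (\<alpha> k)\<^sup>2 * (norm (dir k \<omega>))\<^sup>2)"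
      proof (rule AE_I2)
        fix \<omega> assume \<omega>: "\<omega> \<in> space M"
        show "norm (\<Psi> (x (Suc k) \<omega>)) \<le> norm (\<Psi> (x k \<omega>) - \<alpha> k * (\<phi> (x k \<omega>) \<bullet> dir k \<omega>) +
            K * (\<alpha> k)\<^sup>2 * (norm (dir k \<omega>))\<^sup>2)"
          using step[OF \<omega>, of k] nonneg[OF x_in_X[OF \<omega>], of "Suc k"] by simp
      qed
    qed measurable
  qed
  note int_\<phi> = int_\<phi>'[OF int_\<Psi>, THEN conjunct1] and moment_\<phi> = int_\<phi>'[OF int_\<Psi>, THEN conjunct2]
  define d where "d = (\<lambda>k. expectation (\<lambda>\<omega>. \<Psi> (x k \<omega>)))"
  define \<rho> where "\<rho> = (\<lambda>k \<omega>. bias_bound \<phi> k \<omega> + K * (\<alpha> k)\<^sup>2 * (norm (dir k \<omega>))\<^sup>2)"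
  define s where "s = (\<lambda>k \<omega>. \<phi> (x k \<omega>) \<bullet> mean_grad (x k \<omega>))"
  define q where "q = (\<lambda>k. expectation (s k))"
  have d: "0 \<le> d k" for k
    unfolding d_def using nonneg x_in_X by (intro Bochner_Integration.integral_nonneg_AE AE_I2) auto
  have [measurable]: "s k \<in> borel_measurable M" for k
    unfolding s_def by measurable
  have s_nonneg: "\<omega> \<in> space M \<Longrightarrow> 0 \<le> s k \<omega>" for k \<omega>
    unfolding s_def using descent x_in_X by auto
  have mean_sq: "integrable M (\<lambda>\<omega>. (norm (mean_grad (x k \<omega>)))\<^sup>2)" for k
    by (rule integrable_const_bound[where B="Cg * Cf"]) (use norm_mean_grad_le x_in_X in auto)
  have int_s: "integrable M (s k)" for k
  proof (rule Bochner_Integration.integrable_bound)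
    show "integrable M (\<lambda>\<omega>. norm (\<phi> (x k \<omega>)) * norm (mean_grad (x k \<omega>)))"
      using int_\<phi> mean_sq by (intro integrable_mult_of_squares) auto
    show "AE \<omega> in M. norm (s k \<omega>) \<le> norm (norm (\<phi> (x k \<omega>)) * norm (mean_grad (x k \<omega>)))"
      unfolding s_def using Cauchy_Schwarz_ineq2 by auto
  qed measurable
  have int_\<rho>: "integrable M (\<rho> k)" for k
    unfolding \<rho>_def using integrable_bias_bound[OF \<phi> int_\<phi>] integrable_dir by auto
  have Z1: "(\<lambda>_. 1 :: real) \<in> borel_measurable (past k)" "integrable M (\<lambda>\<omega>. (1 :: real)\<^sup>2)" for k
    by auto
  have noise: "integrable M (\<lambda>\<omega>. \<phi> (x k \<omega>) \<bullet> noise k \<omega>)" "expectation (\<lambda>\<omega>. \<phi> (x k \<omega>) \<bullet> noise k \<omega>) = 0" for k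
    using noise_orthogonal(3,4)[OF \<phi> int_\<phi> Z1, of k] by simp_all
  have AE_step: "AE \<omega> in M. \<forall>k. \<Psi> (x (Suc k) \<omega>) \<le>
      \<Psi> (x k \<omega>) - \<alpha> k * s k \<omega> - \<alpha> k * (\<phi> (x k \<omega>) \<bullet> noise k \<omega>) + \<rho> k \<omega>"
    using AE_bias_le AE_space
  proof eventually_elim
    case (elim \<omega>)
    show ?case
    proof
      fix k
      have "dir k \<omega> = mean_grad (x k \<omega>) + noise k \<omega> + (dir k \<omega> - unbiased_dir k \<omega>)"
        by (simp add: noise_def)
      then have "\<phi> (x k \<omega>) \<bullet> dir k \<omega> = s k \<omega> + \<phi> (x k \<omega>) \<bullet> noise k \<omega> +
          \<phi> (x k \<omega>) \<bullet> (dir k \<omega> - unbiased_dir k \<omega>)"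
        unfolding s_def by (metis inner_add_right)
      moreover have "- (\<phi> (x k \<omega>) \<bullet> (dir k \<omega> - unbiased_dir k \<omega>)) \<le>
          norm (\<phi> (x k \<omega>)) * norm (dir k \<omega> - unbiased_dir k \<omega>)"
        using Cauchy_Schwarz_ineq2[of "\<phi> (x k \<omega>)" "dir k \<omega> - unbiased_dir k \<omega>"] by linarith
      then have "\<alpha> k * - (\<phi> (x k \<omega>) \<bullet> (dir k \<omega> - unbiased_dir k \<omega>)) \<le>
          \<alpha> k * (norm (\<phi> (x k \<omega>)) * norm (dir k \<omega> - unbiased_dir k \<omega>))"
        using steps(1)[of k] by (intro mult_left_mono) auto
      then have "- (\<alpha> k * (\<phi> (x k \<omega>) \<bullet> (dir k \<omega> - unbiased_dir k \<omega>))) \<le> bias_bound \<phi> k \<omega>"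
        using elim(1) by (smt (verit) mult_minus_right)
      ultimately show "\<Psi> (x (Suc k) \<omega>) \<le>
          \<Psi> (x k \<omega>) - \<alpha> k * s k \<omega> - \<alpha> k * (\<phi> (x k \<omega>) \<bullet> noise k \<omega>) + \<rho> k \<omega>"
        using step[OF elim(2), of k] unfolding \<rho>_def by (simp add: distrib_left)
    qed
  qed
  \<comment> \<open>\<open>growth\<close> turns the bias into a multiple of \<open>1 + d k\<close>.
    The part with \<open>d k\<close> becomes the growth rate \<open>\<eta>\<close>, the constant
    part goes into \<open>\<mu>\<close>.\<close>
  define \<eta> where "\<eta> = (\<lambda>k. Lf\<^sup>2 * Cg * B * ((\<alpha> k)\<^sup>2 / \<beta> k))"
  define \<mu> where "\<mu> = (\<lambda>k. \<eta> k + \<beta> k * expectation (\<lambda>\<omega>. (tracking k \<omega>)\<^sup>2) + K * (Cg * Cf) * (\<alpha> k)\<^sup>2)"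
  have \<eta>: "0 \<le> \<eta> k" for k
    unfolding \<eta>_def using B constants_pos steps(2)[of k] by simp
  have \<mu>: "0 \<le> \<mu> k" for k
    unfolding \<mu>_def using \<eta>[of k] K constants_pos steps(2)[of k] by simp
  have sum_\<eta>: "summable \<eta>"
    unfolding \<eta>_def by (intro summable_mult summable_steps)
  have sum_\<mu>: "summable \<mu>"
    unfolding \<mu>_def by (intro summable_add summable_mult summable_steps sum_\<eta> summable_tracking)
  have E\<rho>: "expectation (\<rho> k) \<le> \<eta> k * d k + \<mu> k" for k
  proof -
    have "expectation (\<rho> k) = expectation (bias_bound \<phi> k) +
        K * (\<alpha> k)\<^sup>2 * expectation (\<lambda>\<omega>. (norm (dir k \<omega>))\<^sup>2)"
      unfolding \<rho>_def using integrable_bias_bound[OF \<phi> int_\<phi>, of k] integrable_dir[of k] by simp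
    also have "\<dots> \<le> (Lf\<^sup>2 * ((\<alpha> k)\<^sup>2 / \<beta> k) * (Cg * (B * (1 + d k))) +
        \<beta> k * expectation (\<lambda>\<omega>. (tracking k \<omega>)\<^sup>2)) + K * (\<alpha> k)\<^sup>2 * (Cg * Cf)"
    proof (rule add_mono)
      show "expectation (bias_bound \<phi> k) \<le> Lf\<^sup>2 * ((\<alpha> k)\<^sup>2 / \<beta> k) * (Cg * (B * (1 + d k))) +
          \<beta> k * expectation (\<lambda>\<omega>. (tracking k \<omega>)\<^sup>2)"
        unfolding d_def using moment_\<phi>[of k] constants_pos steps(2)[of k]
        by (intro order_trans[OF expectation_bias_bound_le[OF \<phi> int_\<phi>]] add_right_mono mult_left_mono) auto
      show "K * (\<alpha> k)\<^sup>2 * expectation (\<lambda>\<omega>. (norm (dir k \<omega>))\<^sup>2) \<le> K * (\<alpha> k)\<^sup>2 * (Cg * Cf)"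
        using K dir_second_moment by (intro mult_left_mono) auto
    qed
    also have "\<dots> = \<eta> k * d k + \<mu> k"
      by (simp add: \<eta>_def \<mu>_def algebra_simps add_divide_distrib)
    finally show ?thesis .
  qed
  have rec: "d (Suc k) \<le> (1 + \<eta> k) * d k - \<alpha> k * q k + \<mu> k" for k
  proof -
    have "d (Suc k) \<le> expectation (\<lambda>\<omega>. \<Psi> (x k \<omega>) - \<alpha> k * s k \<omega> -
        \<alpha> k * (\<phi> (x k \<omega>) \<bullet> noise k \<omega>) + \<rho> k \<omega>)"
      unfolding d_def using AE_step int_\<Psi> int_s int_\<rho> noise(1)
      by (intro integral_mono_AE Bochner_Integration.integrable_add Bochner_Integration.integrable_diff integrable_mult_right) auto
    also have "\<dots> = d k - \<alpha> k * q k + expectation (\<rho> k)"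
      using int_\<Psi>[of k] int_s[of k] int_\<rho>[of k] noise[of k] by (simp add: d_def q_def)
    finally show ?thesis
      using E\<rho>[of k] by (simp add: algebra_simps)
  qed
  have q: "0 \<le> \<alpha> k * q k" for k
    unfolding q_def using steps(1)[of k] s_nonneg
    by (intro mult_nonneg_nonneg Bochner_Integration.integral_nonneg_AE AE_I2) auto
  note recursion = almost_supermartingale_recursion[of d "\<lambda>k. \<alpha> k * q k" \<eta> \<mu>, OF d q \<eta> \<mu> rec sum_\<eta> sum_\<mu>]
  obtain D where D: "\<And>k. d k \<le> D"
    using recursion(1) by blast
  \<comment> \<open>Only now is the moment of \<open>\<phi>\<close> bounded uniformly in
    \<open>k\<close>, as the almost sure summability of bias and noise requires.\<close>
  have moment: "expectation (\<lambda>\<omega>. (norm (\<phi> (x k \<omega>)))\<^sup>2) \<le> B * (1 + D)" for k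
    using moment_\<phi>[of k] D[of k] B unfolding d_def
    by (elim order_trans, intro mult_left_mono) auto
  \<comment> \<open>Absolute values, because \<open>s\<close> is known to be nonnegative only on
    \<open>space M\<close>.\<close>
  have "AE \<omega> in M. summable (\<lambda>k. \<bar>\<alpha> k * s k \<omega>\<bar>)"
  proof (rule AE_summable_expectation)
    have "expectation (\<lambda>\<omega>. \<bar>\<alpha> k * s k \<omega>\<bar>) = expectation (\<lambda>\<omega>. \<alpha> k * s k \<omega>)" for k
      using steps(1)[of k] s_nonneg by (intro Bochner_Integration.integral_cong) auto
    then show "summable (\<lambda>k. expectation (\<lambda>\<omega>. \<bar>\<alpha> k * s k \<omega>\<bar>))"
      using recursion(2) by (simp add: q_def)
  qed (use int_s in auto)
  then show "AE \<omega> in M. summable (\<lambda>k. \<alpha> k * (\<phi> (x k \<omega>) \<bullet> mean_grad (x k \<omega>)))"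
    unfolding s_def by eventually_elim (rule summable_rabs_cancel)
  have "AE \<omega> in M. summable (\<lambda>k. K * (\<alpha> k)\<^sup>2 * (norm (dir k \<omega>))\<^sup>2)"
  proof (rule AE_summable_expectation)
    have "summable (\<lambda>k. K * (Cg * Cf) * (\<alpha> k)\<^sup>2)"
      by (intro summable_mult summable_steps)
    then show "summable (\<lambda>k. expectation (\<lambda>\<omega>. K * (\<alpha> k)\<^sup>2 * (norm (dir k \<omega>))\<^sup>2))"
    proof (rule summable_comparison_test'[where N=0])
      fix k
      have "K * (\<alpha> k)\<^sup>2 * expectation (\<lambda>\<omega>. (norm (dir k \<omega>))\<^sup>2) \<le> K * (\<alpha> k)\<^sup>2 * (Cg * Cf)"
        using K dir_second_moment by (intro mult_left_mono) auto
      then show "norm (expectation (\<lambda>\<omega>. K * (\<alpha> k)\<^sup>2 * (norm (dir k \<omega>))\<^sup>2)) \<le> K * (Cg * Cf) * (\<alpha> k)\<^sup>2"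
        using K by (simp add: mult_ac)
    qed
  qed (use K integrable_dir in auto)
  with AE_summable_bias_bound[OF \<phi> int_\<phi> moment] AE_summable_noise[OF \<phi> int_\<phi> moment] AE_step AE_space
  show "AE \<omega> in M. convergent (\<lambda>k. \<Psi> (x k \<omega>))"
  proof eventually_elim
    case (elim \<omega>)
    show ?case
    proof (rule convergent_almost_decreasing)
      show "0 \<le> \<Psi> (x k \<omega>)" for k
        using nonneg x_in_X elim(4) by blast
      \<comment> \<open>The nonnegative descent term is dropped. What remains in
        \<open>\<rho>\<close> is nonnegative and summable, while the noise series is only known to
        converge.\<close>
      show "\<Psi> (x (Suc k) \<omega>) \<le> \<Psi> (x k \<omega>) + (\<rho> k \<omega> - \<alpha> k * (\<phi> (x k \<omega>) \<bullet> noise k \<omega>))" for k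
      proof -
        have "0 \<le> \<alpha> k * s k \<omega>"
          using steps(1)[of k] s_nonneg[OF elim(4)] by simp
        then show ?thesis
          using elim(3) by (smt (verit))
      qed
      show "summable (\<lambda>k. \<rho> k \<omega> - \<alpha> k * (\<phi> (x k \<omega>) \<bullet> noise k \<omega>))"
        unfolding \<rho>_def using elim by (intro summable_diff summable_add)
    qed
  qed
qed

lemma objective_continuous: "continuous_on UNIV (f \<circ> g)"
proof -
  have "continuous_on UNIV f"
    using f_C1(1) by (intro continuous_at_imp_continuous_on ballI differentiable_imp_continuous_within)
  then show ?thesis
    by (intro continuous_on_compose g_continuous) (rule continuous_on_subset[OF _ subset_UNIV])
qed

section \<open>The convex constrained case\<close>

theorem convex_convergence:
  assumes conv: "convex_on UNIV (f \<circ> g)"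
  shows "AE \<omega> in M. \<exists>l. is_arg_min (f \<circ> g) (\<lambda>u. u \<in> X) l \<and> (\<lambda>k. x k \<omega>) \<longlonglongrightarrow> l"
proof -
  let ?F = "f \<circ> g"
  obtain z0 where z0: "is_arg_min ?F (\<lambda>u. u \<in> X) z0"
    using optimal_exists by blast
  then have z0X: "z0 \<in> X" and z0_min: "\<And>z. z \<in> X \<Longrightarrow> ?F z0 \<le> ?F z"
    by (auto simp: is_arg_min_linorder)
  define S where "S = {z \<in> X. ?F z \<le> ?F z0}"
  have S_arg_min: "is_arg_min ?F (\<lambda>u. u \<in> X) z" if "z \<in> S" for z
    using that z0_min unfolding S_def is_arg_min_linorder by (auto intro: order_trans)
  \<comment> \<open>Each solution brings its own null set, so the distances are controlled
    simultaneously only for a countable dense set of solutions.\<close>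
  obtain D where D: "countable D" "D \<subseteq> S" "S \<subseteq> closure D"
    using separable by blast
  have *: "(AE \<omega> in M. convergent (\<lambda>k. (norm (x k \<omega> - z))\<^sup>2)) \<and>
      (AE \<omega> in M. summable (\<lambda>k. \<alpha> k * ((2 *\<^sub>R (x k \<omega> - z)) \<bullet> mean_grad (x k \<omega>))))"
    if z: "z \<in> S" for z
  proof -
    have descent: "0 \<le> (2 *\<^sub>R (u - z)) \<bullet> mean_grad u" if u: "u \<in> X" for u
    proof -
      have "?F z \<ge> ?F u + mean_grad u \<bullet> (z - u)"
        using conv u by (rule mean_grad_subgradient)
      moreover have "?F z \<le> ?F u"
        using z z0_min[OF u] by (auto simp: S_def)
      ultimately show ?thesis
        by (simp add: inner_commute[of "mean_grad u"] inner_diff_left)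
    qed
    have step: "(norm (x (Suc k) \<omega> - z))\<^sup>2 \<le> (norm (x k \<omega> - z))\<^sup>2 -
        \<alpha> k * ((2 *\<^sub>R (x k \<omega> - z)) \<bullet> dir k \<omega>) + 1 * (\<alpha> k)\<^sup>2 * (norm (dir k \<omega>))\<^sup>2"
      if \<omega>: "\<omega> \<in> space M" for k \<omega>
    proof -
      have "(norm (x (Suc k) \<omega> - z))\<^sup>2 \<le> (norm ((x k \<omega> - z) - \<alpha> k *\<^sub>R dir k \<omega>))\<^sup>2"
        using dist_x_Suc_le[OF \<omega>, of z k] z by (intro power_mono) (auto simp: S_def algebra_simps)
      also have "\<dots> = (norm (x k \<omega> - z))\<^sup>2 - \<alpha> k * ((2 *\<^sub>R (x k \<omega> - z)) \<bullet> dir k \<omega>) +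
          1 * (\<alpha> k)\<^sup>2 * (norm (dir k \<omega>))\<^sup>2"
        unfolding power2_norm_eq_inner inner_diff_left inner_diff_right inner_scaleR_left inner_scaleR_right
        by (simp add: inner_commute power2_eq_square algebra_simps)
      finally show ?thesis .
    qed
    \<comment> \<open>\<open>B = 4\<close> is the square of the factor 2 in the gradient of the
      squared distance; \<open>K = 1\<close> is the coefficient of the squared step in its
      expansion.\<close>
    note lyapunov[where B=4 and K=1 and \<Psi>="\<lambda>u. (norm (u - z))\<^sup>2" and \<phi>="\<lambda>u. 2 *\<^sub>R (u - z)",
        OF _ _ _ _ _ descent _ step]
    then show ?thesis
      by (intro conjI) (auto simp: power_mult_distrib)
  qed
  have "AE \<omega> in M. \<forall>z\<in>D. convergent (\<lambda>k. (norm (x k \<omega> - z))\<^sup>2)"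
    using D * by (subst AE_ball_countable) auto
  \<comment> \<open>A single solution suffices here: by the subgradient inequality the inner product
    is at least twice the optimality gap at \<open>x k \<omega>\<close>.\<close>
  moreover have "AE \<omega> in M. summable (\<lambda>k. \<alpha> k * ((2 *\<^sub>R (x k \<omega> - z0)) \<bullet> mean_grad (x k \<omega>)))"
    using *[of z0] z0X by (simp add: S_def)
  ultimately show ?thesis
    using AE_space
  proof eventually_elim
    case (elim \<omega>)
    have "\<exists>l\<in>S. (\<lambda>k. x k \<omega>) \<longlonglongrightarrow> l"
    proof (rule fejer_convergence[OF S_def _ X_props(2) x_in_X[OF elim(3)] objective_continuous D(2,3)])
      show "S \<noteq> {}"
        using z0X by (auto simp: S_def)
      show "convergent (\<lambda>k. (norm (x k \<omega> - z))\<^sup>2)" if "z \<in> D" for z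
        using elim(1) that by blast
      fix \<epsilon> :: real and N assume "0 < \<epsilon>"
      then obtain k where k: "k \<ge> N" "(2 *\<^sub>R (x k \<omega> - z0)) \<bullet> mean_grad (x k \<omega>) < 2 * \<epsilon>"
        using small_infinitely_often[OF sum_alpha _ elim(2), of "2 * \<epsilon>" N] steps(1) by auto
      moreover have "?F z0 \<ge> ?F (x k \<omega>) + mean_grad (x k \<omega>) \<bullet> (z0 - x k \<omega>)"
        using conv x_in_X[OF elim(3)] by (rule mean_grad_subgradient)
      ultimately show "\<exists>k\<ge>N. ?F (x k \<omega>) < ?F z0 + \<epsilon>"
        by (intro exI[of _ k]) (simp add: inner_commute[of "mean_grad (x k \<omega>)"] inner_diff_left)
    qed
    then show ?case
      using S_arg_min by blast
  qed
qed

section \<open>The smooth unconstrained case\<close>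

theorem gradient_tendsto_0:
  assumes diff: "\<And>z. (f \<circ> g) differentiable (at z)" and lip: "L-lipschitz_on UNIV (grad (f \<circ> g))"
    and UNIV: "X = UNIV"
  shows "AE \<omega> in M. (\<lambda>k. grad (f \<circ> g) (x k \<omega>)) \<longlonglongrightarrow> 0"
proof -
  let ?F = "f \<circ> g"
  have mean: "mean_grad z = grad ?F z" for z
    using diff by (rule mean_grad_eq_grad) (simp add: UNIV)
  obtain z0 where z0: "\<And>z. ?F z0 \<le> ?F z"
    using optimal_exists by (auto simp: is_arg_min_linorder UNIV)
  have step: "x (Suc k) \<omega> = x k \<omega> - \<alpha> k *\<^sub>R dir k \<omega>" if "\<omega> \<in> space M" for k \<omega>
    using x_Suc[OF that, of k] by (simp add: UNIV closest_point_self)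
  have "mean_grad = grad ?F"
    using mean by (rule ext)
  with mean_grad_measurable have [measurable]: "grad ?F \<in> borel_measurable XB"
    by simp
  have [measurable]: "?F \<in> borel_measurable XB"
    using objective_continuous by (intro measurable_restrict_space1 borel_measurable_continuous_onI)
  have "AE \<omega> in M. summable (\<lambda>k. \<alpha> k * (grad ?F (x k \<omega>) \<bullet> mean_grad (x k \<omega>)))"
  \<comment> \<open>The gradient is bounded, with square at most \<open>Cg * Cf\<close>, so
    \<open>growth\<close> holds with this \<open>B\<close>; \<open>K = L\<close> is the constant of
    the descent inequality.\<close>
  proof (rule lyapunov(2)[where \<Psi>="\<lambda>z. ?F z - ?F z0" and B="Cg * Cf" and K=L])
    fix z
    have "(norm (grad ?F z))\<^sup>2 \<le> Cg * Cf * 1"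
      using norm_mean_grad_le[of z] by (simp add: mean UNIV)
    also have "\<dots> \<le> Cg * Cf * (1 + (?F z - ?F z0))"
      using z0[of z] constants_pos by (intro mult_left_mono) auto
    finally show "(norm (grad ?F z))\<^sup>2 \<le> Cg * Cf * (1 + (?F z - ?F z0))" .
  next
    fix k \<omega> assume "\<omega> \<in> space M"
    then show "?F (x (Suc k) \<omega>) - ?F z0 \<le> ?F (x k \<omega>) - ?F z0 - \<alpha> k * (grad ?F (x k \<omega>) \<bullet> dir k \<omega>) +
        L * (\<alpha> k)\<^sup>2 * (norm (dir k \<omega>))\<^sup>2"
      using lipschitz_gradient_descent[OF diff lip, of "x k \<omega>" "- \<alpha> k *\<^sub>R dir k \<omega>"]
      by (simp add: step power_mult_distrib)
  next
    show "(\<lambda>z. ?F z - ?F z0) \<in> borel_measurable XB" "grad ?F \<in> borel_measurable XB"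
      by measurable
    show "0 \<le> grad ?F z \<bullet> mean_grad z" for z
      unfolding mean by (rule inner_ge_zero)
  qed (use z0 constants_pos lipschitz_on_nonneg[OF lip] in auto)
  then have sum_grad: "AE \<omega> in M. summable (\<lambda>k. \<alpha> k * (norm (grad ?F (x k \<omega>)))\<^sup>2)"
    by (simp add: mean power2_norm_eq_inner)
  have const: "(\<lambda>_. b) \<in> borel_measurable XB" "integrable M (\<lambda>\<omega>. (norm b)\<^sup>2)"
    "expectation (\<lambda>\<omega>. (norm b)\<^sup>2) \<le> (norm b)\<^sup>2" for b :: "real^'n"
    by (auto simp: prob_space)
  \<comment> \<open>Constant fields \<open>b\<close> give the coordinates of the noise series, whose
    convergence as a vector series is needed below.\<close>
  have noise: "AE \<omega> in M. \<forall>b\<in>Basis. summable (\<lambda>k. \<alpha> k * (b \<bullet> noise k \<omega>))"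
    using AE_summable_noise[OF const] by (subst AE_ball_countable) (auto intro: countable_finite)
  \<comment> \<open>Any unit vector will do: as a constant field it makes \<open>bias_bound\<close>
    dominate \<open>\<alpha> k\<close> times the norm of the bias itself.\<close>
  obtain b :: "real^'n" where b: "b \<in> Basis"
    using nonempty_Basis by blast
  show ?thesis
    using sum_grad noise AE_summable_bias_bound[OF const, of b] AE_bias_le AE_space
  proof eventually_elim
    case (elim \<omega>)
    define r where "r = (\<lambda>k. - (\<alpha> k *\<^sub>R noise k \<omega>) - \<alpha> k *\<^sub>R (dir k \<omega> - unbiased_dir k \<omega>))"
    have "summable (\<lambda>k. \<Sum>b\<in>Basis. (\<alpha> k * (b \<bullet> noise k \<omega>)) *\<^sub>R b)"
      using elim(2) by (intro summable_sum summable_scaleR_left) auto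
    moreover have "(\<Sum>b\<in>Basis. (\<alpha> k * (b \<bullet> noise k \<omega>)) *\<^sub>R b) = \<alpha> k *\<^sub>R noise k \<omega>" for k
      using euclidean_representation[of "\<alpha> k *\<^sub>R noise k \<omega>"] by (simp add: inner_commute)
    ultimately have 1: "summable (\<lambda>k. \<alpha> k *\<^sub>R noise k \<omega>)"
      by simp
    have 2: "summable (\<lambda>k. \<alpha> k *\<^sub>R (dir k \<omega> - unbiased_dir k \<omega>))"
    proof (rule summable_comparison_test'[OF elim(3), of 0])
      fix k
      show "norm (\<alpha> k *\<^sub>R (dir k \<omega> - unbiased_dir k \<omega>)) \<le> bias_bound (\<lambda>_. b) k \<omega>"
        using elim(4)[rule_format, of k "\<lambda>_. b"] steps(1)[of k] b by simp
    qed
    show "(\<lambda>k. grad ?F (x k \<omega>)) \<longlonglongrightarrow> 0"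
    proof (rule perturbed_flow_field_tendsto_0[OF sum_alpha _ _ lip elim(1)])
      show "x (Suc k) \<omega> = x k \<omega> - \<alpha> k *\<^sub>R grad ?F (x k \<omega>) + r k" for k
        unfolding step[OF elim(5)] by (simp add: r_def noise_def mean algebra_simps)
      show "summable r"
        unfolding r_def by (intro summable_diff summable_minus 1 2)
    qed (use steps(1) in auto)
  qed
qed

end

theorem theorem5:
  fixes M :: "'a measure" and W :: "'w measure" and V :: "'v measure"
    and w :: "nat \<Rightarrow> 'a \<Rightarrow> 'w" and v :: "nat \<Rightarrow> 'a \<Rightarrow> 'v"
    and X :: "(real^'n) set"
    and f :: "real^'m \<Rightarrow> real" and g :: "real^'n \<Rightarrow> real^'m"
    and fs :: "'v \<Rightarrow> real^'m \<Rightarrow> real" and gs :: "'w \<Rightarrow> real^'n \<Rightarrow> real^'m"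
    and Gs :: "'w \<Rightarrow> real^'n \<Rightarrow> real^'m^'n"
    and Cg Cf Vg Lf :: real
    and \<alpha> \<beta> :: "nat \<Rightarrow> real"
    and x0 :: "real^'n" and y0 :: "real^'m"
    and x :: "nat \<Rightarrow> 'a \<Rightarrow> real^'n" and y :: "nat \<Rightarrow> 'a \<Rightarrow> real^'m"
  assumes assumption1: "stochastic_composition M W V w v X f g fs gs Gs Cg Cf Vg Lf"
    and steps: "\<And>k. 0 < \<alpha> k \<and> \<alpha> k \<le> 1" "\<And>k. 0 < \<beta> k \<and> \<beta> k \<le> 1"
    and sum_alpha: "filterlim (\<lambda>N. \<Sum>k<N. \<alpha> k) at_top sequentially"
    and sum_beta: "filterlim (\<lambda>N. \<Sum>k<N. \<beta> k) at_top sequentially"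
    and sum_squares: "summable (\<lambda>k. (\<alpha> k)\<^sup>2 + (\<beta> k)\<^sup>2 + (\<alpha> k)\<^sup>2 / \<beta> k)"
    and x0: "x0 \<in> X"
    and init: "\<And>\<omega>. \<omega> \<in> space M \<Longrightarrow> x 0 \<omega> = x0" "\<And>\<omega>. \<omega> \<in> space M \<Longrightarrow> y 0 \<omega> = y0"
    and y_step: "\<And>k \<omega>. \<omega> \<in> space M \<Longrightarrow>
      y (Suc k) \<omega> = (1 - \<beta> k) *\<^sub>R y k \<omega> + \<beta> k *\<^sub>R gs (w k \<omega>) (x k \<omega>)"
    and x_step: "\<And>k \<omega>. \<omega> \<in> space M \<Longrightarrow>
      x (Suc k) \<omega> = closest_point X
        (x k \<omega> - \<alpha> k *\<^sub>R (Gs (w k \<omega>) (x k \<omega>) *v grad (fs (v k \<omega>)) (y (Suc k) \<omega>)))"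
  shows "(convex_on UNIV (f \<circ> g) \<and> (\<exists>z. is_arg_min (f \<circ> g) (\<lambda>u. u \<in> X) z) \<longrightarrow>
           (\<exists>\<xi> \<in> borel_measurable M. AE \<omega> in M.
              is_arg_min (f \<circ> g) (\<lambda>u. u \<in> X) (\<xi> \<omega>) \<and> (\<lambda>k. x k \<omega>) \<longlonglongrightarrow> \<xi> \<omega>))
       \<and> ((\<forall>z. (f \<circ> g) differentiable (at z)) \<and> (\<exists>L. L-lipschitz_on UNIV (grad (f \<circ> g)))
           \<and> X = UNIV \<longrightarrow>
           (AE \<omega> in M. \<forall>xbar r. strict_mono r \<and> (\<lambda>k. x (r k) \<omega>) \<longlonglongrightarrow> xbar
              \<longrightarrow> grad (f \<circ> g) xbar = 0))"
proof -
  interpret stochastic_composition M W V w v X f g fs gs Gs Cg Cf Vg Lf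
    by (rule assumption1)
  interpret scgd M W V w v X f g fs gs Gs Cg Cf Vg Lf \<alpha> \<beta> x0 y0 x y
    by unfold_locales (fact steps sum_alpha sum_squares x0 init y_step x_step)+
  show ?thesis
  proof (intro conjI impI)
    assume "convex_on UNIV (f \<circ> g) \<and> (\<exists>z. is_arg_min (f \<circ> g) (\<lambda>u. u \<in> X) z)"
    then have "AE \<omega> in M. \<exists>l. is_arg_min (f \<circ> g) (\<lambda>u. u \<in> X) l \<and> (\<lambda>k. x k \<omega>) \<longlonglongrightarrow> l"
      using convex_convergence by blast
    \<comment> \<open>A pointwise choice of \<open>l\<close> need not be measurable.
      \<open>lim\<close> is measurable in \<open>\<omega>\<close> and agrees with \<open>l\<close>
      wherever the iterates converge.\<close>
    then have "AE \<omega> in M. is_arg_min (f \<circ> g) (\<lambda>u. u \<in> X) (lim (\<lambda>k. x k \<omega>)) \<and>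
        (\<lambda>k. x k \<omega>) \<longlonglongrightarrow> lim (\<lambda>k. x k \<omega>)"
      by eventually_elim (auto simp: limI)
    moreover have "(\<lambda>\<omega>. lim (\<lambda>k. x k \<omega>)) \<in> borel_measurable M"
      by (rule borel_measurable_lim_metric) measurable
    ultimately show "\<exists>\<xi>\<in>borel_measurable M. AE \<omega> in M.
        is_arg_min (f \<circ> g) (\<lambda>u. u \<in> X) (\<xi> \<omega>) \<and> (\<lambda>k. x k \<omega>) \<longlonglongrightarrow> \<xi> \<omega>"
      by (intro bexI[of _ "\<lambda>\<omega>. lim (\<lambda>k. x k \<omega>)"])
  next
    assume smooth: "(\<forall>z. (f \<circ> g) differentiable (at z)) \<and> (\<exists>L. L-lipschitz_on UNIV (grad (f \<circ> g))) \<and> X = UNIV"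
    then obtain L where L: "L-lipschitz_on UNIV (grad (f \<circ> g))"
      by blast
    have "AE \<omega> in M. (\<lambda>k. grad (f \<circ> g) (x k \<omega>)) \<longlonglongrightarrow> 0"
      using smooth L by (intro gradient_tendsto_0) auto
    then show "AE \<omega> in M. \<forall>xbar r. strict_mono r \<and> (\<lambda>k. x (r k) \<omega>) \<longlonglongrightarrow> xbar \<longrightarrow> grad (f \<circ> g) xbar = 0"
    proof eventually_elim
      case (elim \<omega>)
      show ?case
      proof (intro allI impI, elim conjE)
        fix xbar and r :: "nat \<Rightarrow> nat"
        assume r: "strict_mono r" and lim: "(\<lambda>k. x (r k) \<omega>) \<longlonglongrightarrow> xbar"
        have "(\<lambda>k. grad (f \<circ> g) (x (r k) \<omega>)) \<longlonglongrightarrow> 0"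
          using LIMSEQ_subseq_LIMSEQ[OF elim r] by (simp only: comp_def)
        moreover have "(\<lambda>k. grad (f \<circ> g) (x (r k) \<omega>)) \<longlonglongrightarrow> grad (f \<circ> g) xbar"
          using lipschitz_on_continuous_on[OF L] lim by (rule continuous_on_tendsto_compose) auto
        ultimately show "grad (f \<circ> g) xbar = 0"
          using LIMSEQ_unique by blast
      qed
    qed
  qed
qed

end
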